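(* Let $\Omega\subset\mathbb{R}^N$ be an open bounded convex set and let $1<p<\infty$. Then \[ \mu_{p,p}(\Omega)<\lambda_{p,p}(B)\left(\frac{|B|}{|\Omega|}\right)^{\frac{p}{N}}, \] where $B$ is any $N$-dimensional ball.
   Context: For an open bounded Lipschitz set $\Omega\subset\mathbb{R}^N$ and $1<p<\infty$, define \[ \mu_{p,p}(\Omega)=\inf_{v\in W^{1,p}(\Omega)\setminus\{0\}}\left\{\frac{\int_\Omega|\nabla v|^p\,dx}{\int_\Omega|v|^p\,dx}\ :\ \int_\Omega|v|^{p-2}v\,dx=0\right\} \] and \[ \lambda_{p,p}(\Omega)=\inf_{v\in W^{1,p}_0(\Omega)\setminus\{0\}}\frac{\int_\Omega|\nabla v|^p\,dx}{\int_\Omega|v|^p\,dx}. \] Here $W^{1,p}_0(\Omega)$ is the completion of $C_0^\infty(\Omega)$ in the norm of $W^{1,p}(\Omega)$. $|\cdot|$ applied to a set denotes $N$-dimensional Lebesgue measure.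
   Formalization: The dimension is assumed to satisfy N ≥ 2 and Ω is assumed nonempty; for N = 1 every Ω is an interval and the two sides are equal, so the strict inequality fails there. *)

theory Defs
  imports "HOL-Analysis.Analysis"
begin

definition grad :: "('a::euclidean_space \<Rightarrow> real) \<Rightarrow> 'a \<Rightarrow> 'a"
  where "grad f x = (\<Sum>b\<in>Basis. frechet_derivative f (at x) b *\<^sub>R b)"

primrec C_k :: "nat \<Rightarrow> ('a::euclidean_space \<Rightarrow> real) \<Rightarrow> bool"
  where
    "C_k 0 f \<longleftrightarrow> continuous_on UNIV f"
  | "C_k (Suc k) f \<longleftrightarrow>
      (\<forall>x. f differentiable (at x)) \<and>
      (\<forall>b\<in>Basis. C_k k (\<lambda>x. frechet_derivative f (at x) b))"

text \<open>The elements of \<open>C\<^sub>0\<^sup>\<infinity>(\<Omega>)\<close>, extended by zero to the whole space.\<close>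

definition test_functions :: "'a::euclidean_space set \<Rightarrow> ('a \<Rightarrow> real) set"
  where "test_functions \<Omega> =
    {\<phi>. (\<forall>k. C_k k \<phi>) \<and> compact (closure {x. \<phi> x \<noteq> 0}) \<and> closure {x. \<phi> x \<noteq> 0} \<subseteq> \<Omega>}"

definition L_space :: "real \<Rightarrow> 'a::euclidean_space set \<Rightarrow> ('a \<Rightarrow> 'b::euclidean_space) set"
  where "L_space p \<Omega> =
    {f \<in> borel_measurable (lebesgue_on \<Omega>). integrable (lebesgue_on \<Omega>) (\<lambda>x. norm (f x) powr p)}"

text \<open>
  Functions are not identified when they agree almost everywhere, and only their values on \<open>\<Omega>\<close>
  matter. An element of \<open>W\<^sup>1\<^sup>,\<^sup>p(\<Omega>)\<close> is represented by a pair \<open>(v, g)\<close>, where \<open>g\<close> is a version of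
  the weak gradient of \<open>v\<close>. On open \<open>\<Omega>\<close> it is determined by \<open>v\<close> almost everywhere, so the
  integrals of \<open>g\<close> below do not depend on the version. The two integrals below converge for
  \<open>p \<ge> 1\<close>, since \<open>v\<close> and \<open>g\<close> are then locally integrable.
\<close>

definition W1 :: "real \<Rightarrow> 'a::euclidean_space set \<Rightarrow> (('a \<Rightarrow> real) \<times> ('a \<Rightarrow> 'a)) set"
  where "W1 p \<Omega> = {(v, g). v \<in> L_space p \<Omega> \<and> g \<in> L_space p \<Omega> \<and>
    (\<forall>\<phi>\<in>test_functions \<Omega>.
      (\<integral>x. v x *\<^sub>R grad \<phi> x \<partial>lebesgue_on \<Omega>) = - (\<integral>x. \<phi> x *\<^sub>R g x \<partial>lebesgue_on \<Omega>))}"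

definition W1_norm ::
    "real \<Rightarrow> 'a::euclidean_space set \<Rightarrow> ('a \<Rightarrow> real) \<Rightarrow> ('a \<Rightarrow> 'a) \<Rightarrow> real"
  where "W1_norm p \<Omega> v g =
    ((\<integral>x. \<bar>v x\<bar> powr p \<partial>lebesgue_on \<Omega>) + (\<integral>x. norm (g x) powr p \<partial>lebesgue_on \<Omega>)) powr (1 / p)"

text \<open>
  As \<open>W\<^sup>1\<^sup>,\<^sup>p(\<Omega>)\<close> is complete, the completion of \<open>C\<^sub>0\<^sup>\<infinity>(\<Omega>)\<close> is its closure in \<open>W\<^sup>1\<^sup>,\<^sup>p(\<Omega>)\<close>.
\<close>

definition W1_0 :: "real \<Rightarrow> 'a::euclidean_space set \<Rightarrow> (('a \<Rightarrow> real) \<times> ('a \<Rightarrow> 'a)) set"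
  where "W1_0 p \<Omega> = {(v, g) \<in> W1 p \<Omega>. \<exists>\<phi>. (\<forall>n::nat. \<phi> n \<in> test_functions \<Omega>) \<and>
    (\<lambda>n. W1_norm p \<Omega> (\<lambda>x. \<phi> n x - v x) (\<lambda>x. grad (\<phi> n) x - g x)) \<longlonglongrightarrow> 0}"

definition rayleigh ::
    "real \<Rightarrow> 'a::euclidean_space set \<Rightarrow> ('a \<Rightarrow> real) \<Rightarrow> ('a \<Rightarrow> 'a) \<Rightarrow> real"
  where "rayleigh p \<Omega> v g =
    (\<integral>x. norm (g x) powr p \<partial>lebesgue_on \<Omega>) / (\<integral>x. \<bar>v x\<bar> powr p \<partial>lebesgue_on \<Omega>)"

text \<open>
  The infima are taken in the extended reals, so that the infimum of the empty set is \<open>\<infinity>\<close>.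
  Being nonzero means not vanishing almost everywhere. In \<open>\<mu>\<close>, the integrand \<open>\<bar>v\<bar>\<^sup>p\<^sup>-\<^sup>2 v\<close> is zero
  where \<open>v\<close> is, also for \<open>p < 2\<close>.
\<close>

definition mu :: "real \<Rightarrow> 'a::euclidean_space set \<Rightarrow> ereal"
  where "mu p \<Omega> = Inf {ereal (rayleigh p \<Omega> v g) | v g.
    (v, g) \<in> W1 p \<Omega> \<and> \<not> (AE x in lebesgue_on \<Omega>. v x = 0) \<and>
    (\<integral>x. \<bar>v x\<bar> powr (p - 2) * v x \<partial>lebesgue_on \<Omega>) = 0}"

definition lambda :: "real \<Rightarrow> 'a::euclidean_space set \<Rightarrow> ereal"
  where "lambda p \<Omega> = Inf {ereal (rayleigh p \<Omega> v g) | v g.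
    (v, g) \<in> W1_0 p \<Omega> \<and> \<not> (AE x in lebesgue_on \<Omega>. v x = 0)}"

end

theory Submission
  imports Defs
begin

text \<open>
  Let \<open>2R\<close> be the diameter of \<open>\<Omega>\<close>, attained at \<open>a, b \<in> closure \<Omega>\<close>, and let \<open>\<phi>\<close> be the radial first
  Dirichlet eigenfunction of a ball of radius \<open>R\<close>, with eigenvalue \<open>\<Lambda>\<close>. As \<open>\<Omega>\<close> is starshaped with
  respect to \<open>a\<close>, the divergence theorem gives \<open>\<integral>\<bar>\<nabla>u\<bar>\<^sup>p \<le> \<Lambda> \<integral>u\<^sup>p\<close> over \<open>\<Omega>\<close> for \<open>u(x) = \<phi>(\<bar>x - a\<bar>)\<close>, and
  likewise at \<open>b\<close>. The two functions have disjoint supports, so a combination with opposite signs is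
  admissible for \<open>\<mu>\<close> and \<open>\<mu>(\<Omega>) \<le> \<Lambda>\<close>. The isodiametric inequality \<open>\<bar>\<Omega>\<bar> \<le> \<bar>B\<^sub>R\<bar>\<close> then gives the weak
  inequality, and the strict one if \<open>\<bar>\<Omega>\<bar> < \<bar>B\<^sub>R\<bar>\<close>. If \<open>\<bar>\<Omega>\<bar> = \<bar>B\<^sub>R\<bar>\<close>, then \<open>\<Omega>\<close> has width \<open>2R\<close> in every
  direction; hence near \<open>a\<close> it is not a cone, and the energy inequality at \<open>a\<close> is strict.

  The eigenfunction is replaced by the solution of the Riccati equation
  \<open>w' = \<Lambda> + (p - 1) w\<^sup>q - (N - 1) w/\<rho>\<close> with \<open>q = p/(p - 1)\<close> for \<open>w = (- \<phi>'/\<phi>)\<^sup>p\<^sup>-\<^sup>1\<close>, which is the limit of a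
  monotone iteration and blows up at \<open>R\<close>. It also bounds \<open>\<lambda>\<close> of the ball from below, by Picone's
  argument. The divergence theorem is only used for fields \<open>K(x) x\<close>, where it amounts to scaling.
\<close>

text \<open>The obstacle is strictness. Off the equality case of the isodiametric inequality the
  volume ratio supplies it. If \<open>|\<Omega>| = |B_R|\<close>, Brunn-Minkowski only says that the
  differences of points of the closure of \<Omega> fill the ball of radius 2R, and this has to
  exclude that \<Omega> is a cone at a up to some fixed distance. The argument takes a direction
  orthogonal to the diameter, hence dimension at least 2; in dimension one both sides of the claim
  agree for every interval.

  The field behind the energy inequality is - u |grad u|^(p-2) grad u, with divergence \<Lambda> u^p
  - |grad u|^p. It points away from a, so its flux through the boundary of \<Omega> is outward.
  Working with w makes this field explicit: it is u^p F with F(x) = h(|x|) x, and the same F serves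
  for arbitrary test functions on the ball. Scaling gives \<Lambda> R^p the same value for all R,
  which converts the bound at radius R into one in terms of B.\<close>

section \<open>The radial eigenfunction\<close>

text \<open>The iterates converge to \<open>h = w/\<rho>\<close> for \<open>\<Lambda> = 1\<close>. The Riccati equation is integrated in the form
  \<open>(\<rho>\<^sup>N h)' = \<rho>\<^sup>N\<^sup>-\<^sup>1 (1 + (p - 1) (\<rho> h)\<^sup>q)\<close> and rescaled to the unit interval, which removes the
  singularity at \<open>\<rho> = 0\<close> and makes monotonicity in \<open>\<rho>\<close> and in the iteration index evident.\<close>

primrec riccati_iter :: "nat \<Rightarrow> real \<Rightarrow> nat \<Rightarrow> real \<Rightarrow> real" where
  "riccati_iter N p 0 = (\<lambda>_. 0)"
| "riccati_iter N p (Suc k) = (\<lambda>\<rho>. integral {0..1}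
     (\<lambda>t. t ^ (N - 1) * (1 + (p - 1) * (\<rho> * t * riccati_iter N p k (\<rho> * t)) powr (p / (p - 1)))))"

section \<open>The iterates, their limit and its blow-up\<close>

locale riccati =
  fixes N :: nat and p :: real
  assumes N: "N \<ge> 1" and p: "p > 1"
begin

definition "q = p / (p - 1)"

abbreviation "h \<equiv> riccati_iter N p"

definition "rhs f s = 1 + (p - 1) * (s * f s) powr q" for f :: "real \<Rightarrow> real"

lemma q: "q > 1" "q > 0"
  using p by (auto simp: q_def field_simps)

lemma h_Suc: "h (Suc k) \<rho> = integral {0..1} (\<lambda>t. t ^ (N - 1) * rhs (h k) (\<rho> * t))"
  by (simp add: rhs_def q_def)

declare riccati_iter.simps(2) [simp del]

text \<open>The two claims need one induction: \<open>powr\<close> is continuous up to the value 0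
  only along nonnegative bases, so continuity of the next iterate uses the sign of the current
  one.\<close>

lemma h_cont_nonneg: "continuous_on {0..} (h k) \<and> (\<forall>\<rho>\<ge>0. 0 \<le> h k \<rho>)"
proof (induction k)
  case (Suc k)
  have c: "continuous_on {0..} (\<lambda>s. rhs (h k) s)"
    unfolding rhs_def using conjunct1[OF Suc] conjunct2[OF Suc] q by (intro continuous_on_mult continuous_on_add continuous_on_power continuous_on_const continuous_on_id continuous_on_powr') auto
  have "continuous_on ({0..} \<times> cbox 0 1) (\<lambda>(\<rho>, t). t ^ (N - 1) * rhs (h k) (\<rho> * t))"
    unfolding case_prod_unfold
    by (intro continuous_intros continuous_on_compose2[OF c]) auto
  from integral_continuous_on_param[OF this]
  have "continuous_on {0..} (h (Suc k))"
    by (simp add: h_Suc[abs_def])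
  moreover have "0 \<le> h (Suc k) \<rho>" if "0 \<le> \<rho>" for \<rho>
  proof -
    have "(\<lambda>t. t ^ (N - 1) * rhs (h k) (\<rho> * t)) integrable_on {0..1}"
      using that by (intro integrable_continuous_real continuous_intros continuous_on_compose2[OF c]) auto
    moreover have "0 \<le> rhs (h k) s" for s
      unfolding rhs_def using p by (auto intro!: add_nonneg_nonneg mult_nonneg_nonneg)
    ultimately show ?thesis
      unfolding h_Suc by (intro Henstock_Kurzweil_Integration.integral_nonneg) auto
  qed
  ultimately show ?case by blast
qed auto

lemma h_nonneg: "0 \<le> \<rho> \<Longrightarrow> 0 \<le> h k \<rho>"
  using h_cont_nonneg by blast

lemma h_cont: "continuous_on {0..} (h k)"
  using h_cont_nonneg by blast

lemma rhs_cont: "continuous_on {0..} (rhs (h k))"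
  unfolding rhs_def using h_cont h_nonneg q by (intro continuous_on_mult continuous_on_add continuous_on_power continuous_on_const continuous_on_id continuous_on_powr') auto

lemma rhs_mono: "rhs f s \<le> rhs g t" if "0 \<le> s" "s \<le> t" "0 \<le> f s" "f s \<le> g t"
  unfolding rhs_def using that p q
  by (intro add_left_mono mult_left_mono powr_mono2 mult_mono) auto

lemma rhs_ge_1: "1 \<le> rhs f s"
  unfolding rhs_def using p by auto

lemma h_integrable: "0 \<le> \<rho> \<Longrightarrow> (\<lambda>t. t ^ (N - 1) * rhs (h k) (\<rho> * t)) integrable_on {0..1}"
  by (intro integrable_continuous_real continuous_intros continuous_on_compose2[OF rhs_cont]) auto

lemma h_mono: "0 \<le> \<rho> \<Longrightarrow> \<rho> \<le> \<sigma> \<Longrightarrow> h k \<rho> \<le> h k \<sigma>"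
proof (induction k arbitrary: \<rho> \<sigma>)
  case (Suc k)
  show ?case unfolding h_Suc
    using Suc by (intro integral_le h_integrable mult_left_mono rhs_mono h_nonneg Suc.IH mult_nonneg_nonneg mult_right_mono) auto
qed auto

lemma h_step: "0 \<le> \<rho> \<Longrightarrow> h k \<rho> \<le> h (Suc k) \<rho>"
proof (induction k arbitrary: \<rho>)
  case 0
  then show ?case using h_nonneg by auto
next
  case (Suc k)
  show ?case unfolding h_Suc[of "Suc k" \<rho>] h_Suc[of k \<rho>]
    using Suc by (intro integral_le h_integrable mult_left_mono rhs_mono h_nonneg Suc.IH mult_nonneg_nonneg) auto
qed

text \<open>Undoes the rescaling to the unit interval by the substitution
  \<open>s = \<rho> t\<close>: the weight contributes \<open>\<rho> ^ (N - 1)\<close>, the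
  substitution one more factor.\<close>

lemma rescale_integral:
  fixes f :: "real \<Rightarrow> real" and \<rho> I :: real
  assumes "0 < \<rho>" and "((\<lambda>t. t ^ (N - 1) * f (\<rho> * t)) has_integral I) {0..1}"
  shows "((\<lambda>s. s ^ (N - 1) * f s) has_integral \<rho> ^ N * I) {0..\<rho>}"
proof -
  have im: "(\<lambda>x. x / (1 / \<rho>)) ` {0..1} = {0..\<rho>}"
    using image_mult_atLeastAtMost[OF assms(1), of 0 1] by (simp add: mult.commute)
  have "((\<lambda>s. (1 / \<rho> * s) ^ (N - 1) * f (\<rho> * (1 / \<rho> * s))) has_integral \<rho> * I) {0..\<rho>}"
    using has_integral_stretch_real[OF assms(2), of "1 / \<rho>"] assms(1) unfolding im by simp
  then have "((\<lambda>s. \<rho> ^ (N - 1) * ((1 / \<rho> * s) ^ (N - 1) * f (\<rho> * (1 / \<rho> * s)))) has_integral \<rho> ^ (N - 1) * (\<rho> * I)) {0..\<rho>}"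
    by (rule has_integral_mult_right)
  moreover have "\<rho> ^ (N - 1) * (\<rho> * I) = \<rho> ^ N * I"
    using N by (cases N) auto
  moreover have "\<rho> ^ (N - 1) * ((1 / \<rho> * s) ^ (N - 1) * f (\<rho> * (1 / \<rho> * s))) = s ^ (N - 1) * f s" for s
    using assms(1) by (simp add: power_divide)
  ultimately show ?thesis
    by (simp only:)
qed

lemma h_Suc_has_integral:
  assumes "0 < \<rho>"
  shows "((\<lambda>s. s ^ (N - 1) * rhs (h k) s) has_integral \<rho> ^ N * h (Suc k) \<rho>) {0..\<rho>}"
  using rescale_integral[OF assms, of "rhs (h k)"] h_integrable[of \<rho> k] assms
  by (simp add: h_Suc integrable_integral)

text \<open>The interval of existence of the solution. As the iterates increase with the index,
  boundedness at a radius decides convergence there, and monotonicity in \<open>\<rho>\<close>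
  passes it on to smaller radii. Nothing is presupposed about the length of the interval.\<close>

definition "convergence_set = {\<rho>. 0 \<le> \<rho> \<and> bdd_above (range (\<lambda>k. h k \<rho>))}"

definition "H \<rho> = (SUP k. h k \<rho>)"

lemma convergence_set_down: "\<sigma> \<in> convergence_set \<Longrightarrow> 0 \<le> \<rho> \<Longrightarrow> \<rho> \<le> \<sigma> \<Longrightarrow> \<rho> \<in> convergence_set"
proof -
  assume a: "\<sigma> \<in> convergence_set" "0 \<le> \<rho>" "\<rho> \<le> \<sigma>"
  then obtain M where "\<And>k. h k \<sigma> \<le> M"
    unfolding convergence_set_def bdd_above_def by blast
  then have "h k \<rho> \<le> M" for k
    using h_mono[OF a(2,3), of k] order_trans by blast
  then show ?thesis using a unfolding convergence_set_def bdd_above_def by blast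
qed

lemma h_le_H: "\<rho> \<in> convergence_set \<Longrightarrow> h k \<rho> \<le> H \<rho>"
  unfolding H_def convergence_set_def by (rule cSUP_upper) simp_all

lemma H_mono: "\<sigma> \<in> convergence_set \<Longrightarrow> 0 \<le> \<rho> \<Longrightarrow> \<rho> \<le> \<sigma> \<Longrightarrow> H \<rho> \<le> H \<sigma>"
  unfolding H_def by (rule cSUP_mono) (auto simp: convergence_set_def intro!: exI h_mono)

lemma H_nonneg: "\<rho> \<in> convergence_set \<Longrightarrow> 0 \<le> H \<rho>"
  using h_le_H[of \<rho> 0] by simp

lemma h_lim: "\<rho> \<in> convergence_set \<Longrightarrow> (\<lambda>k. h k \<rho>) \<longlonglongrightarrow> H \<rho>"
  unfolding H_def
  by (intro LIMSEQ_incseq_SUP) (auto simp: convergence_set_def incseq_Suc_iff intro!: h_step)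

text \<open>Monotone convergence is applied on the unit interval, where the integrands increase with
  the index; the limit equation is rescaled only afterwards.\<close>

lemma H_integral:
  assumes "0 < \<rho>" "\<rho> \<in> convergence_set"
  shows "((\<lambda>s. s ^ (N - 1) * rhs H s) has_integral \<rho> ^ N * H \<rho>) {0..\<rho>}"
proof -
  let ?f = "\<lambda>k t. t ^ (N - 1) * rhs (h k) (\<rho> * t)"
  have d: "\<rho> * t \<in> convergence_set" if "t \<in> {0..1}" for t
    using convergence_set_down[OF assms(2), of "\<rho> * t"] that assms(1) by (auto simp: mult_le_cancel_left1)
  have "bounded (range (\<lambda>k. integral {0..1} (?f k)))"
    unfolding bounded_iff
  proof (intro exI[of _ "H \<rho>"] ballI)
    fix x assume "x \<in> range (\<lambda>k. integral {0..1} (?f k))"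
    then obtain k where "x = h (Suc k) \<rho>" by (auto simp: h_Suc)
    then show "norm x \<le> H \<rho>" using h_le_H[OF assms(2)] h_nonneg[of \<rho> "Suc k"] assms by auto
  qed
  moreover have "?f k t \<le> ?f (Suc k) t" if "t \<in> {0..1}" for k t
    using that assms(1) by (intro mult_left_mono rhs_mono h_step h_nonneg) auto
  moreover have "(\<lambda>k. ?f k t) \<longlonglongrightarrow> t ^ (N - 1) * rhs H (\<rho> * t)" if "t \<in> {0..1}" for t
    unfolding rhs_def using that assms(1) q h_nonneg
    by (intro tendsto_intros tendsto_powr' h_lim d) auto
  ultimately have m: "(\<lambda>t. t ^ (N - 1) * rhs H (\<rho> * t)) integrable_on {0..1} \<and>
      (\<lambda>k. integral {0..1} (?f k)) \<longlonglongrightarrow> integral {0..1} (\<lambda>t. t ^ (N - 1) * rhs H (\<rho> * t))"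
    using h_integrable[of \<rho>] assms(1) by (intro monotone_convergence_increasing) auto
  have "(\<lambda>k. h (Suc k) \<rho>) \<longlonglongrightarrow> H \<rho>"
    using h_lim[OF assms(2)] by (rule LIMSEQ_Suc)
  with m have "integral {0..1} (\<lambda>t. t ^ (N - 1) * rhs H (\<rho> * t)) = H \<rho>"
    unfolding h_Suc using LIMSEQ_unique by blast
  with m show ?thesis using rescale_integral[OF assms(1), of "rhs H" "H \<rho>"] by (auto simp: has_integral_iff)
qed


text \<open>\<open>\<rho>0\<close> solves \<open>(p - 1) * (2 * \<rho>0) powr q = 1\<close>. Up to
  this radius, a bound 2 for one iterate makes the right-hand side at most 2, which is again the
  bound 2 for the next iterate.\<close>

lemma small_in_convergence_set: "\<exists>\<rho>>0. \<rho> \<in> convergence_set"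
proof -
  define \<rho>0 where "\<rho>0 = (1 / (p - 1)) powr (1 / q) / 2"
  have pos: "\<rho>0 > 0" using p by (simp add: \<rho>0_def)
  have eq: "(2 * \<rho>0) powr q = 1 / (p - 1)"
    using p q by (simp add: \<rho>0_def powr_powr)
  have "h k \<rho> \<le> 2" if "0 \<le> \<rho>" "\<rho> \<le> \<rho>0" for k \<rho>
    using that
  proof (induction k arbitrary: \<rho>)
    case (Suc k)
    have "t ^ (N - 1) * rhs (h k) (\<rho> * t) \<le> 1 * 2" if t: "t \<in> {0..1}" for t
    proof (rule mult_mono)
      have 1: "0 \<le> \<rho> * t" using Suc.prems t by auto
      have 2: "\<rho> * t \<le> \<rho>0" using mult_mono[of \<rho> \<rho>0 t 1] Suc.prems t pos by auto
      have "(\<rho> * t * h k (\<rho> * t)) powr q \<le> (2 * \<rho>0) powr q"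
        using mult_mono[OF 2 Suc.IH[OF 1 2]] h_nonneg[OF 1] 1 pos q
        by (intro powr_mono2) (auto simp: mult.commute)
      then have "(p - 1) * (\<rho> * t * h k (\<rho> * t)) powr q \<le> (p - 1) * (1 / (p - 1))"
        unfolding eq using p by (intro mult_left_mono) auto
      then show "rhs (h k) (\<rho> * t) \<le> 2" unfolding rhs_def using p by simp
      show "0 \<le> rhs (h k) (\<rho> * t)" using rhs_ge_1[of "h k" "\<rho> * t"] by simp
    qed (use t in \<open>auto intro: power_le_one\<close>)
    then have "h (Suc k) \<rho> \<le> integral {0..1} (\<lambda>_::real. 2)"
      unfolding h_Suc using Suc.prems by (intro integral_le h_integrable) auto
    then show ?case by simp
  qed auto
  then have "\<rho>0 \<in> convergence_set" using pos unfolding convergence_set_def bdd_above_def by (auto intro!: exI[of _ 2])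
  then show ?thesis using pos by blast
qed

text \<open>Already the first iterate is at least the integral of \<open>t ^ (N - 1)\<close> over
  the unit interval. The bound is uniform down to the origin and is the source of
  \<open>h_pos\<close> in the radial profile.\<close>

lemma H_pos: assumes "\<rho> \<in> convergence_set" shows "1 / real N \<le> H \<rho>"
proof -
  have r: "0 \<le> \<rho>" using assms by (simp add: convergence_set_def)
  have "((\<lambda>t::real. t ^ (N - 1)) has_integral (1 ^ N / real N - 0 ^ N / real N)) {0..1}"
    using N by (intro fundamental_theorem_of_calculus)
      (auto intro!: derivative_eq_intros simp flip: has_real_derivative_iff_has_vector_derivative)
  then have *: "((\<lambda>t::real. t ^ (N - 1)) has_integral (1 / real N)) {0..1}"
    using N by (simp add: zero_power)
  have "1 / real N \<le> h (Suc 0) \<rho>"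
    unfolding h_Suc using r rhs_ge_1
    by (intro has_integral_le[OF * integrable_integral[OF h_integrable]])
       (auto intro!: mult_le_cancel_left1[THEN iffD2])
  with h_le_H[OF assms, of "Suc 0"] show ?thesis by simp
qed

text \<open>\<open>s * H s\<close> is the quantity that enters the equation. Away from 0 the
  integral equation gives continuity; at 0, where that formula divides by \<open>\<rho> ^ N\<close>,
  the function is squeezed between 0 and \<open>s * H \<sigma>\<close>.\<close>

lemma times_H_cont:
  assumes "\<sigma> \<in> convergence_set"
  shows "continuous_on {0..\<sigma>} (\<lambda>s. s * H s)"
proof (cases "\<sigma> = 0")
  case False
  then have s: "0 < \<sigma>" using assms by (auto simp: convergence_set_def)
  have "(\<lambda>s. s ^ (N - 1) * rhs H s) integrable_on {0..\<sigma>}"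
    using H_integral[OF s assms] by blast
  then have c: "continuous_on {0..\<sigma>} (\<lambda>\<rho>. integral {0..\<rho>} (\<lambda>s. s ^ (N - 1) * rhs H s))"
    by (rule indefinite_integral_continuous_1)
  have "continuous_on {0<..\<sigma>} (\<lambda>\<rho>. \<rho> * (integral {0..\<rho>} (\<lambda>s. s ^ (N - 1) * rhs H s) / \<rho> ^ N))"
    by (intro continuous_intros continuous_on_subset[OF c]) auto
  moreover have "\<rho> * (integral {0..\<rho>} (\<lambda>s. s ^ (N - 1) * rhs H s) / \<rho> ^ N) = \<rho> * H \<rho>" if "\<rho> \<in> {0<..\<sigma>}" for \<rho>
    using H_integral[of \<rho>] convergence_set_down[OF assms, of \<rho>] that by (auto simp: has_integral_iff)
  ultimately have c1: "continuous_on {0<..\<sigma>} (\<lambda>s. s * H s)"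
    by (rule continuous_on_eq)
  show ?thesis unfolding continuous_on_eq_continuous_within
  proof
    fix x assume x: "x \<in> {0..\<sigma>}"
    show "continuous (at x within {0..\<sigma>}) (\<lambda>s. s * H s)"
    proof (cases "x = 0")
      case True
      have "((\<lambda>s. s * H s) \<longlongrightarrow> 0) (at 0 within {0..\<sigma>})"
      proof (rule tendsto_sandwich)
        show "\<forall>\<^sub>F s in at 0 within {0..\<sigma>}. 0 \<le> s * H s"
          unfolding eventually_at_filter using convergence_set_down[OF assms] H_nonneg by (auto intro!: eventuallyI)
        show "\<forall>\<^sub>F s in at 0 within {0..\<sigma>}. s * H s \<le> s * H \<sigma>"
          unfolding eventually_at_filter using H_mono[OF assms] by (auto intro!: eventuallyI mult_left_mono)
        show "((\<lambda>s. s * H \<sigma>) \<longlongrightarrow> 0) (at 0 within {0..\<sigma>})"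
          by (rule tendsto_eq_intros | simp)+
      qed simp
      then show ?thesis using True by (simp add: continuous_within)
    next
      case False
      with x have "x \<in> {0<..\<sigma>}" by auto
      with c1 have "continuous (at x within {0<..\<sigma>}) (\<lambda>s. s * H s)"
        by (simp add: continuous_on_eq_continuous_within)
      moreover have "at x within {0<..\<sigma>} = at x within {0..\<sigma>}"
        using False x by (intro at_within_nhd[of _ "{0<..}"]) auto
      ultimately show ?thesis by (simp add: continuous_within)
    qed
  qed
qed simp

text \<open>\<open>s ^ N * H s\<close> is an indefinite integral of a continuous function. The room
  up to \<open>\<sigma>\<close> makes the derivative two-sided.\<close>

lemma Z_deriv:
  assumes "0 < \<rho>" "\<rho> < \<sigma>" "\<sigma> \<in> convergence_set"
  shows "((\<lambda>s. s ^ N * H s) has_real_derivative \<rho> ^ (N - 1) * rhs H \<rho>) (at \<rho>)"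
proof -
  have "continuous_on {0..\<sigma>} (\<lambda>s. s ^ (N - 1) * rhs H s)"
    unfolding rhs_def using q H_nonneg convergence_set_down[OF assms(3)]
    by (intro continuous_on_mult continuous_on_add continuous_on_power continuous_on_const continuous_on_id continuous_on_powr' times_H_cont[OF assms(3)]) auto
  from integral_has_real_derivative[OF this, of \<rho>] assms
  have "((\<lambda>x. integral {0..x} (\<lambda>s. s ^ (N - 1) * rhs H s)) has_real_derivative \<rho> ^ (N - 1) * rhs H \<rho>) (at \<rho> within {0..\<sigma>})"
    by auto
  then have "((\<lambda>x. integral {0..x} (\<lambda>s. s ^ (N - 1) * rhs H s)) has_real_derivative \<rho> ^ (N - 1) * rhs H \<rho>) (at \<rho>)"
    using assms by (simp add: at_within_Icc_at)
  then show ?thesis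
  proof (rule has_field_derivative_transform_within_open[where S = "{0<..<\<sigma>}"])
    show "integral {0..x} (\<lambda>s. s ^ (N - 1) * rhs H s) = x ^ N * H x" if "x \<in> {0<..<\<sigma>}" for x
      using H_integral[of x] convergence_set_down[OF assms(3), of x] that by (auto simp: has_integral_iff)
  qed (use assms in auto)
qed

lemma H_deriv:
  assumes "0 < \<rho>" "\<rho> < \<sigma>" "\<sigma> \<in> convergence_set"
  shows "(H has_real_derivative (rhs H \<rho> - real N * H \<rho>) / \<rho>) (at \<rho>)"
proof -
  have eq: "\<rho> ^ N = \<rho> * \<rho> ^ (N - 1)" using N by (cases N) auto
  have "((\<lambda>s. (s ^ N * H s) / s ^ N) has_real_derivative
     (\<rho> ^ (N - 1) * rhs H \<rho> * \<rho> ^ N - \<rho> ^ N * H \<rho> * (real N * \<rho> ^ (N - 1))) / (\<rho> ^ N * \<rho> ^ N)) (at \<rho>)"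
    using assms(1) by (intro DERIV_divide Z_deriv[OF assms]) (auto intro!: derivative_eq_intros)
  also have "(\<rho> ^ (N - 1) * rhs H \<rho> * \<rho> ^ N - \<rho> ^ N * H \<rho> * (real N * \<rho> ^ (N - 1))) / (\<rho> ^ N * \<rho> ^ N)
      = (rhs H \<rho> - real N * H \<rho>) / \<rho>"
    using assms(1) unfolding eq by (simp add: field_simps)
  finally show ?thesis
    by (rule has_field_derivative_transform_within_open[where S = "{0<..}"]) (use assms(1) in auto)
qed

text \<open>For \<open>w = \<rho> H\<close> one has
  \<open>w' = 1 + (p - 1) w^q - (N - 1) w / \<rho>\<close>. Far out the last term uses up at most
  the 1 and half of the power, so \<open>w' \<ge> (p - 1) w^q / 2\<close>, and
  \<open>w^(1 - q)\<close> falls at rate at least 1/2 because \<open>(q - 1) (p - 1) = 1\<close>. A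
  positive function cannot do so forever.\<close>

lemma convergence_set_bounded: "\<exists>B. \<forall>\<rho>\<in>convergence_set. \<rho> \<le> B"
proof (rule ccontr)
  assume "\<not> ?thesis"
  then have all: "\<rho> \<in> convergence_set" if "0 \<le> \<rho>" for \<rho>
    using convergence_set_down that by (meson not_le less_imp_le)
  \<comment> \<open>The second summand gives \<open>(N - 1) / s \<le> 1\<close>, which settles the
    case \<open>w s \<le> 1\<close>; the third gives \<open>(N - 1) / s \<le> (p - 1) / 2\<close>
    for the other case. The summand 1 keeps \<open>\<rho>1\<close> positive.\<close>
  define \<rho>1 where "\<rho>1 = 1 + (real N - 1) + 2 * (real N - 1) / (p - 1)"
  have a: "(real N - 1) \<ge> 0" "2 * (real N - 1) / (p - 1) \<ge> 0" using N p by auto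
  have r1: "\<rho>1 > 0" "\<rho>1 \<ge> real N - 1" "\<rho>1 \<ge> 2 * (real N - 1) / (p - 1)" using a by (auto simp: \<rho>1_def)
  define w where "w = (\<lambda>s. s * H s)"
  have wpos: "w s > 0" if "s > 0" for s
  proof -
    have "0 < 1 / real N" using N by simp
    then show ?thesis using H_pos[OF all, of s] that unfolding w_def by (intro mult_pos_pos) linarith+
  qed
  have pq: "(q - 1) * (p - 1) = 1" unfolding q_def using p by (simp add: field_simps)
  have D: "\<exists>y. DERIV (\<lambda>s. w s powr (1 - q) + s / 2) s :> y \<and> y \<le> 0" if s: "s \<ge> \<rho>1" for s
  proof -
    have s0: "s > 0" using s r1 by simp
    define w' where "w' = rhs H s - (real N - 1) * H s"
    have "(w has_real_derivative 1 * H s + (rhs H s - real N * H s) / s * s) (at s)"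
      unfolding w_def using DERIV_mult[OF DERIV_ident H_deriv[of s "s + 1"]] all s0 by simp
    moreover have "1 * H s + (rhs H s - real N * H s) / s * s = w'"
      using s0 by (simp add: w'_def field_simps)
    ultimately have dw: "(w has_real_derivative w') (at s)" by simp
    have "((\<lambda>s. w s powr (1 - q) + s / 2) has_real_derivative (1 - q) * w s powr (1 - q - 1) * w' + 1 / 2) (at s)"
      using DERIV_add[OF DERIV_fun_powr[OF dw wpos[OF s0], of "1 - q"] DERIV_cdivide[OF DERIV_ident, of 2]]
      by simp
    moreover have "(1 - q) * w s powr (1 - q - 1) * w' + 1 / 2 \<le> 0"
    proof -
      have Hs: "(real N - 1) * H s = (real N - 1) / s * w s" using s0 by (simp add: w_def)
      have "(real N - 1) / s * w s \<le> 1 + (p - 1) / 2 * w s powr q"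
      proof (cases "w s \<le> 1")
        case True
        have "(real N - 1) / s * w s \<le> 1 * 1"
          using s s0 r1 a wpos[OF s0] True by (intro mult_mono) auto
        moreover have "(p - 1) / 2 * w s powr q \<ge> 0" using p by simp
        ultimately show ?thesis by linarith
      next
        case False
        have "w s powr 1 \<le> w s powr q" using False q by (intro powr_mono) auto
        moreover have "(real N - 1) / s \<le> (p - 1) / 2"
        proof -
          have "2 * (real N - 1) / (p - 1) \<le> s" using s r1(3) by linarith
          then show ?thesis using s0 p by (simp add: field_simps)
        qed
        ultimately have "(real N - 1) / s * w s \<le> (p - 1) / 2 * w s powr q"
          using a s0 wpos[OF s0] p by (intro mult_mono) auto
        then show ?thesis by linarith
      qed
      then have "(p - 1) / 2 * w s powr q \<le> w'"
        unfolding w'_def Hs rhs_def w_def[symmetric] by (simp add: w_def field_simps)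
      then have "((q - 1) * w s powr (- q)) * ((p - 1) / 2 * w s powr q) \<le> ((q - 1) * w s powr (- q)) * w'"
        using q by (intro mult_left_mono) auto
      also have "((q - 1) * w s powr (- q)) * ((p - 1) / 2 * w s powr q) = ((q - 1) * (p - 1)) / 2 * (w s powr (- q) * w s powr q)"
        by simp
      also have "\<dots> = 1 / 2" unfolding pq using wpos[OF s0] by (simp flip: powr_add)
      finally show ?thesis by (simp add: algebra_simps)
    qed
    ultimately show ?thesis by blast
  qed
  \<comment> \<open>Far enough for the loss \<open>(\<rho>2 - \<rho>1) / 2\<close> to exceed the
    value of \<open>w^(1 - q)\<close> at \<open>\<rho>1\<close>.\<close>
  define \<rho>2 where "\<rho>2 = \<rho>1 + 2 * (w \<rho>1 powr (1 - q)) + 1"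
  have "w \<rho>2 powr (1 - q) + \<rho>2 / 2 \<le> w \<rho>1 powr (1 - q) + \<rho>1 / 2"
    by (rule DERIV_nonpos_imp_nonincreasing) (use D in \<open>auto simp: \<rho>2_def add_nonneg_nonneg\<close>)
  moreover have "w \<rho>2 powr (1 - q) \<ge> 0" by simp
  ultimately show False using \<rho>2_def by linarith
qed

text \<open>The blow-up radius; it is the radius of the ball with first Dirichlet eigenvalue
  1.\<close>

definition "R1 = Sup convergence_set"

lemma R1_pos: "R1 > 0" and less_R1: "0 \<le> \<rho> \<Longrightarrow> \<rho> < R1 \<Longrightarrow> \<rho> \<in> convergence_set"
  and convergence_set_le_R1: "\<rho> \<in> convergence_set \<Longrightarrow> \<rho> \<le> R1"
proof -
  have b: "bdd_above convergence_set" using convergence_set_bounded by (auto simp: bdd_above_def)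
  show le: "\<rho> \<in> convergence_set \<Longrightarrow> \<rho> \<le> R1" for \<rho>
    unfolding R1_def by (rule cSup_upper[OF _ b])
  from small_in_convergence_set obtain \<rho>0 where r0: "\<rho>0 > 0" "\<rho>0 \<in> convergence_set" by blast
  with le show "R1 > 0" by force
  show "\<rho> \<in> convergence_set" if r: "0 \<le> \<rho>" "\<rho> < R1" for \<rho>
  proof -
    obtain \<sigma> where "\<sigma> \<in> convergence_set" "\<rho> < \<sigma>"
      using r(2) less_cSup_iff[of convergence_set \<rho>] r0 b unfolding R1_def by blast
    then show ?thesis using convergence_set_down r by auto
  qed
qed

text \<open>A continuation argument. A bound \<open>M\<close> below \<open>R1\<close> passes to
  \<open>R1\<close> itself for every iterate by continuity. On a short interval beyond
  \<open>R1\<close> an induction over the iterates loses at most 1, uniformly in the index, so the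
  interval of existence would extend past its supremum.\<close>

lemma H_unbounded: "\<exists>\<rho>\<in>{0..<R1}. M < H \<rho>"
proof (rule ccontr)
  assume "\<not> ?thesis"
  then have M: "H \<rho> \<le> M" if "0 \<le> \<rho>" "\<rho> < R1" for \<rho> using that by (auto simp: not_less)
  have M0: "M \<ge> 0" using M[of 0] H_nonneg[OF less_R1[of 0]] R1_pos by auto
  \<comment> \<open>Bounds the integrand as long as the iterate is at most \<open>M + 1\<close> and
    the radius at most \<open>R1 + 1\<close>. The choice of \<open>\<delta>\<close> then keeps the
    additional integral below \<open>R1 ^ N\<close>, which costs at most 1 after division by
    \<open>\<rho> ^ N\<close>.\<close>
  define B where "B = (R1 + 1) ^ (N - 1) * (1 + (p - 1) * ((R1 + 1) * (M + 1)) powr q)"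
  have B: "B > 0" unfolding B_def using R1_pos p by (intro mult_pos_pos add_pos_nonneg) auto
  define \<delta> where "\<delta> = min 1 (R1 ^ N / B)"
  have d: "\<delta> > 0" "\<delta> \<le> 1" "\<delta> * B \<le> R1 ^ N"
    using B R1_pos by (auto simp: \<delta>_def min_def field_simps)
  have hR1: "h k R1 \<le> M" for k
  proof (rule continuous_le_on_closure[where S = "{0..<R1}" and f = "h k"])
    show "continuous_on (closure {0..<R1}) (h k)"
      using R1_pos by (auto intro: continuous_on_subset[OF h_cont])
    show "h k x \<le> M" if "x \<in> {0..<R1}" for x
      using h_le_H[OF less_R1] M that by (meson atLeastLessThan_iff order_trans)
  qed (use R1_pos in auto)
  have "h k \<rho> \<le> M + 1" if "0 \<le> \<rho>" "\<rho> \<le> R1 + \<delta>" for k \<rho>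
    using that
  proof (induction k arbitrary: \<rho>)
    case (Suc k)
    show ?case
    proof (cases "\<rho> < R1")
      case True
      then show ?thesis using h_le_H[OF less_R1, of \<rho> "Suc k"] M[of \<rho>] Suc.prems by auto
    next
      case False
      let ?g = "\<lambda>s. s ^ (N - 1) * rhs (h k) s"
      have r: "R1 \<le> \<rho>" "0 < \<rho>" using False R1_pos by auto
      have i1: "(?g has_integral R1 ^ N * h (Suc k) R1) {0..R1}" using h_Suc_has_integral[OF R1_pos] .
      have i: "(?g has_integral \<rho> ^ N * h (Suc k) \<rho>) {0..\<rho>}" using h_Suc_has_integral[OF r(2)] .
      have i2: "?g integrable_on {R1..\<rho>}"
        using integrable_subinterval_real[OF has_integral_integrable[OF i], of R1 \<rho>] R1_pos by simp
      have "?g s \<le> B" if s: "s \<in> {R1..\<rho>}" for s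
        unfolding B_def
      proof (rule mult_mono)
        have s': "0 \<le> s" "s \<le> R1 + \<delta>" using s Suc.prems R1_pos by auto
        show "s ^ (N - 1) \<le> (R1 + 1) ^ (N - 1)" using s' d by (intro power_mono) auto
        show "rhs (h k) s \<le> 1 + (p - 1) * ((R1 + 1) * (M + 1)) powr q"
          unfolding rhs_def using p q s' d M0 Suc.IH[OF s'] h_nonneg[OF s'(1), of k] R1_pos
          by (intro add_left_mono mult_left_mono powr_mono2 mult_mono) auto
        show "0 \<le> rhs (h k) s" using rhs_ge_1[of "h k" s] by simp
      qed (use R1_pos in auto)
      then have "integral {R1..\<rho>} ?g \<le> integral {R1..\<rho>} (\<lambda>_. B)"
        by (intro integral_le i2) auto
      also have "\<dots> = (\<rho> - R1) * B" using r by simp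
      also have "\<dots> \<le> \<delta> * B" using Suc.prems B by (intro mult_right_mono) auto
      also have "\<dots> \<le> \<rho> ^ N" using d(3) power_mono[OF r(1), of N] R1_pos by linarith
      finally have 2: "integral {R1..\<rho>} ?g \<le> \<rho> ^ N" .
      have "R1 ^ N * h (Suc k) R1 \<le> \<rho> ^ N * M"
        using hR1[of "Suc k"] h_nonneg[of R1 "Suc k"] R1_pos r M0 by (intro mult_mono power_mono) auto
      moreover have "\<rho> ^ N * h (Suc k) \<rho> = R1 ^ N * h (Suc k) R1 + integral {R1..\<rho>} ?g"
        using Henstock_Kurzweil_Integration.integral_combine[of 0 R1 \<rho> ?g] i i1 R1_pos r
        by (simp add: has_integral_iff)
      ultimately have "\<rho> ^ N * h (Suc k) \<rho> \<le> \<rho> ^ N * (M + 1)" using 2 by (simp add: algebra_simps)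
      then show ?thesis using r(2) by simp
    qed
  qed (use M0 in auto)
  then have "R1 + \<delta> \<in> convergence_set" using d R1_pos unfolding convergence_set_def bdd_above_def by (auto intro!: exI[of _ "M + 1"])
  then show False using convergence_set_le_R1 d by force
qed

end

text \<open>What later arguments use of the solution, at an arbitrary scale: \<open>h\<close> is
  \<open>w / \<rho>\<close> and \<open>\<phi>\<close> is the eigenfunction extended by zero. No
  bound on \<open>h\<close> near \<open>R\<close> is assumed; instead, \<open>bounds\<close>
  controls \<open>\<bar>\<phi>'\<bar>\<close>, which makes the competitors Lipschitz, and
  \<open>\<phi> powr p * h\<close>, the multiplier of the vector field in the energy
  inequality.\<close>

locale radial_profile =
  fixes N :: nat and p \<Lambda> R :: real and h \<phi> :: "real \<Rightarrow> real"
  assumes p: "1 < p" and \<Lambda>: "0 < \<Lambda>" and R: "0 < R"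
    and h_deriv: "\<lbrakk>0 < \<rho>; \<rho> < R\<rbrakk> \<Longrightarrow>
      (h has_real_derivative (\<Lambda> + (p - 1) * (\<rho> * h \<rho>) powr (p / (p - 1)) - real N * h \<rho>) / \<rho>) (at \<rho>)"
    and h_pos: "\<exists>c>0. \<forall>\<rho>\<in>{0..<R}. c \<le> h \<rho>"
    and h_mono: "\<lbrakk>0 \<le> \<rho>; \<rho> \<le> \<sigma>; \<sigma> < R\<rbrakk> \<Longrightarrow> h \<rho> \<le> h \<sigma>"
    and \<phi>_deriv: "\<lbrakk>0 < \<rho>; \<rho> < R\<rbrakk> \<Longrightarrow>
      (\<phi> has_real_derivative - ((\<rho> * h \<rho>) powr (1 / (p - 1)) * \<phi> \<rho>)) (at \<rho>)"
    and \<phi>_pos: "\<lbrakk>0 \<le> \<rho>; \<rho> < R\<rbrakk> \<Longrightarrow> 0 < \<phi> \<rho>"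
    and \<phi>_le_1: "0 \<le> \<rho> \<Longrightarrow> \<phi> \<rho> \<le> 1"
    and \<phi>_eq_0: "R \<le> \<rho> \<Longrightarrow> \<phi> \<rho> = 0"
    and \<phi>_cont: "continuous_on {0..} \<phi>"
    and \<phi>_antimono: "\<lbrakk>0 \<le> \<rho>; \<rho> \<le> \<sigma>\<rbrakk> \<Longrightarrow> \<phi> \<sigma> \<le> \<phi> \<rho>"
    and bounds: "\<exists>C. \<forall>\<rho>\<in>{0..<R}. (\<rho> * h \<rho>) powr (1 / (p - 1)) * \<phi> \<rho> \<le> C \<and> \<phi> \<rho> powr p * h \<rho> \<le> C"

section \<open>The eigenfunction recovered from the Riccati solution\<close>

context riccati
begin

text \<open>The logarithmic slope \<open>- \<phi>' / \<phi>\<close>, obtained from \<open>w\<close>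
  by inverting the power \<open>p - 1\<close>.\<close>

definition "slope s = (s * H s) powr (1 / (p - 1))"

text \<open>Solves \<open>\<Phi>' = - slope * \<Phi>\<close> with value 1 at the origin. That the
  extension by zero is continuous at \<open>R1\<close> is the content of
  \<open>\<Phi>_small\<close>.\<close>

definition "\<Phi> \<rho> = (if \<rho> < R1 then exp (- integral {0..\<rho>} slope) else 0)"

lemma q_eq: "q = 1 + 1 / (p - 1)"
  using p by (simp add: q_def field_simps)

lemma slope_cont:
  assumes "\<sigma> < R1"
  shows "continuous_on {0..\<sigma>} slope"
proof (cases "0 \<le> \<sigma>")
  case True
  then have \<sigma>: "\<sigma> \<in> convergence_set" using less_R1 assms by blast
  have nn: "0 \<le> s * H s" if "s \<in> {0..\<sigma>}" for s
    using H_nonneg[OF convergence_set_down[OF \<sigma>]] that by simp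
  show ?thesis unfolding slope_def[abs_def] using p nn
    by (intro continuous_on_powr' continuous_on_const times_H_cont[OF \<sigma>]) auto
qed simp

lemma slope_nonneg: "0 \<le> slope s"
  by (simp add: slope_def)

lemma slope_mono:
  assumes "0 \<le> s" "s \<le> t" "t < R1"
  shows "slope s \<le> slope t"
proof -
  have t: "t \<in> convergence_set" using assms less_R1[of t] by simp
  show ?thesis unfolding slope_def
    using p assms H_nonneg[OF convergence_set_down[OF t assms(1,2)]] H_mono[OF t assms(1,2)] H_nonneg[OF t]
    by (intro powr_mono2 mult_mono mult_nonneg_nonneg) auto
qed

lemma slope_integrable: "0 \<le> \<rho> \<Longrightarrow> \<rho> < R1 \<Longrightarrow> slope integrable_on {0..\<rho>}"
  by (intro integrable_continuous_real slope_cont)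

lemma \<Phi>_deriv:
  assumes "0 < \<rho>" "\<rho> < R1"
  shows "(\<Phi> has_real_derivative - (slope \<rho> * \<Phi> \<rho>)) (at \<rho>)"
proof -
  obtain \<sigma> where s: "\<rho> < \<sigma>" "\<sigma> < R1" using dense[OF assms(2)] by blast
  have "((\<lambda>x. integral {0..x} slope) has_real_derivative slope \<rho>) (at \<rho>)"
    using integral_has_real_derivative[OF slope_cont[OF s(2)], of \<rho>] assms s by (simp add: at_within_Icc_at)
  from DERIV_chain2[OF DERIV_exp DERIV_minus[OF this]]
  have "((\<lambda>x. exp (- integral {0..x} slope)) has_real_derivative - (slope \<rho> * \<Phi> \<rho>)) (at \<rho>)"
    using assms by (simp add: \<Phi>_def mult.commute)
  then show ?thesis
    by (rule has_field_derivative_transform_within_open[where S = "{..<R1}"]) (use assms in \<open>auto simp: \<Phi>_def\<close>)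
qed

lemma \<Phi>_antimono:
  assumes "0 \<le> \<rho>" "\<rho> \<le> \<sigma>"
  shows "\<Phi> \<sigma> \<le> \<Phi> \<rho>"
proof (cases "\<sigma> < R1")
  case True
  then have "integral {0..\<rho>} slope \<le> integral {0..\<sigma>} slope"
    using assms slope_nonneg by (intro integral_subset_le slope_integrable) auto
  then show ?thesis using True assms by (simp add: \<Phi>_def)
qed (auto simp: \<Phi>_def)

lemma \<Phi>_le_1: "0 \<le> \<rho> \<Longrightarrow> \<Phi> \<rho> \<le> 1"
  using \<Phi>_antimono[of 0 \<rho>] R1_pos by (simp add: \<Phi>_def)

lemma \<Phi>_pos: "\<rho> < R1 \<Longrightarrow> 0 < \<Phi> \<rho>"
  by (simp add: \<Phi>_def)

text \<open>In terms of \<open>\<Phi>\<close> this is the bound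
  \<open>\<rho>\<^sup>N\<^sup>-\<^sup>1\<bar>\<Phi>'\<bar>\<^sup>p\<^sup>-\<^sup>1 \<le> C\<close>, because the derivative of the left-hand side is \<open>\<rho>\<^sup>N\<^sup>-\<^sup>1\<Phi>\<^sup>p\<^sup>-\<^sup>1\<close>.\<close>

lemma flux_bound: "\<exists>C. \<forall>\<rho>\<in>{R1/2..<R1}. \<rho> ^ N * H \<rho> * \<Phi> \<rho> powr (p - 1) \<le> C"
proof -
  define Y where "Y = (\<lambda>\<rho>. \<rho> ^ N * H \<rho> * \<Phi> \<rho> powr (p - 1))"
  have D: "(Y has_real_derivative \<rho> ^ (N - 1) * \<Phi> \<rho> powr (p - 1)) (at \<rho>)" if r: "0 < \<rho>" "\<rho> < R1" for \<rho>
  proof -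
    obtain \<sigma> where s: "\<rho> < \<sigma>" "\<sigma> < R1" using dense[OF r(2)] by blast
    have "\<rho> ^ N = \<rho> ^ (N - 1) * \<rho>" using N by (cases N) auto
    moreover have "(\<rho> * H \<rho>) * slope \<rho> = (\<rho> * H \<rho>) powr q"
      using r H_nonneg[OF less_R1, of \<rho>] by (simp add: slope_def q_eq powr_mult_base)
    ultimately have 1: "\<rho> ^ N * H \<rho> * slope \<rho> = \<rho> ^ (N - 1) * (\<rho> * H \<rho>) powr q"
      by (simp add: mult_ac)
    have 2: "\<Phi> \<rho> powr (p - 1 - 1) * \<Phi> \<rho> = \<Phi> \<rho> powr (p - 1)"
      using powr_mult_base[of "\<Phi> \<rho>" "p - 1 - 1"] \<Phi>_pos[OF r(2)] by (simp add: mult.commute)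
    have "(Y has_real_derivative (\<rho> ^ (N - 1) * rhs H \<rho>) * \<Phi> \<rho> powr (p - 1)
        + ((p - 1) * \<Phi> \<rho> powr (p - 1 - of_nat 1) * (- (slope \<rho> * \<Phi> \<rho>))) * (\<rho> ^ N * H \<rho>)) (at \<rho>)"
      unfolding Y_def
      using r s by (intro DERIV_mult Z_deriv[OF r(1) s(1)] less_R1 DERIV_fun_powr \<Phi>_deriv \<Phi>_pos) simp_all
    also have "((p - 1) * \<Phi> \<rho> powr (p - 1 - of_nat 1) * (- (slope \<rho> * \<Phi> \<rho>))) * (\<rho> ^ N * H \<rho>)
      = - ((p - 1) * (\<Phi> \<rho> powr (p - 1 - 1) * \<Phi> \<rho>) * (\<rho> ^ N * H \<rho> * slope \<rho>))"
      by (simp add: mult_ac)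
    also have "(\<rho> ^ (N - 1) * rhs H \<rho>) * \<Phi> \<rho> powr (p - 1) + \<dots> = \<rho> ^ (N - 1) * \<Phi> \<rho> powr (p - 1)"
      unfolding 1 2 rhs_def by (simp add: algebra_simps)
    finally show ?thesis .
  qed
  \<comment> \<open>As \<open>\<Phi> \<le> 1\<close>, the derivative of \<open>Y\<close> is at most
    \<open>R1 ^ (N - 1)\<close>, so \<open>Y\<close> is compared with a linear function.\<close>
  have "Y \<rho> \<le> Y (R1 / 2) + R1 ^ (N - 1) * R1" if r: "R1 / 2 \<le> \<rho>" "\<rho> < R1" for \<rho>
  proof -
    have "Y \<rho> - R1 ^ (N - 1) * \<rho> \<le> Y (R1 / 2) - R1 ^ (N - 1) * (R1 / 2)"
    proof (rule DERIV_nonpos_imp_nonincreasing[OF r(1)])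
      fix x assume x: "R1 / 2 \<le> x" "x \<le> \<rho>"
      then have x': "0 < x" "x < R1" using r R1_pos by auto
      have "((\<lambda>\<rho>. Y \<rho> - R1 ^ (N - 1) * \<rho>) has_real_derivative x ^ (N - 1) * \<Phi> x powr (p - 1) - R1 ^ (N - 1)) (at x)"
        using DERIV_diff[OF D[OF x'] DERIV_cmult[OF DERIV_ident]] by simp
      moreover have "x ^ (N - 1) * \<Phi> x powr (p - 1) \<le> R1 ^ (N - 1) * 1"
        using x' \<Phi>_le_1[of x] \<Phi>_pos[of x] p by (intro mult_mono power_mono powr_le1) auto
      ultimately show "\<exists>y. ((\<lambda>\<rho>. Y \<rho> - R1 ^ (N - 1) * \<rho>) has_real_derivative y) (at x) \<and> y \<le> 0"
        by (intro exI[of _ "x ^ (N - 1) * \<Phi> x powr (p - 1) - R1 ^ (N - 1)"]) simp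
    qed
    moreover have "R1 ^ (N - 1) * \<rho> \<le> R1 ^ (N - 1) * R1" using r R1_pos by simp
    moreover have "0 \<le> R1 ^ (N - 1) * (R1 / 2)" using R1_pos by simp
    ultimately show ?thesis by linarith
  qed
  then have "\<forall>\<rho>\<in>{R1/2..<R1}. Y \<rho> \<le> Y (R1 / 2) + R1 ^ (N - 1) * R1" by simp
  then show ?thesis unfolding Y_def by blast
qed

text \<open>The flux \<open>\<rho> ^ N * H \<rho> * \<Phi> \<rho> powr (p - 1)\<close> stays bounded
  near \<open>R1\<close> while \<open>H\<close> does not, so the last factor must become small. This
  is the Dirichlet condition at \<open>R1\<close>.\<close>

lemma \<Phi>_small: assumes "0 < \<epsilon>" shows "\<exists>\<rho>\<in>{0..<R1}. \<Phi> \<rho> < \<epsilon>"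
proof -
  obtain C where C: "\<rho> ^ N * H \<rho> * \<Phi> \<rho> powr (p - 1) \<le> C" if "\<rho> \<in> {R1/2..<R1}" for \<rho>
    using flux_bound by blast
  define A where "A = (R1 / 2) ^ N * \<epsilon> powr (p - 1)"
  have A: "A > 0" using R1_pos assms by (simp add: A_def)
  obtain \<rho>0 where r0: "\<rho>0 \<in> {0..<R1}" "max (\<bar>C\<bar> / A) 0 < H \<rho>0"
    using H_unbounded by blast
  \<comment> \<open>Moving to the right up to \<open>R1 / 2\<close> keeps \<open>H\<close> large by
    monotonicity and enters the range of \<open>flux_bound\<close>.\<close>
  define \<rho> where "\<rho> = max \<rho>0 (R1 / 2)"
  have r: "\<rho> \<in> {R1/2..<R1}" "0 < \<rho>" using r0 R1_pos by (auto simp: \<rho>_def)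
  have "H \<rho>0 \<le> H \<rho>" using r0 r by (intro H_mono less_R1) (auto simp: \<rho>_def)
  then have "\<bar>C\<bar> / A < H \<rho>" using r0 by auto
  then have 1: "C < A * H \<rho>" using A by (simp add: field_simps)
  have Hp: "0 < H \<rho>" using \<open>\<bar>C\<bar> / A < H \<rho>\<close> A
    by (meson abs_ge_zero divide_nonneg_pos le_less_trans)
  have "\<Phi> \<rho> < \<epsilon>"
  proof (rule ccontr)
    assume "\<not> \<Phi> \<rho> < \<epsilon>"
    then have "(R1 / 2) ^ N * \<epsilon> powr (p - 1) \<le> \<rho> ^ N * \<Phi> \<rho> powr (p - 1)"
      using r R1_pos assms p by (intro mult_mono power_mono powr_mono2) auto
    then have "A * H \<rho> \<le> \<rho> ^ N * \<Phi> \<rho> powr (p - 1) * H \<rho>"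
      unfolding A_def using Hp by (intro mult_right_mono) auto
    then show False using C[OF r(1)] 1 by (simp add: mult_ac)
  qed
  then show ?thesis using r R1_pos by auto
qed

lemma \<Phi>_cont: "continuous_on {0..} \<Phi>"
proof -
  have "isCont \<Phi> x" if "R1 \<le> x" for x
  proof (cases "x = R1")
    case True
    show ?thesis unfolding True continuous_at_eps_delta
    proof (intro allI impI)
      fix e :: real assume "0 < e"
      then obtain \<rho> where r: "0 \<le> \<rho>" "\<rho> < R1" "\<Phi> \<rho> < e" using \<Phi>_small[of e] by auto
      have "dist (\<Phi> y) (\<Phi> R1) < e" if "dist y R1 < R1 - \<rho>" for y
      proof (cases "y < R1")
        case True
        then have "\<rho> \<le> y" using that by (simp add: dist_real_def)
        then show ?thesis using \<Phi>_antimono[of \<rho> y] \<Phi>_pos[OF True] r by (simp add: \<Phi>_def dist_real_def split: if_splits)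
      qed (use \<open>0 < e\<close> in \<open>simp add: \<Phi>_def\<close>)
      then show "\<exists>d>0. \<forall>y. dist y R1 < d \<longrightarrow> dist (\<Phi> y) (\<Phi> R1) < e"
        using r by (intro exI[of _ "R1 - \<rho>"]) simp
    qed
  next
    case False
    with that have "x \<in> {R1<..}" by simp
    moreover have "continuous_on {R1<..} \<Phi>"
      by (rule continuous_on_eq[of _ "\<lambda>_. 0"]) (auto simp: \<Phi>_def)
    ultimately show ?thesis by (simp add: continuous_on_eq_continuous_at)
  qed
  moreover have "continuous (at x within {0..}) \<Phi>" if x: "0 \<le> x" "x < R1" for x
  proof -
    obtain \<sigma> where s: "x < \<sigma>" "\<sigma> < R1" using dense[OF x(2)] by blast
    have "continuous_on {0..\<sigma>} (\<lambda>\<rho>. exp (- integral {0..\<rho>} slope))"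
      using s x by (intro continuous_on_exp continuous_on_minus indefinite_integral_continuous_1 slope_integrable) simp_all
    then have "continuous_on {0..\<sigma>} \<Phi>"
      by (rule continuous_on_eq) (use s in \<open>auto simp: \<Phi>_def\<close>)
    then have "continuous (at x within {0..\<sigma>}) \<Phi>" using x s by (simp add: continuous_on_eq_continuous_within)
    moreover have "at x within {0..\<sigma>} = at x within {0..}"
      using s by (intro at_within_nhd[of _ "{..<\<sigma>}"]) auto
    ultimately show ?thesis by (simp add: continuous_within)
  qed
  ultimately have "continuous (at x within {0..}) \<Phi>" if "0 \<le> x" for x
    using that by (cases "x < R1") (auto intro: continuous_at_imp_continuous_at_within)
  then show ?thesis by (simp add: continuous_on_eq_continuous_within)
qed

text \<open>On the inner half, monotonicity of \<open>slope\<close> and \<open>H\<close> suffices.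
  On the outer half both quantities are expressed through \<open>H * \<Phi> powr (p - 1)\<close>,
  which is the bounded flux divided by \<open>\<rho> ^ N\<close>.\<close>

lemma bounds: "\<exists>C. \<forall>\<rho>\<in>{0..<R1}. slope \<rho> * \<Phi> \<rho> \<le> C \<and> \<Phi> \<rho> powr p * H \<rho> \<le> C"
proof -
  obtain C where C: "\<rho> ^ N * H \<rho> * \<Phi> \<rho> powr (p - 1) \<le> C" if "\<rho> \<in> {R1/2..<R1}" for \<rho>
    using flux_bound by blast
  define a where "a = R1 / 2"
  have a: "0 < a" "a < R1" using R1_pos by (auto simp: a_def)
  define B where "B = max (max (slope a) (H a)) (max ((C * R1 / a ^ N) powr (1 / (p - 1))) (C / a ^ N))"
  have "slope \<rho> * \<Phi> \<rho> \<le> B \<and> \<Phi> \<rho> powr p * H \<rho> \<le> B" if r: "\<rho> \<in> {0..<R1}" for \<rho>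
  proof (cases "\<rho> \<le> a")
    case True
    have "slope \<rho> * \<Phi> \<rho> \<le> slope a * 1"
      using True a r slope_mono[of \<rho> a] slope_nonneg \<Phi>_le_1[of \<rho>] \<Phi>_pos[of \<rho>] by (intro mult_mono) auto
    moreover have "\<Phi> \<rho> powr p * H \<rho> \<le> 1 * H a"
      using True a r p H_nonneg[OF less_R1, of \<rho>] \<Phi>_le_1[of \<rho>] \<Phi>_pos[of \<rho>]
      by (intro mult_mono powr_le1 H_mono less_R1) auto
    ultimately show ?thesis unfolding B_def by auto
  next
    case False
    then have r': "\<rho> \<in> {R1/2..<R1}" "0 < \<rho>" "a \<le> \<rho>" using r a by (auto simp: a_def)
    have Hn: "0 \<le> H \<rho>" using H_nonneg[OF less_R1] r by auto
    have ph: "0 < \<Phi> \<rho>" "\<Phi> \<rho> \<le> 1" using \<Phi>_pos \<Phi>_le_1 r by auto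
    have "a ^ N * (H \<rho> * \<Phi> \<rho> powr (p - 1)) \<le> \<rho> ^ N * (H \<rho> * \<Phi> \<rho> powr (p - 1))"
      using r' a Hn by (intro mult_right_mono power_mono) auto
    also have "\<dots> \<le> C" using C[OF r'(1)] by (simp add: mult_ac)
    finally have 1: "H \<rho> * \<Phi> \<rho> powr (p - 1) \<le> C / a ^ N" using a by (simp add: field_simps)
    have "slope \<rho> * \<Phi> \<rho> = (\<rho> * (H \<rho> * \<Phi> \<rho> powr (p - 1))) powr (1 / (p - 1))"
      using p ph by (simp add: slope_def powr_mult powr_powr)
    also have "\<dots> \<le> (R1 * (C / a ^ N)) powr (1 / (p - 1))"
      using p r r' Hn 1 by (intro powr_mono2 mult_mono mult_nonneg_nonneg) auto
    also have "\<dots> \<le> B" by (simp add: B_def mult.commute)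
    finally have 2: "slope \<rho> * \<Phi> \<rho> \<le> B" .
    have "\<Phi> \<rho> powr p = \<Phi> \<rho> * \<Phi> \<rho> powr (p - 1)" using ph by (simp add: powr_mult_base)
    then have "\<Phi> \<rho> powr p * H \<rho> = \<Phi> \<rho> * (H \<rho> * \<Phi> \<rho> powr (p - 1))" by simp
    also have "\<dots> \<le> 1 * (C / a ^ N)" using ph 1 Hn by (intro mult_mono) auto
    also have "\<dots> \<le> B" by (simp add: B_def)
    finally show ?thesis using 2 by blast
  qed
  then show ?thesis by blast
qed

text \<open>With \<open>s = R1 / R\<close>, replacing \<open>\<rho>\<close> by
  \<open>s * \<rho>\<close> multiplies the logarithmic slope by \<open>s\<close>, hence
  \<open>w\<close> by \<open>s powr (p - 1)\<close> and the eigenvalue by \<open>s powr p\<close>.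
  Since \<open>h = w / \<rho>\<close>, the factor in front of \<open>H\<close> is again
  \<open>s powr p\<close>.\<close>

lemma radial_profile_scaled:
  assumes "0 < R"
  shows "radial_profile N p ((R1 / R) powr p) R (\<lambda>\<rho>. (R1 / R) powr p * H (R1 / R * \<rho>)) (\<lambda>\<rho>. \<Phi> (R1 / R * \<rho>))"
proof -
  define s where "s = R1 / R"
  have s: "s > 0" using assms R1_pos by (simp add: s_def)
  have lt: "s * \<rho> < R1 \<longleftrightarrow> \<rho> < R" for \<rho> using assms R1_pos by (simp add: s_def field_simps)
  have sp: "s * s powr (1 / (p - 1)) = s powr q" using s by (simp add: q_eq powr_mult_base)
  have scr: "(\<rho> * (s powr p * H (s * \<rho>))) powr r = s powr ((p - 1) * r) * (s * \<rho> * H (s * \<rho>)) powr r" for \<rho> r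
  proof -
    have "\<rho> * (s powr p * H (s * \<rho>)) = s powr (p - 1) * (s * \<rho> * H (s * \<rho>))"
      using s by (simp add: powr_diff)
    then show ?thesis by (simp only: powr_mult powr_powr)
  qed
  have sc: "(\<rho> * (s powr p * H (s * \<rho>))) powr (1 / (p - 1)) = s * slope (s * \<rho>)" for \<rho>
    unfolding scr slope_def using s p by simp
  have sc': "(\<rho> * (s powr p * H (s * \<rho>))) powr (p / (p - 1)) = s powr p * (s * \<rho> * H (s * \<rho>)) powr q" for \<rho>
    unfolding scr q_def using p by simp
  have ds: "((\<lambda>\<rho>. s * \<rho>) has_real_derivative s) (at \<rho>)" for \<rho>
    using DERIV_cmult[OF DERIV_ident, of s] by simp
  show ?thesis unfolding s_def[symmetric]
  proof
    fix \<rho> assume r: "0 < \<rho>" "\<rho> < R"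
    then have r': "0 < s * \<rho>" "s * \<rho> < R1" using s lt by auto
    obtain \<sigma> where \<sigma>: "s * \<rho> < \<sigma>" "\<sigma> < R1" using dense[OF r'(2)] by blast
    have "((\<lambda>\<rho>. s powr p * H (s * \<rho>)) has_real_derivative
       s powr p * ((rhs H (s * \<rho>) - real N * H (s * \<rho>)) / (s * \<rho>) * s)) (at \<rho>)"
      using r' \<sigma> by (intro DERIV_cmult DERIV_chain2[OF H_deriv ds] less_R1) auto
    also have "s powr p * ((rhs H (s * \<rho>) - real N * H (s * \<rho>)) / (s * \<rho>) * s)
      = (s powr p + (p - 1) * (\<rho> * (s powr p * H (s * \<rho>))) powr (p / (p - 1)) - real N * (s powr p * H (s * \<rho>))) / \<rho>"
      unfolding sc' rhs_def using s r by (simp add: field_simps)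
    finally show "((\<lambda>\<rho>. s powr p * H (s * \<rho>)) has_real_derivative
      (s powr p + (p - 1) * (\<rho> * (s powr p * H (s * \<rho>))) powr (p / (p - 1)) - real N * (s powr p * H (s * \<rho>))) / \<rho>) (at \<rho>)" .
    show "((\<lambda>\<rho>. \<Phi> (s * \<rho>)) has_real_derivative - ((\<rho> * (s powr p * H (s * \<rho>))) powr (1 / (p - 1)) * \<Phi> (s * \<rho>))) (at \<rho>)"
      unfolding sc using DERIV_chain2[OF \<Phi>_deriv[OF r'] ds] by (simp add: mult_ac)
  next
    show "\<exists>c>0. \<forall>\<rho>\<in>{0..<R}. c \<le> s powr p * H (s * \<rho>)"
    proof (intro exI[of _ "s powr p * (1 / real N)"] conjI ballI)
      show "0 < s powr p * (1 / real N)" using s N by simp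
      show "s powr p * (1 / real N) \<le> s powr p * H (s * \<rho>)" if "\<rho> \<in> {0..<R}" for \<rho>
        using that s lt[of \<rho>] by (intro mult_left_mono H_pos less_R1) auto
    qed
  next
    fix \<rho> \<sigma> assume "0 \<le> \<rho>" "\<rho> \<le> \<sigma>" "\<sigma> < R"
    then show "s powr p * H (s * \<rho>) \<le> s powr p * H (s * \<sigma>)"
      using s lt[of \<sigma>] by (intro mult_left_mono H_mono less_R1) auto
  next
    show "continuous_on {0..} (\<lambda>\<rho>. \<Phi> (s * \<rho>))"
      using s by (intro continuous_on_compose2[OF \<Phi>_cont] continuous_intros) auto
  next
    obtain C where C: "slope \<rho> * \<Phi> \<rho> \<le> C" "\<Phi> \<rho> powr p * H \<rho> \<le> C" if "\<rho> \<in> {0..<R1}" for \<rho>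
      using bounds by blast
    show "\<exists>C. \<forall>\<rho>\<in>{0..<R}. (\<rho> * (s powr p * H (s * \<rho>))) powr (1 / (p - 1)) * \<Phi> (s * \<rho>) \<le> C \<and>
               \<Phi> (s * \<rho>) powr p * (s powr p * H (s * \<rho>)) \<le> C"
      unfolding sc
    proof (intro exI ballI conjI)
      fix \<rho> assume "\<rho> \<in> {0..<R}"
      then have r: "s * \<rho> \<in> {0..<R1}" using s lt by auto
      have "s * slope (s * \<rho>) * \<Phi> (s * \<rho>) \<le> s * C" using C(1)[OF r] s by simp
      then show "s * slope (s * \<rho>) * \<Phi> (s * \<rho>) \<le> max (s * C) (s powr p * C)"
        by (rule max.coboundedI1)
      have "s powr p * (\<Phi> (s * \<rho>) powr p * H (s * \<rho>)) \<le> s powr p * C" using C(2)[OF r] s by simp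
      then have "\<Phi> (s * \<rho>) powr p * (s powr p * H (s * \<rho>)) \<le> s powr p * C"
        by (simp only: mult.left_commute)
      then show "\<Phi> (s * \<rho>) powr p * (s powr p * H (s * \<rho>)) \<le> max (s * C) (s powr p * C)"
        by (rule max.coboundedI2)
    qed
  next
    show "\<Phi> (s * \<rho>) = 0" if "R \<le> \<rho>" for \<rho>
      using that lt[of \<rho>] by (simp add: \<Phi>_def)
    show "0 < \<Phi> (s * \<rho>)" if "\<rho> < R" for \<rho>
      using that lt[of \<rho>] by (intro \<Phi>_pos) simp
    show "\<Phi> (s * \<rho>) \<le> 1" if "0 \<le> \<rho>" for \<rho>
      using that s by (intro \<Phi>_le_1) simp
    show "\<Phi> (s * \<sigma>) \<le> \<Phi> (s * \<rho>)" if "0 \<le> \<rho>" "\<rho> \<le> \<sigma>" for \<rho> \<sigma>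
      using that s by (intro \<Phi>_antimono) auto
  qed (use p s assms in auto)
qed

end

text \<open>A single \<open>R1\<close>, depending on \<open>N\<close> and \<open>p\<close> only,
  serves all radii; this makes the eigenvalues of balls of different radii comparable.\<close>

lemma radial_profile_exists:
  assumes "1 \<le> N" "1 < p"
  obtains R1 where "0 < R1" "\<And>R. 0 < R \<Longrightarrow> \<exists>h \<phi>. radial_profile N p ((R1 / R) powr p) R h \<phi>"
proof -
  interpret riccati N p by unfold_locales (use assms in auto)
  show ?thesis using that[OF R1_pos] radial_profile_scaled by blast
qed

section \<open>The isodiametric inequality\<close>

definition sumset :: "'a::real_normed_vector set \<Rightarrow> 'a set \<Rightarrow> 'a set"
  where "sumset A B = (\<Union>x\<in>A. \<Union>y\<in>B. {x + y})"

lemma sumset_iff: "z \<in> sumset A B \<longleftrightarrow> (\<exists>x\<in>A. \<exists>y\<in>B. z = x + y)"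
  by (auto simp: sumset_def)

lemma sumset_commute: "sumset A B = sumset B A"
  unfolding set_eq_iff sumset_iff by (metis add.commute)

lemma sumset_mono: "A \<subseteq> A' \<Longrightarrow> B \<subseteq> B' \<Longrightarrow> sumset A B \<subseteq> sumset A' B'"
  unfolding sumset_def by blast

lemma open_sumset: "open A \<Longrightarrow> open (sumset A B)"
  unfolding sumset_def by (rule open_sums) blast

lemma bounded_sumset: "bounded A \<Longrightarrow> bounded B \<Longrightarrow> bounded (sumset A B)"
  unfolding sumset_def by (rule bounded_sums)

text \<open>Open boxes, so that unions and sumsets are open; nonempty, so that each has positive
  volume; disjoint, so that any two are separated by a coordinate hyperplane.\<close>

definition box_family :: "'a::euclidean_space set set \<Rightarrow> bool" where
  "box_family \<A> \<longleftrightarrow> finite \<A> \<and> (\<forall>D\<in>\<A>. D \<noteq> {} \<and> (\<exists>a b. D = box a b)) \<and> pairwise disjnt \<A>"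

lemma box_family_open: "box_family \<A> \<Longrightarrow> open (\<Union>\<A>)"
  and box_family_bounded: "box_family \<A> \<Longrightarrow> bounded (\<Union>\<A>)"
proof -
  assume A: "box_family \<A>"
  then have "\<exists>a b. D = box a b" if "D \<in> \<A>" for D using that unfolding box_family_def by blast
  then have "open D" "bounded D" if "D \<in> \<A>" for D using that open_box bounded_box by metis+
  then show "open (\<Union>\<A>)" "bounded (\<Union>\<A>)" using A unfolding box_family_def by auto
qed

lemma open_measure_pos:
  fixes D :: "'a::euclidean_space set"
  assumes "open D" "D \<noteq> {}" "bounded D" shows "0 < measure lebesgue D"
proof -
  have "D \<in> lmeasurable" using assms by (intro lmeasurable_open)
  moreover have "\<not> negligible D" using open_not_negligible assms by blast
  ultimately show ?thesis
    using negligible_iff_measure zero_less_measure_iff by blast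
qed

lemma box_Int_halfspace:
  fixes a :: "'a::euclidean_space"
  assumes "k \<in> Basis"
  shows "box a b \<inter> {x. x \<bullet> k < c} = box a (\<Sum>i\<in>Basis. (if i = k then min (b\<bullet>k) c else b\<bullet>i) *\<^sub>R i)"
    and "box a b \<inter> {x. c < x \<bullet> k} = box (\<Sum>i\<in>Basis. (if i = k then max (a\<bullet>k) c else a\<bullet>i) *\<^sub>R i) b"
  using assms by (rule_tac set_eqI; auto simp: mem_box)+

text \<open>Empty traces are discarded, hence a half-space that misses one box strictly lowers the
  number of boxes. This count drives the induction below.\<close>

lemma box_family_cut:
  assumes \<A>: "box_family \<A>" and H: "\<And>a b. \<exists>c d. box a b \<inter> H = box c d"
  shows "box_family ((\<lambda>D. D \<inter> H) ` \<A> - {{}})" "\<Union>((\<lambda>D. D \<inter> H) ` \<A> - {{}}) = \<Union>\<A> \<inter> H"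
    "card ((\<lambda>D. D \<inter> H) ` \<A> - {{}}) \<le> card \<A>"
    "D \<in> \<A> \<Longrightarrow> D \<inter> H = {} \<Longrightarrow> card ((\<lambda>D. D \<inter> H) ` \<A> - {{}}) < card \<A>"
proof -
  have fin: "finite \<A>" using \<A> by (simp add: box_family_def)
  show "box_family ((\<lambda>D. D \<inter> H) ` \<A> - {{}})"
    unfolding box_family_def
  proof (intro conjI ballI)
    show "pairwise disjnt ((\<lambda>D. D \<inter> H) ` \<A> - {{}})"
      using \<A> unfolding box_family_def pairwise_def disjnt_def by blast
    show "\<exists>a b. D = box a b" if D: "D \<in> (\<lambda>D. D \<inter> H) ` \<A> - {{}}" for D
    proof -
      from D obtain E where "E \<in> \<A>" "D = E \<inter> H" by blast
      moreover from this \<A> obtain a b where "E = box a b" unfolding box_family_def by blast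
      ultimately show ?thesis using H[of a b] by blast
    qed
  qed (use fin in auto)
  show "\<Union>((\<lambda>D. D \<inter> H) ` \<A> - {{}}) = \<Union>\<A> \<inter> H" by blast
  show "card ((\<lambda>D. D \<inter> H) ` \<A> - {{}}) \<le> card \<A>"
    using card_mono[of "(\<lambda>D. D \<inter> H) ` \<A>" "(\<lambda>D. D \<inter> H) ` \<A> - {{}}"] card_image_le[OF fin, of "\<lambda>D. D \<inter> H"] fin by auto
  show "card ((\<lambda>D. D \<inter> H) ` \<A> - {{}}) < card \<A>" if "D \<in> \<A>" "D \<inter> H = {}"
  proof -
    have "(\<lambda>D. D \<inter> H) ` \<A> - {{}} \<subseteq> (\<lambda>D. D \<inter> H) ` (\<A> - {D})" using that by blast
    then have "card ((\<lambda>D. D \<inter> H) ` \<A> - {{}}) \<le> card ((\<lambda>D. D \<inter> H) ` (\<A> - {D}))"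
      using fin by (intro card_mono) auto
    also have "\<dots> \<le> card (\<A> - {D})" using fin by (intro card_image_le) auto
    also have "\<dots> < card \<A>" using fin that(1) by (intro psubset_card_mono) auto
    finally show ?thesis .
  qed
qed

lemma measure_split_halfspace:
  fixes U :: "'a::euclidean_space set"
  assumes "open U" "bounded U" "k \<in> Basis"
  shows "measure lebesgue U = measure lebesgue (U \<inter> {x. x \<bullet> k < t}) + measure lebesgue (U \<inter> {x. t < x \<bullet> k})"
proof -
  let ?A = "U \<inter> {x. x \<bullet> k < t}" and ?B = "U \<inter> {x. t < x \<bullet> k}"
  have m: "?A \<in> lmeasurable" "?B \<in> lmeasurable"
    using assms by (auto intro!: lmeasurable_open open_halfspace_component_lt open_halfspace_component_gt)
  have "measure lebesgue U = measure lebesgue (?A \<union> ?B)"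
  proof (rule measure_negligible_symdiff)
    show "?A \<union> ?B \<in> lmeasurable" using m by auto
    show "negligible ((?A \<union> ?B) - U \<union> (U - (?A \<union> ?B)))"
      by (rule negligible_subset[OF negligible_standard_hyperplane[OF assms(3), of t]]) auto
  qed
  also have "\<dots> = measure lebesgue ?A + measure lebesgue (?B - ?A)" by (rule measure_Un2[OF m])
  also have "?B - ?A = ?B" by auto
  finally show ?thesis .
qed

text \<open>Dominated convergence: the indicators converge except on the hyperplane
  \<open>x \<bullet> k = t\<close>, which is a null set.\<close>

lemma isCont_measure_halfspace:
  fixes U :: "'a::euclidean_space set"
  assumes "open U" "bounded U" "k \<in> Basis"
  shows "isCont (\<lambda>t. measure lebesgue (U \<inter> {x. x \<bullet> k < t})) t"
  unfolding continuous_at_sequentially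
proof (intro allI impI)
  fix s :: "nat \<Rightarrow> real" assume s: "s \<longlonglongrightarrow> t"
  let ?C = "\<lambda>t. U \<inter> {x. x \<bullet> k < t}"
  have m: "?C r \<in> lmeasurable" for r
    using assms by (auto intro!: lmeasurable_open open_halfspace_component_lt)
  have e: "measure lebesgue (?C r) = integral\<^sup>L lebesgue (indicator (?C r))" for r
    by simp
  have "(\<lambda>n. integral\<^sup>L lebesgue (indicator (?C (s n)) :: 'a \<Rightarrow> real)) \<longlonglongrightarrow> integral\<^sup>L lebesgue (indicator (?C t))"
  proof (rule integral_dominated_convergence)
    show "integrable lebesgue (indicator U :: 'a \<Rightarrow> real)"
      using lmeasurable_open[OF assms(2,1)] by (auto simp: fmeasurable_def intro!: integrable_real_indicator)
    have "AE x in lebesgue. x \<notin> {x. x \<bullet> k = t}"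
      using negligible_standard_hyperplane[OF assms(3), of t] by (intro AE_not_in) (simp add: negligible_iff_null_sets)
    then show "AE x in lebesgue. (\<lambda>n. indicator (?C (s n)) x :: real) \<longlonglongrightarrow> indicator (?C t) x"
    proof (rule AE_mp, intro AE_I2 impI)
      fix x assume "x \<notin> {x. x \<bullet> k = t}"
      then consider "x \<bullet> k < t" | "t < x \<bullet> k" by fastforce
      then have "\<forall>\<^sub>F n in sequentially. (indicator (?C (s n)) x :: real) = indicator (?C t) x"
      proof cases
        case 1
        then have "\<forall>\<^sub>F n in sequentially. x \<bullet> k < s n" using s order_tendstoD(1) by blast
        then show ?thesis by eventually_elim (use 1 in \<open>auto simp: indicator_def\<close>)
      next
        case 2
        then have "\<forall>\<^sub>F n in sequentially. s n < x \<bullet> k" using s order_tendstoD(2) by blast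
        then show ?thesis by eventually_elim (use 2 in \<open>auto simp: indicator_def\<close>)
      qed
      then show "(\<lambda>n. indicator (?C (s n)) x :: real) \<longlonglongrightarrow> indicator (?C t) x"
        by (rule tendsto_eventually)
    qed
  qed (use m in \<open>auto simp: indicator_def intro!: borel_measurable_indicator fmeasurableD\<close>)
  then show "((\<lambda>t. measure lebesgue (?C t)) \<circ> s) \<longlonglongrightarrow> measure lebesgue (?C t)"
    by (simp add: o_def)
qed

text \<open>Provides the hyperplane that cuts the second family in the volume ratio of the
  first.\<close>

lemma measure_halfspace_ivt:
  fixes U :: "'a::euclidean_space set"
  assumes U: "open U" "bounded U" "k \<in> Basis" and \<theta>: "0 < \<theta>" "\<theta> < 1"
  shows "\<exists>t. measure lebesgue (U \<inter> {x. x \<bullet> k < t}) = \<theta> * measure lebesgue U"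
proof -
  obtain B where B: "\<And>x. x \<in> U \<Longrightarrow> norm x \<le> B" using U(2) bounded_iff by blast
  have b: "\<bar>x \<bullet> k\<bar> \<le> B" if "x \<in> U" for x
    using Basis_le_norm[OF U(3), of x] B[OF that] by linarith
  define C where "C = max B 0 + 1"
  have e: "U \<inter> {x. x \<bullet> k < - C} = {}" "U \<inter> {x. x \<bullet> k < C} = U"
    using b by (force simp: C_def)+
  have "\<exists>t\<ge>-C. t \<le> C \<and> measure lebesgue (U \<inter> {x. x \<bullet> k < t}) = \<theta> * measure lebesgue U"
  proof (rule IVT)
    show "measure lebesgue (U \<inter> {x. x \<bullet> k < - C}) \<le> \<theta> * measure lebesgue U" unfolding e using \<theta> by simp
    show "\<theta> * measure lebesgue U \<le> measure lebesgue (U \<inter> {x. x \<bullet> k < C})"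
      unfolding e using \<theta> by (intro mult_left_le_one_le) auto
  qed (auto simp: C_def intro!: isCont_measure_halfspace U)
  then show ?thesis by blast
qed

text \<open>The side lengths of the sum are the sums of the side lengths. For each of them
  \<open>4 u w \<le> (u + w)^2\<close>, and the product over the basis is the square of the
  claim.\<close>

lemma brunn_minkowski_box:
  fixes a b c d :: "'a::euclidean_space"
  assumes "box a b \<noteq> {}" "box c d \<noteq> {}"
  shows "2 ^ DIM('a) * sqrt (measure lebesgue (box a b) * measure lebesgue (box c d))
    \<le> measure lebesgue (sumset (box a b) (box c d))"
proof -
  have lt: "a \<bullet> i < b \<bullet> i" "c \<bullet> i < d \<bullet> i" if "i \<in> Basis" for i
    using assms that by (auto simp: box_ne_empty)
  have vb: "measure lebesgue (box a b) = (\<Prod>i\<in>Basis. (b - a) \<bullet> i)" "measure lebesgue (box c d) = (\<Prod>i\<in>Basis. (d - c) \<bullet> i)"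
    "measure lebesgue (box (a + c) (b + d)) = (\<Prod>i\<in>Basis. (b - a) \<bullet> i + (d - c) \<bullet> i)"
    using lt by (auto simp: measure_lborel_box_eq less_imp_le add_mono inner_simps intro!: prod.cong)
  have "(2 ^ DIM('a) * sqrt (measure lebesgue (box a b) * measure lebesgue (box c d)))\<^sup>2
    = (\<Prod>i\<in>Basis. 4 * ((b - a) \<bullet> i * ((d - c) \<bullet> i)))"
    unfolding vb using lt
    by (simp add: power_mult_distrib real_sqrt_pow2 prod_nonneg less_imp_le inner_simps prod.distrib)
       (simp add: power2_eq_square flip: power_mult_distrib)
  also have "\<dots> \<le> (\<Prod>i\<in>Basis. ((b - a) \<bullet> i + (d - c) \<bullet> i)\<^sup>2)"
  proof (rule prod_mono)
    fix i :: 'a assume i: "i \<in> Basis"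
    define u w where "u = (b - a) \<bullet> i" and "w = (d - c) \<bullet> i"
    have "0 < u" "0 < w" using lt[OF i] by (auto simp: u_def w_def inner_simps)
    moreover have "4 * (u * w) \<le> (u + w)\<^sup>2"
      using zero_le_power2[of "u - w"] by (simp add: power2_eq_square algebra_simps)
    ultimately show "0 \<le> 4 * ((b - a) \<bullet> i * ((d - c) \<bullet> i)) \<and> 4 * ((b - a) \<bullet> i * ((d - c) \<bullet> i)) \<le> ((b - a) \<bullet> i + (d - c) \<bullet> i)\<^sup>2"
      by (simp flip: u_def w_def)
  qed
  also have "\<dots> = (measure lebesgue (box (a + c) (b + d)))\<^sup>2"
    unfolding vb by (simp add: prod_power_distrib)
  finally have "2 ^ DIM('a) * sqrt (measure lebesgue (box a b) * measure lebesgue (box c d)) \<le> measure lebesgue (box (a + c) (b + d))"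
    by (rule power2_le_imp_le) simp
  also have "\<dots> \<le> measure lebesgue (sumset (box a b) (box c d))"
  proof (rule measure_mono_fmeasurable)
    show "sumset (box a b) (box c d) \<in> lmeasurable"
      by (intro lmeasurable_open bounded_sumset open_sumset) auto
    show "box (a + c) (b + d) \<subseteq> sumset (box a b) (box c d)"
    proof
      fix x assume x: "x \<in> box (a + c) (b + d)"
      \<comment> \<open>The relative position of \<open>x\<close> in the summed box, coordinate by
        coordinate. \<open>y\<close> takes the same position in the first box, and
        \<open>x - y\<close> then takes it in the second.\<close>
      define l where "l i = (x \<bullet> i - a \<bullet> i - c \<bullet> i) / ((b \<bullet> i - a \<bullet> i) + (d \<bullet> i - c \<bullet> i))" for i
      define y where "y = (\<Sum>i\<in>Basis. (a \<bullet> i + l i * (b \<bullet> i - a \<bullet> i)) *\<^sub>R i)"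
      have l: "0 < l i" "l i < 1" if "i \<in> Basis" for i
        using lt[OF that] x that by (auto simp: l_def mem_box inner_simps field_simps)
      have yi: "y \<bullet> i = a \<bullet> i + l i * (b \<bullet> i - a \<bullet> i)" if "i \<in> Basis" for i
        using that by (simp add: y_def)
      have xi: "x \<bullet> i - y \<bullet> i = c \<bullet> i + l i * (d \<bullet> i - c \<bullet> i)" if "i \<in> Basis" for i
      proof -
        have "l i * ((b \<bullet> i - a \<bullet> i) + (d \<bullet> i - c \<bullet> i)) = x \<bullet> i - a \<bullet> i - c \<bullet> i"
          using lt[OF that] by (simp add: l_def)
        then show ?thesis unfolding yi[OF that] by (simp add: algebra_simps)
      qed
      have between: "r < r + t * (s - r) \<and> r + t * (s - r) < s" if "0 < t" "t < 1" "r < s" for r s t :: real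
      proof -
        define e where "e = s - r"
        have "0 < t * e" "0 < (1 - t) * e" using that by (auto simp: e_def)
        then show ?thesis unfolding e_def[symmetric] by (auto simp: e_def algebra_simps)
      qed
      have "a \<bullet> i < y \<bullet> i \<and> y \<bullet> i < b \<bullet> i" if "i \<in> Basis" for i
        unfolding yi[OF that] using between lt[OF that] l[OF that] by blast
      moreover have "c \<bullet> i < (x - y) \<bullet> i \<and> (x - y) \<bullet> i < d \<bullet> i" if "i \<in> Basis" for i
        unfolding inner_diff_left xi[OF that] using between lt[OF that] l[OF that] by blast
      ultimately have "y \<in> box a b" "x - y \<in> box c d" by (auto simp: mem_box)
      then show "x \<in> sumset (box a b) (box c d)" unfolding sumset_iff by (intro bexI[of _ y] bexI[of _ "x - y"]) auto
    qed
  qed auto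
  finally show ?thesis .
qed

text \<open>Hadwiger and Ohmann's induction: cut one family by a coordinate hyperplane between two of its boxes,
  and the other one by a parallel hyperplane in the same volume ratio. For the geometric mean of the
  volumes, the bounds for the two sides simply add up.\<close>

lemma brunn_minkowski_family:
  fixes \<A> \<B> :: "'a::euclidean_space set set"
  assumes "box_family \<A>" "box_family \<B>" "\<A> \<noteq> {}" "\<B> \<noteq> {}"
  shows "2 ^ DIM('a) * sqrt (measure lebesgue (\<Union>\<A>) * measure lebesgue (\<Union>\<B>))
    \<le> measure lebesgue (sumset (\<Union>\<A>) (\<Union>\<B>))"
  using assms
proof (induction "card \<A> + card \<B>" arbitrary: \<A> \<B> rule: less_induct)
  case less
  define V where "V = (measure lebesgue :: 'a set \<Rightarrow> real)"
  \<comment> \<open>One cut. The families are named afresh so that the step applies to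
    \<open>\<A>\<close> and, with exchanged roles, to \<open>\<B>\<close>; only the total number of
    boxes is tied to the induction.\<close>
  have step: "2 ^ DIM('a) * sqrt (V (\<Union>\<C>) * V (\<Union>\<D>)) \<le> V (sumset (\<Union>\<C>) (\<Union>\<D>))"
    if fam: "box_family \<C>" "box_family \<D>" "\<D> \<noteq> {}" and D12: "D1 \<in> \<C>" "D2 \<in> \<C>"
      and k: "k \<in> Basis" "D1 \<subseteq> {x. x \<bullet> k < t}" "D2 \<subseteq> {x. t < x \<bullet> k}"
      and card: "card \<C> + card \<D> = card \<A> + card \<B>"
    for \<C> \<D> D1 D2 k t
  proof -
    define L where "L = (\<lambda>t. {x::'a. x \<bullet> k < t})"
    define G where "G = (\<lambda>t. {x::'a. t < x \<bullet> k})"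
    define cut where "cut H \<A> = (\<lambda>D. D \<inter> H) ` \<A> - {{}}" for H :: "'a set" and \<A>
    have HL: "\<exists>c d. box a b \<inter> L s = box c d" and HG: "\<exists>c d. box a b \<inter> G s = box c d" for a b s
      unfolding L_def G_def using box_Int_halfspace[OF k(1)] by blast+
    let ?C = "\<Union>\<C>" and ?D = "\<Union>\<D>"
    have ob: "open ?C" "open ?D" "bounded ?C" "bounded ?D" using box_family_open box_family_bounded fam by blast+
    have oL: "open (L s)" "open (G s)" for s
      unfolding L_def G_def by (auto intro: open_halfspace_component_lt open_halfspace_component_gt)
    have split: "V ?C = V (?C \<inter> L s) + V (?C \<inter> G s)" "V ?D = V (?D \<inter> L s) + V (?D \<inter> G s)" for s
      unfolding V_def L_def G_def using measure_split_halfspace ob k(1) by blast+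
    have D12': "D1 \<noteq> {}" "D2 \<noteq> {}" using fam(1) D12 by (auto simp: box_family_def)
    have ne: "?C \<inter> L t \<noteq> {}" "?C \<inter> G t \<noteq> {}" using D12 D12' k(2,3) by (auto simp: L_def G_def)
    have pos: "0 < V (?C \<inter> L t)" "0 < V (?C \<inter> G t)"
      unfolding V_def by (rule open_measure_pos; use ne ob oL in \<open>auto intro: bounded_Int\<close>)+
    \<comment> \<open>The share of the first volume to the left of the cut. The second union is cut
      at a level \<open>s\<close> with the same share, so that both products under the root carry
      the factor \<open>\<theta>\<close> squared on the left and \<open>1 - \<theta>\<close> squared
      on the right.\<close>
    define \<theta> where "\<theta> = V (?C \<inter> L t) / V ?C"
    have \<theta>: "0 < \<theta>" "\<theta> < 1" using pos split(1)[of t] by (auto simp: \<theta>_def)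
    have VC: "V (?C \<inter> L t) = \<theta> * V ?C" using pos split(1)[of t] by (simp add: \<theta>_def)
    then have VC': "V (?C \<inter> G t) = (1 - \<theta>) * V ?C" using split(1)[of t] by (simp add: algebra_simps)
    obtain s where VD: "V (?D \<inter> L s) = \<theta> * V ?D"
      using measure_halfspace_ivt[OF ob(2,4) k(1) \<theta>] unfolding V_def L_def by blast
    then have VD': "V (?D \<inter> G s) = (1 - \<theta>) * V ?D" using split(2)[of s] by (simp add: algebra_simps)
    have "?D \<noteq> {}" using fam by (auto simp: box_family_def)
    then have VDp: "0 < V ?D" unfolding V_def using ob by (intro open_measure_pos) auto
    have ne2: "?D \<inter> L s \<noteq> {}" "?D \<inter> G s \<noteq> {}"
      using VD VD' VDp \<theta> by (auto simp: V_def)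
    note cC = box_family_cut[OF fam(1) HL[of _ _ t], folded cut_def] box_family_cut[OF fam(1) HG[of _ _ t], folded cut_def]
    note cD = box_family_cut[OF fam(2) HL[of _ _ s], folded cut_def] box_family_cut[OF fam(2) HG[of _ _ s], folded cut_def]
    \<comment> \<open>Each half of the first family loses one of the two separated boxes, and the
      second family gains none, so the induction hypothesis applies to both halves.\<close>
    have "D2 \<inter> L t = {}" "D1 \<inter> G t = {}" using k by (auto simp: L_def G_def)
    then have lt: "card (cut (L t) \<C>) < card \<C>" "card (cut (G t) \<C>) < card \<C>"
      using cC(4)[OF D12(2)] cC(8)[OF D12(1)] by auto
    have 1: "2 ^ DIM('a) * sqrt (V (?C \<inter> L t) * V (?D \<inter> L s)) \<le> V (sumset (?C \<inter> L t) (?D \<inter> L s))"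
      using less(1)[of "cut (L t) \<C>" "cut (L s) \<D>"] cC(1,2) cD(1,2,3) lt(1) ne ne2 card
      by (fastforce simp: V_def)
    have 2: "2 ^ DIM('a) * sqrt (V (?C \<inter> G t) * V (?D \<inter> G s)) \<le> V (sumset (?C \<inter> G t) (?D \<inter> G s))"
      using less(1)[of "cut (G t) \<C>" "cut (G s) \<D>"] cC(5,6) cD(5,6,7) lt(2) ne ne2 card
      by (fastforce simp: V_def)
    have sq: "sqrt (V (?C \<inter> L t) * V (?D \<inter> L s)) = \<theta> * sqrt (V ?C * V ?D)"
      "sqrt (V (?C \<inter> G t) * V (?D \<inter> G s)) = (1 - \<theta>) * sqrt (V ?C * V ?D)"
      unfolding VC VD VC' VD' using \<theta> by (simp_all add: real_sqrt_mult)
    let ?S1 = "sumset (?C \<inter> L t) (?D \<inter> L s)" and ?S2 = "sumset (?C \<inter> G t) (?D \<inter> G s)"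
    have m: "?S1 \<in> lmeasurable" "?S2 \<in> lmeasurable" "sumset ?C ?D \<in> lmeasurable"
      using ob oL by (auto intro!: lmeasurable_open bounded_sumset open_sumset bounded_Int)
    \<comment> \<open>The hyperplane at level \<open>t + s\<close> separates the two sumsets, so
      their volumes add.\<close>
    have "?S1 \<inter> ?S2 = {}"
    proof -
      have "z \<bullet> k < t + s" if "z \<in> ?S1" for z
        using that unfolding sumset_iff L_def by (auto simp: inner_simps)
      moreover have "t + s < z \<bullet> k" if "z \<in> ?S2" for z
        using that unfolding sumset_iff G_def by (auto simp: inner_simps)
      ultimately show ?thesis by fastforce
    qed
    then have "?S2 - ?S1 = ?S2" by blast
    then have "V ?S1 + V ?S2 = V (?S1 \<union> ?S2)" unfolding V_def using measure_Un2[OF m(1,2)] by simp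
    also have "\<dots> \<le> V (sumset ?C ?D)" unfolding V_def
      using m sumset_mono[of "?C \<inter> L t" ?C "?D \<inter> L s" ?D] sumset_mono[of "?C \<inter> G t" ?C "?D \<inter> G s" ?D]
      by (intro measure_mono_fmeasurable) (auto simp: fmeasurableD)
    finally have "V ?S1 + V ?S2 \<le> V (sumset ?C ?D)" .
    moreover have "2 ^ DIM('a) * sqrt (V ?C * V ?D) =
      2 ^ DIM('a) * (\<theta> * sqrt (V ?C * V ?D)) + 2 ^ DIM('a) * ((1 - \<theta>) * sqrt (V ?C * V ?D))"
      by (simp add: algebra_simps)
    ultimately show ?thesis using 1 2 unfolding sq by linarith
  qed
  have step2: "2 ^ DIM('a) * sqrt (V (\<Union>\<C>) * V (\<Union>\<D>)) \<le> V (sumset (\<Union>\<C>) (\<Union>\<D>))"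
    if fam: "box_family \<C>" "box_family \<D>" "\<D> \<noteq> {}" and D12: "D1 \<in> \<C>" "D2 \<in> \<C>" "D1 \<noteq> D2"
      and card: "card \<C> + card \<D> = card \<A> + card \<B>"
    for \<C> \<D> D1 D2
  proof -
    obtain a b c d where e: "D1 = box a b" "D2 = box c d" "D1 \<noteq> {}" "D2 \<noteq> {}"
      using fam(1) D12 unfolding box_family_def by meson
    have "box a b \<inter> box c d = {}" using fam(1) D12 e unfolding box_family_def pairwise_def disjnt_def by blast
    \<comment> \<open>The first two alternatives would make one of the boxes empty; the other two
      give a separating hyperplane.\<close>
    then obtain k where k: "k \<in> Basis" "b \<bullet> k \<le> a \<bullet> k \<or> d \<bullet> k \<le> c \<bullet> k \<or> b \<bullet> k \<le> c \<bullet> k \<or> d \<bullet> k \<le> a \<bullet> k"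
      unfolding disjoint_interval by blast
    have "a \<bullet> k < b \<bullet> k" "c \<bullet> k < d \<bullet> k" using e k(1) by (auto simp: box_ne_empty)
    with k(2) consider "b \<bullet> k \<le> c \<bullet> k" | "d \<bullet> k \<le> a \<bullet> k" by linarith
    then show ?thesis
    proof cases
      case 1
      then show ?thesis using k(1) e
        by (intro step[OF fam D12(1,2) k(1), of "b \<bullet> k"] card) (force simp: mem_box)+
    next
      case 2
      then show ?thesis using k(1) e
        by (intro step[OF fam D12(2,1) k(1), of "d \<bullet> k"] card) (force simp: mem_box)+
    qed
  qed
  have fin: "finite \<A>" "finite \<B>" using less.prems by (auto simp: box_family_def)
  show ?case
  proof (cases "(\<exists>D1\<in>\<A>. \<exists>D2\<in>\<A>. D1 \<noteq> D2) \<or> (\<exists>D1\<in>\<B>. \<exists>D2\<in>\<B>. D1 \<noteq> D2)")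
    case True
    then show ?thesis
    proof
      assume "\<exists>D1\<in>\<A>. \<exists>D2\<in>\<A>. D1 \<noteq> D2"
      then show ?thesis using step2[OF less.prems(1,2,4)] unfolding V_def by blast
    next
      assume "\<exists>D1\<in>\<B>. \<exists>D2\<in>\<B>. D1 \<noteq> D2"
      then show ?thesis using step2[OF less.prems(2,1,3)] unfolding V_def
        by (metis add.commute mult.commute sumset_commute)
    qed
  next
    case False
    obtain D E where DE: "D \<in> \<A>" "E \<in> \<B>" using less.prems(3,4) by blast
    from False have F: "(\<forall>D1\<in>\<A>. \<forall>D2\<in>\<A>. D1 = D2)" "(\<forall>D1\<in>\<B>. \<forall>D2\<in>\<B>. D1 = D2)" by meson+
    have "x = D" if "x \<in> \<A>" for x by (rule F(1)[rule_format, OF that DE(1)])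
    moreover have "x = E" if "x \<in> \<B>" for x by (rule F(2)[rule_format, OF that DE(2)])
    ultimately have eq: "\<A> = {D}" "\<B> = {E}" using DE by (blast intro: subset_antisym)+
    obtain a b c d where "D = box a b" "E = box c d" "D \<noteq> {}" "E \<noteq> {}"
      using less.prems(1,2) DE unfolding box_family_def by meson
    then show ?thesis using brunn_minkowski_box[of a b c d] by (simp add: eq)
  qed
qed

text \<open>\<open>U\<close> is a countable union of closed boxes. Finitely many of them exhaust its
  volume up to \<open>e\<close>; their union is cut into non-overlapping boxes, and passing to the
  interiors loses only faces.\<close>

lemma open_approx_box_family:
  fixes U :: "'a::euclidean_space set"
  assumes U: "open U" "bounded U" and e: "0 < e"
  shows "\<exists>\<A>. box_family \<A> \<and> \<Union>\<A> \<subseteq> U \<and> measure lebesgue U - e < measure lebesgue (\<Union>\<A>)"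
proof -
  obtain \<D> where D: "countable \<D>" "\<D> \<subseteq> Pow U" "\<And>X. X \<in> \<D> \<Longrightarrow> \<exists>a b. X = cbox a b" "\<Union>\<D> = U"
    using open_countable_Union_open_cbox[OF U(1)] by metis
  have Um: "U \<in> lmeasurable" using U by (intro lmeasurable_open)
  have Dm: "d \<in> lmeasurable" if "d \<in> \<D>" for d using D(3)[OF that] by auto
  have B: "measure lebesgue (\<Union>D') \<le> measure lebesgue U" if "D' \<subseteq> \<D>" "finite D'" for D'
    using that D(4) Um Dm by (intro measure_mono_fmeasurable fmeasurableD fmeasurable.finite_Union) auto
  obtain D' where D': "D' \<subseteq> \<D>" "finite D'" "measure lebesgue (\<Union>\<D>) - e < measure lebesgue (\<Union>D')"
    using measure_countable_Union_approachable[OF D(1) e Dm B] by blast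
  obtain P where P: "P division_of (\<Union>D')"
    using elementary_unions_intervals[OF D'(2)] D(3) D'(1) by (metis subsetD)
  define \<A> where "\<A> = interior ` P - {{}}"
  have fP: "finite P" using P by (rule division_ofD)
  have Pb: "\<exists>a b. K = cbox a b" if "K \<in> P" for K using division_ofD(4)[OF P that] by simp
  have fam: "box_family \<A>" unfolding box_family_def
  proof (intro conjI ballI)
    show "finite \<A>" using fP by (simp add: \<A>_def)
    show "\<exists>a b. D = box a b" if "D \<in> \<A>" for D
      using that Pb unfolding \<A>_def by (metis DiffD1 imageE interior_cbox)
    show "pairwise disjnt \<A>"
      unfolding pairwise_def disjnt_def \<A>_def using division_ofD(5)[OF P] by blast
  qed (auto simp: \<A>_def)
  have sub: "\<Union>\<A> \<subseteq> \<Union>D'" unfolding \<A>_def division_ofD(6)[OF P, symmetric] using interior_subset by fastforce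
  have "measure lebesgue (\<Union>\<A>) = measure lebesgue (\<Union>D')"
  proof (rule measure_negligible_symdiff)
    show "\<Union>D' \<in> lmeasurable" using D' Dm by (intro fmeasurable.finite_Union) auto
    have "negligible (\<Union>K\<in>P. K - interior K)"
      using fP Pb by (intro negligible_Union) (auto, metis interior_cbox negligible_frontier_interval)
    moreover have "\<Union>D' - \<Union>\<A> \<subseteq> (\<Union>K\<in>P. K - interior K)"
      unfolding \<A>_def division_ofD(6)[OF P, symmetric] by auto
    ultimately show "negligible (\<Union>D' - \<Union>\<A> \<union> (\<Union>\<A> - \<Union>D'))"
      using sub by (metis Diff_eq_empty_iff negligible_subset sup_bot.right_neutral)
  qed
  then show ?thesis using fam sub D' D(4) by (intro exI[of _ \<A>]) auto
qed

text \<open>Approximation from inside only shrinks the sumset, so the right-hand side is free of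
  \<open>e\<close>, and \<open>e\<close> tends to 0 on the left.\<close>

lemma brunn_minkowski_sqrt:
  fixes U W :: "'a::euclidean_space set"
  assumes U: "open U" "bounded U" "U \<noteq> {}" and W: "open W" "bounded W" "W \<noteq> {}"
  shows "2 ^ DIM('a) * sqrt (measure lebesgue U * measure lebesgue W) \<le> measure lebesgue (sumset U W)"
proof -
  let ?V = "measure lebesgue :: 'a set \<Rightarrow> real"
  have pos: "0 < ?V U" "0 < ?V W" using open_measure_pos assms by blast+
  have m: "sumset U W \<in> lmeasurable" using assms by (intro lmeasurable_open bounded_sumset open_sumset)
  have "2 ^ DIM('a) * sqrt ((?V U - e) * (?V W - e)) \<le> ?V (sumset U W)" if e: "0 < e" "e < ?V U" "e < ?V W" for e
  proof -
    obtain \<A> \<B> where A: "box_family \<A>" "\<Union>\<A> \<subseteq> U" "?V U - e < ?V (\<Union>\<A>)"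
      and B: "box_family \<B>" "\<Union>\<B> \<subseteq> W" "?V W - e < ?V (\<Union>\<B>)"
      using open_approx_box_family[OF U(1,2) e(1)] open_approx_box_family[OF W(1,2) e(1)] by blast
    have "\<A> \<noteq> {}" "\<B> \<noteq> {}" using A B e by auto
    have "2 ^ DIM('a) * sqrt ((?V U - e) * (?V W - e)) \<le> 2 ^ DIM('a) * sqrt (?V (\<Union>\<A>) * ?V (\<Union>\<B>))"
      using A B e by (intro mult_left_mono real_sqrt_le_mono mult_mono) auto
    also have "\<dots> \<le> ?V (sumset (\<Union>\<A>) (\<Union>\<B>))"
      by (rule brunn_minkowski_family) fact+
    also have "\<dots> \<le> ?V (sumset U W)"
      using m A B by (intro measure_mono_fmeasurable sumset_mono fmeasurableD[OF lmeasurable_open] bounded_sumset open_sumset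
          box_family_open box_family_bounded)
    finally show ?thesis .
  qed
  then have ev: "\<forall>\<^sub>F e in at_right 0. 2 ^ DIM('a) * sqrt ((?V U - e) * (?V W - e)) \<le> ?V (sumset U W)"
    unfolding eventually_at_right_field using pos by (intro exI[of _ "min (?V U) (?V W)"]) auto
  have "((\<lambda>e. 2 ^ DIM('a) * sqrt ((?V U - e) * (?V W - e))) \<longlongrightarrow> 2 ^ DIM('a) * sqrt ((?V U - 0) * (?V W - 0))) (at_right 0)"
    by (intro tendsto_intros)
  from tendsto_upperbound[OF this ev] show ?thesis by simp
qed

section \<open>The isodiametric inequality and its case of equality\<close>

lemma lebesgue_measure_uminus:
  fixes S :: "'a::euclidean_space set"
  shows "measure lebesgue (uminus ` S) = measure lebesgue S"
proof -
  have "(\<lambda>x. (- 1) *\<^sub>R x + 0) ` S = uminus ` S" by (intro image_cong) auto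
  then show ?thesis using measure_lebesgue_affine[of "- 1" 0 S] by simp
qed

text \<open>By Brunn-Minkowski with the reflected set, the difference set of \<open>\<Omega>\<close>
  has at least \<open>2 ^ DIM('a)\<close> times the volume of \<open>\<Omega>\<close>, and it lies
  in the ball of radius \<open>2 * R\<close>. If the volumes agree, it fills this ball up to a null
  set; as the differences of points of the closure form a compact set, not a single point can then
  be missing.\<close>

lemma isodiametric:
  fixes \<Omega> :: "'a::euclidean_space set"
  assumes \<Omega>: "open \<Omega>" "bounded \<Omega>" "\<Omega> \<noteq> {}" and R: "0 < R"
    and diam: "\<And>x y. x \<in> \<Omega> \<Longrightarrow> y \<in> \<Omega> \<Longrightarrow> dist x y \<le> 2 * R"
  shows "measure lebesgue \<Omega> \<le> measure lebesgue (ball (0::'a) R)"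
    and "measure lebesgue \<Omega> = measure lebesgue (ball (0::'a) R) \<Longrightarrow> norm z \<le> 2 * R \<Longrightarrow>
      \<exists>a\<in>closure \<Omega>. \<exists>b\<in>closure \<Omega>. a - b = z"
proof -
  let ?V = "measure lebesgue :: 'a set \<Rightarrow> real" and ?D = "sumset \<Omega> (uminus ` \<Omega>)"
  have neg: "open (uminus ` \<Omega>)" "bounded (uminus ` \<Omega>)" "uminus ` \<Omega> \<noteq> {}"
    using \<Omega> by (auto intro: open_negations)
  have "2 ^ DIM('a) * sqrt (?V \<Omega> * ?V (uminus ` \<Omega>)) \<le> ?V ?D"
    by (rule brunn_minkowski_sqrt[OF \<Omega> neg])
  then have BM: "2 ^ DIM('a) * ?V \<Omega> \<le> ?V ?D"
    by (simp add: lebesgue_measure_uminus)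
  have Dm: "?D \<in> lmeasurable" using \<Omega> neg by (intro lmeasurable_open open_sumset bounded_sumset)
  have sub: "?D \<subseteq> cball 0 (2 * R)"
    using diam by (auto simp: sumset_iff dist_norm)
  have vol: "?V (cball 0 (2 * R)) = 2 ^ DIM('a) * ?V (ball 0 R)" "?V (cball 0 (2 * R)) = ?V (ball 0 (2 * R))"
    using R by (auto simp: content_ball content_cball power_mult_distrib)
  have "?V ?D \<le> ?V (cball 0 (2 * R))"
    using sub Dm by (intro measure_mono_fmeasurable) (auto simp: fmeasurableD)
  with BM vol(1) have "2 ^ DIM('a) * ?V \<Omega> \<le> 2 ^ DIM('a) * ?V (ball 0 R)" by linarith
  then show "?V \<Omega> \<le> ?V (ball 0 R)" by (rule mult_left_le_imp_le) simp
  show "\<exists>a\<in>closure \<Omega>. \<exists>b\<in>closure \<Omega>. a - b = z" if eq: "?V \<Omega> = ?V (ball 0 R)" and z: "norm z \<le> 2 * R"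
  proof (rule ccontr)
    define E where "E = {x - y | x y. x \<in> closure \<Omega> \<and> y \<in> closure \<Omega>}"
    assume "\<not> ?thesis"
    then have zE: "z \<notin> E" unfolding E_def by blast
    have "compact E" unfolding E_def using \<Omega>(2) by (intro compact_differences) auto
    then have oE: "open (- E)" using compact_imp_closed by blast
    \<comment> \<open>The point \<open>z\<close> may lie on the sphere, but the open complement of
      \<open>E\<close> then meets the open ball as well, in a set of positive measure.\<close>
    have "z \<in> closure (ball 0 (2 * R))" using z R by simp
    then have "- E \<inter> ball 0 (2 * R) \<noteq> {}"
      using zE oE open_Int_closure_eq_empty[of "- E" "ball 0 (2 * R)"] by blast
    then have pos: "0 < ?V (ball 0 (2 * R) - E)"
      using oE by (intro open_measure_pos) (auto simp: Diff_eq Int_commute)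
    have DE: "?D \<subseteq> E"
      unfolding E_def sumset_def using closure_subset[of \<Omega>] by force
    have Em: "ball 0 (2 * R) - E \<in> lmeasurable"
      using oE by (intro lmeasurable_open) (auto simp: Diff_eq)
    have "?V ?D + ?V ((ball 0 (2 * R) - E) - ?D) = ?V (?D \<union> (ball 0 (2 * R) - E))"
      using measure_Un2[OF Dm Em] by simp
    also have "\<dots> \<le> ?V (cball 0 (2 * R))"
      using sub Dm Em by (intro measure_mono_fmeasurable) (auto simp: fmeasurableD)
    also have "(ball 0 (2 * R) - E) - ?D = ball 0 (2 * R) - E" using DE by blast
    finally show False using pos BM eq vol by simp
  qed
qed

lemma exists_orthogonal:
  fixes z :: "'a::euclidean_space"
  assumes "2 \<le> DIM('a)"
  obtains y where "y \<noteq> 0" "y \<bullet> z = 0"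
proof -
  have "dim {z} < DIM('a)" using dim_le_card[of "{z}" "{z}"] assms span_superset by fastforce
  from orthogonal_to_subspace_exists[OF this] show ?thesis
    using that by (metis insertI1 orthogonal_def span_base)
qed

text \<open>If every ray from \<open>0\<close> into \<open>S\<close> stayed in the closure of \<open>S\<close> up to distance \<open>\<rho>\<close>, then \<open>S\<close>
  would have a supporting hyperplane at \<open>0\<close> with normal \<open>n\<close> that contains another point \<open>y\<close> of the
  closure. The diameter in direction \<open>n\<close> can then only be attained between \<open>0\<close> and \<open>- 2 R n\<close>, but
  the latter point is too far away from \<open>y\<close>.\<close>

lemma exists_short_ray:
  fixes S :: "'a::euclidean_space set"
  assumes dim: "2 \<le> DIM('a)" and S: "open S" "bounded S" "S \<noteq> {}" "0 \<in> closure S"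
    and \<rho>: "0 < \<rho>" and R: "0 < R"
    and diam: "\<And>x y. x \<in> closure S \<Longrightarrow> y \<in> closure S \<Longrightarrow> dist x y \<le> 2 * R"
    and z: "z \<in> closure S" "norm z = 2 * R"
    and width: "\<And>n. norm n = 2 * R \<Longrightarrow> \<exists>a\<in>closure S. \<exists>b\<in>closure S. a - b = n"
  shows "\<exists>x\<in>S. x \<noteq> 0 \<and> (\<rho> / norm x) *\<^sub>R x \<notin> closure S"
proof (rule ccontr)
  assume "\<not> ?thesis"
  then have ray: "(\<rho> / norm x) *\<^sub>R x \<in> closure S" if "x \<in> S" "x \<noteq> 0" for x using that by blast
  \<comment> \<open>Expands \<open>|x - z| \<le> 2 R = |z|\<close>. Hence
    \<open>x \<bullet> z\<close> is positive on the closure of \<open>S\<close> except at 0, and one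
    may divide by it below.\<close>
  have xz: "(norm x)\<^sup>2 / 2 \<le> x \<bullet> z" if "x \<in> closure S" for x
  proof -
    have "(norm (x - z))\<^sup>2 \<le> (2 * R)\<^sup>2"
      using diam[OF that z(1)] by (intro power_mono) (auto simp: dist_norm)
    moreover have "(norm (x - z))\<^sup>2 = (norm x)\<^sup>2 - 2 * (x \<bullet> z) + (norm z)\<^sup>2"
      by (simp add: power2_norm_eq_inner inner_diff_left inner_diff_right inner_commute[of z x])
    ultimately show ?thesis unfolding z(2) by linarith
  qed
  define Z where "Z = closure S \<inter> sphere 0 \<rho>"
  have "S \<noteq> {0}" using S(1) not_open_singleton[of "0::'a"] by metis
  then have "\<exists>x\<in>S. x \<noteq> 0" using S(3) subset_singletonD[of S 0] by fast
  then obtain x0 where x0: "x0 \<in> S" "x0 \<noteq> 0" by blast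
  have "(\<rho> / norm x0) *\<^sub>R x0 \<in> Z" unfolding Z_def using ray[OF x0] x0(2) \<rho> by simp
  then have Zne: "Z \<noteq> {}" by blast
  have Zc: "compact Z" unfolding Z_def using S(2) by (intro compact_Int_closed compact_closure[THEN iffD2]) auto
  have Zpos: "0 < y \<bullet> z" if "y \<in> Z" for y
    using xz[of y] that \<rho> unfolding Z_def by (auto intro: less_le_trans[of 0 "\<rho>\<^sup>2 / 2"])
  obtain f where f: "f \<noteq> 0" "f \<bullet> z = 0" using exists_orthogonal[OF dim] by blast
  \<comment> \<open>The quotient is constant along rays. Maximising it over the compact trace
    \<open>Z\<close> on a sphere selects an extreme direction \<open>y\<close> of the cone; with the
    maximum \<open>\<sigma>\<close>, the vector \<open>f - \<sigma> z\<close> is orthogonal to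
    \<open>y\<close> and has nonpositive inner product with all points of \<open>S\<close>.\<close>
  have "continuous_on Z (\<lambda>y. (y \<bullet> f) / (y \<bullet> z))"
    using Zpos by (intro continuous_intros) force
  from continuous_attains_sup[OF Zc Zne this] obtain y where
    y: "y \<in> Z" and ymax: "\<And>x. x \<in> Z \<Longrightarrow> (x \<bullet> f) / (x \<bullet> z) \<le> (y \<bullet> f) / (y \<bullet> z)" by blast
  define \<sigma> where "\<sigma> = (y \<bullet> f) / (y \<bullet> z)"
  define n0 where "n0 = f - \<sigma> *\<^sub>R z"
  have "n0 \<bullet> f = f \<bullet> f" using f(2) by (simp add: n0_def inner_simps inner_commute)
  then have n0: "n0 \<noteq> 0" using f(1) by auto
  define n where "n = n0 /\<^sub>R norm n0"
  have n: "norm n = 1" using n0 by (simp add: n_def)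
  have yn: "y \<bullet> n = 0"
    using Zpos[OF y] by (simp add: n_def n0_def inner_simps \<sigma>_def)
  have negS: "x \<bullet> n \<le> 0" if "x \<in> S" for x
  proof (cases "x = 0")
    case False
    have Zx: "(\<rho> / norm x) *\<^sub>R x \<in> Z" unfolding Z_def using ray[OF that False] False \<rho> by simp
    define s where "s = \<rho> / norm x"
    have s: "0 < s" using False \<rho> by (simp add: s_def)
    have "(x \<bullet> f) / (x \<bullet> z) \<le> \<sigma>"
      using ymax[OF Zx] s unfolding s_def[symmetric] by (simp add: \<sigma>_def)
    moreover have "0 < x \<bullet> z" using Zpos[OF Zx] s unfolding s_def[symmetric] by (simp add: zero_less_mult_iff)
    ultimately have "x \<bullet> n0 \<le> 0" by (simp add: n0_def inner_simps field_simps)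
    then show ?thesis by (simp add: n_def mult_nonneg_nonpos)
  qed simp
  have neg: "x \<bullet> n \<le> 0" if "x \<in> closure S" for x
  proof (rule continuous_le_on_closure[where f = "\<lambda>x. x \<bullet> n"])
    show "continuous_on (closure S) (\<lambda>x. x \<bullet> n)" by (intro continuous_intros)
  qed (use that negS in auto)
  obtain a b where ab: "a \<in> closure S" "b \<in> closure S" "a - b = (2 * R) *\<^sub>R n"
  proof -
    have "norm ((2 * R) *\<^sub>R n) = 2 * R" using n R by simp
    then show ?thesis using width that by blast
  qed
  have "(a - b) \<bullet> n = 2 * R" using ab(3) n by (simp add: norm_eq_1)
  then have bn: "b \<bullet> n \<le> - 2 * R" using neg[OF ab(1)] by (simp add: inner_simps)
  have nb: "norm b \<le> 2 * R" using diam[OF S(4) ab(2)] by (simp add: dist_norm)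
  have nn: "n \<bullet> n = 1" using n by (simp add: norm_eq_1)
  have sq: "(norm (v + c *\<^sub>R n))\<^sup>2 = (norm v)\<^sup>2 + 2 * c * (v \<bullet> n) + c * c" for v c
    unfolding power2_norm_eq_inner by (simp add: inner_add_left inner_add_right inner_commute[of n v] nn distrib_left)
  \<comment> \<open>The equality case of the Cauchy-Schwarz inequality by expanding a square:
    \<open>b \<bullet> n \<le> - 2 R\<close> and \<open>|b| \<le> 2 R\<close> leave only
    \<open>b = - 2 R n\<close>.\<close>
  have "4 * R * (b \<bullet> n) \<le> 4 * R * (- 2 * R)" using bn R by (intro mult_left_mono) auto
  moreover have "(norm b)\<^sup>2 \<le> (2 * R)\<^sup>2" using nb by (intro power_mono) auto
  ultimately have "(norm (b + (2 * R) *\<^sub>R n))\<^sup>2 \<le> 0"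
    unfolding sq by (simp add: power2_eq_square algebra_simps)
  then have "b + (2 * R) *\<^sub>R n = 0" by simp
  then have "y - b = y + (2 * R) *\<^sub>R n" by (metis add_diff_cancel_left' add_diff_eq diff_add_cancel add.commute diff_zero)
  then have "(norm (y - b))\<^sup>2 = (norm y)\<^sup>2 + 2 * (2 * R) * (y \<bullet> n) + (2 * R) * (2 * R)"
    by (simp only: sq)
  then have "(norm (y - b))\<^sup>2 = \<rho>\<^sup>2 + (2 * R)\<^sup>2"
    using y by (simp add: yn Z_def power2_eq_square)
  then have "(2 * R)\<^sup>2 < (norm (y - b))\<^sup>2" using \<rho> by simp
  then have "2 * R < norm (y - b)" using power_less_imp_less_base[of "2 * R" 2 "norm (y - b)"] by simp
  then show False using diam[of y b] y ab(2) by (auto simp: Z_def dist_norm)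
qed

lemma lborel_integral_affine:
  fixes f :: "'a::euclidean_space \<Rightarrow> real"
  assumes [measurable]: "f \<in> borel_measurable borel" and "c \<noteq> 0"
  shows "(\<integral>x. f x \<partial>lborel) = \<bar>c\<bar> ^ DIM('a) * (\<integral>x. f (t + c *\<^sub>R x) \<partial>lborel)"
proof -
  have "(\<integral>x. f x \<partial>lborel) = integral\<^sup>L (density (distr lborel borel (\<lambda>x. t + c *\<^sub>R x)) (\<lambda>_. \<bar>c\<bar>^DIM('a))) f"
    by (subst lborel_affine[OF assms(2), of t]) simp
  also have "\<dots> = \<bar>c\<bar> ^ DIM('a) * (\<integral>x. f (t + c *\<^sub>R x) \<partial>lborel)"
    by (subst integral_density; simp?) (subst integral_distr; simp)
  finally show ?thesis .
qed

section \<open>Energy of radial functions on starshaped sets\<close>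

lemma integrable_indicator_mult_bounded:
  fixes f :: "'a::euclidean_space \<Rightarrow> real"
  assumes "S \<in> sets borel" "bounded S" "(\<lambda>x. indicator S x * f x) \<in> borel_measurable borel"
    and "\<And>x. x \<in> S \<Longrightarrow> \<bar>f x\<bar> \<le> B"
  shows "integrable lborel (\<lambda>x. indicator S x * f x)"
proof (rule Bochner_Integration.integrable_bound)
  show "integrable lborel (\<lambda>x. indicator S x * B)"
    using emeasure_bounded_finite[OF assms(2)] assms(1) by (intro integrable_mult_left integrable_real_indicator) auto
  show "AE x in lborel. norm (indicator S x * f x) \<le> norm (indicator S x * B)"
    using assms(4) by (intro AE_I2) (force simp: indicator_def)
qed (use assms(3) in simp)

text \<open>The integrand \<open>N K + D\<close> is the divergence of the vector field \<open>K(x) x\<close>. By scaling, its integral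
  over \<open>S\<close> is the derivative at \<open>t = 1\<close> of the integral of \<open>K\<close> over \<open>t S\<close>.\<close>

lemma dilation_divergence_nonneg:
  fixes S :: "'a::euclidean_space set" and K D :: "'a \<Rightarrow> real"
  assumes S: "S \<in> sets borel" "bounded S"
    and star: "\<And>x t. x \<in> S \<Longrightarrow> 0 < t \<Longrightarrow> t < 1 \<Longrightarrow> t *\<^sub>R x \<in> S"
    and meas [measurable]: "K \<in> borel_measurable borel" "D \<in> borel_measurable borel"
    and bdd: "\<And>x. x \<in> S \<Longrightarrow> \<bar>K x\<bar> \<le> C" "\<And>x. x \<in> S \<Longrightarrow> \<bar>D x\<bar> \<le> C"
    and deriv: "\<And>x t. x \<in> S \<Longrightarrow> t \<in> {1/2..1} \<Longrightarrow>
      ((\<lambda>s. K (s *\<^sub>R x)) has_real_derivative D (t *\<^sub>R x) / t) (at t within {1/2..1})"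
    and nonneg: "\<tau> < 1" "\<And>x t. \<tau> \<le> t \<Longrightarrow> t < 1 \<Longrightarrow> t *\<^sub>R x \<in> S \<Longrightarrow> x \<notin> S \<Longrightarrow> 0 \<le> K (t *\<^sub>R x)"
  shows "0 \<le> (\<integral>x. indicator S x * (real DIM('a) * K x + D x) \<partial>lborel)"
proof -
  define N where "N = DIM('a)"
  \<comment> \<open>Dilation factors that increase to 1 and stay in the interval on which
    \<open>deriv\<close> is assumed.\<close>
  define T where "T n = real (Suc n) / real (Suc (Suc n))" for n :: nat
  have T: "T n \<in> {1/2..1}" "T n < 1" "0 < T n" for n by (auto simp: T_def field_simps)
  have Tlim: "T \<longlonglongrightarrow> 1" unfolding T_def by (rule LIMSEQ_Suc[OF LIMSEQ_n_over_Suc_n])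
  have Tf: "filterlim T (at 1 within {1/2..1}) sequentially"
    unfolding filterlim_at using Tlim T by (auto intro!: always_eventually simp: less_imp_neq)
  note [measurable] = S(1)
  have fin: "emeasure lborel S < \<infinity>" using S(2) by (rule emeasure_bounded_finite)
  have Sint: "integrable lborel (\<lambda>x. indicator S x * B)" for B :: real
    using fin S(1) by (intro integrable_mult_left integrable_real_indicator) auto
  have C: "0 \<le> C" if "x \<in> S" for x using bdd(1)[OF that] by linarith
  let ?g = "\<lambda>x s. s ^ N * K (s *\<^sub>R x)"
  have inS: "t *\<^sub>R x \<in> S" if "x \<in> S" "t \<in> {1/2..1}" for x t
    using star[OF that(1), of t] that by (cases "t = 1") auto
  have dg: "(?g x has_real_derivative (real N * t ^ (N - 1) * K (t *\<^sub>R x) + D (t *\<^sub>R x) / t * t ^ N)) (at t within {1/2..1})"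
    if "x \<in> S" "t \<in> {1/2..1}" for x t
    using deriv[OF that] by (auto intro!: derivative_eq_intros)
  have lim: "(\<lambda>n. (K x - ?g x (T n)) / (1 - T n)) \<longlonglongrightarrow> real N * K x + D x" if x: "x \<in> S" for x
  proof -
    have "((\<lambda>s. (?g x s - ?g x 1) / (s - 1)) \<longlongrightarrow> real N * K x + D x) (at 1 within {1/2..1})"
      using dg[OF x, of 1] by (simp add: has_field_derivative_iff)
    from filterlim_compose[OF this Tf]
    have "(\<lambda>n. (?g x (T n) - K x) / (T n - 1)) \<longlonglongrightarrow> real N * K x + D x" by simp
    moreover have "(?g x (T n) - K x) / (T n - 1) = (K x - ?g x (T n)) / (1 - T n)" for n
      using minus_divide_divide[of "?g x (T n) - K x" "T n - 1"] by simp
    ultimately show ?thesis by simp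
  qed
  \<comment> \<open>Mean value inequality along the ray: the derivative of \<open>s^N K(s x)\<close>
    is at most \<open>N C + 2 C\<close>, the 2 coming from \<open>t \<ge> 1/2\<close>. This gives
    the dominating function.\<close>
  have bnd: "\<bar>(K x - ?g x (T n)) / (1 - T n)\<bar> \<le> (real N + 2) * C" if x: "x \<in> S" for x n
  proof -
    have "norm (?g x 1 - ?g x (T n)) \<le> ((real N + 2) * C) * norm (1 - T n)"
    proof (rule field_differentiable_bound[OF _ dg[OF x]])
      fix t :: real assume t: "t \<in> {1/2..1}"
      have p1: "t ^ k \<le> 1" "0 \<le> t ^ k" for k using t by (auto intro: power_le_one)
      have "\<bar>real N * t ^ (N - 1) * K (t *\<^sub>R x)\<bar> \<le> real N * 1 * C"
        unfolding abs_mult using p1 bdd(1)[OF inS[OF x t]] C[OF x] by (intro mult_mono) auto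
      moreover have "\<bar>D (t *\<^sub>R x) / t * t ^ N\<bar> \<le> C / (1/2) * 1"
        unfolding abs_mult abs_divide using p1[of N] t bdd(2)[OF inS[OF x t]] C[OF x]
        by (intro mult_mono frac_le) auto
      moreover have "real N * 1 * C + C / (1/2) * 1 = (real N + 2) * C" by (simp add: distrib_right)
      ultimately show "norm (real N * t ^ (N - 1) * K (t *\<^sub>R x) + D (t *\<^sub>R x) / t * t ^ N) \<le> (real N + 2) * C"
        unfolding real_norm_def
        using abs_triangle_ineq[of "real N * t ^ (N - 1) * K (t *\<^sub>R x)" "D (t *\<^sub>R x) / t * t ^ N"]
        by linarith
    qed (use T in auto)
    then show ?thesis using T(2)[of n] by (simp add: abs_divide pos_divide_le_eq)
  qed
  have "(\<lambda>n. \<integral>x. indicator S x * ((K x - ?g x (T n)) / (1 - T n)) \<partial>lborel)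
    \<longlonglongrightarrow> (\<integral>x. indicator S x * (real N * K x + D x) \<partial>lborel)"
  proof (rule integral_dominated_convergence[OF _ _ Sint[of "(real N + 2) * C"]])
    show "AE x in lborel. (\<lambda>n. indicator S x * ((K x - ?g x (T n)) / (1 - T n))) \<longlonglongrightarrow> indicator S x * (real N * K x + D x)"
      using lim by (intro AE_I2) (auto simp: indicator_def)
    show "AE x in lborel. norm (indicator S x * ((K x - ?g x (T n)) / (1 - T n))) \<le> indicator S x * ((real N + 2) * C)" for n
      using bnd by (intro AE_I2) (auto simp: indicator_def)
  qed measurable
  moreover have "\<forall>\<^sub>F n in sequentially. 0 \<le> (\<integral>x. indicator S x * ((K x - ?g x (T n)) / (1 - T n)) \<partial>lborel)"
  proof -
    have "\<forall>\<^sub>F n in sequentially. \<tau> < T n" using order_tendstoD(1)[OF Tlim nonneg(1)] .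
    then show ?thesis
    proof eventually_elim
      case (elim n)
      define t where "t = T n"
      have t: "\<tau> < t" "t < 1" "0 < t" "t \<in> {1/2..1}" using elim T[of n] by (auto simp: t_def)
      have i0: "integrable lborel (\<lambda>x. indicator S x * f x)" if "f \<in> borel_measurable borel" "\<And>x. x \<in> S \<Longrightarrow> \<bar>f x\<bar> \<le> C" for f
        by (rule integrable_indicator_mult_bounded[OF S]) (use that in auto)
      have i1: "integrable lborel (\<lambda>x. indicator S x * K x)" by (rule i0) (use bdd in auto)
      have i2: "integrable lborel (\<lambda>x. indicator S x * K (t *\<^sub>R x))" by (rule i0) (use bdd inS t in auto)
      have e: "(\<integral>x. indicator S x * K x \<partial>lborel) = t ^ N * (\<integral>x. indicator S (t *\<^sub>R x) * K (t *\<^sub>R x) \<partial>lborel)"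
        using lborel_integral_affine[of "\<lambda>x. indicator S x * K x" t 0] t by (simp add: N_def)
      have i3: "integrable lborel (\<lambda>x. indicator S (t *\<^sub>R x) * K (t *\<^sub>R x))"
      proof -
        have "S' \<in> sets borel" "bounded S'" if "S' = (\<lambda>x. t *\<^sub>R x) -` S" for S'
        proof -
          have "S' = (\<lambda>x. (1 / t) *\<^sub>R x) ` S" using t by (force simp: that image_iff)
          then show "bounded S'" using S(2) by (simp add: bounded_scaling)
          show "S' \<in> sets borel" unfolding that using measurable_sets[of "\<lambda>x. t *\<^sub>R x" borel borel S] by simp
        qed
        then have [measurable]: "(\<lambda>x. t *\<^sub>R x) -` S \<in> sets borel" and b: "bounded ((\<lambda>x. t *\<^sub>R x) -` S)" by blast+
        have "integrable lborel (\<lambda>x. indicator ((\<lambda>x. t *\<^sub>R x) -` S) x * K (t *\<^sub>R x))"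
          by (rule integrable_indicator_mult_bounded[OF _ b, where B = C]) (use bdd(1) in auto)
        then show ?thesis by (simp add: indicator_def)
      qed
      \<comment> \<open>The set \<open>S\<close> is contained in its dilate by \<open>1 / t\<close>,
        and on the difference of the two the multiplier is nonnegative by assumption. This replaces
        the outward flux through the boundary.\<close>
      have "0 \<le> (\<integral>x. (indicator S (t *\<^sub>R x) - indicator S x) * K (t *\<^sub>R x) \<partial>lborel)"
        using star t nonneg(2)[of t] by (intro integral_nonneg_AE AE_I2) (auto simp: indicator_def)
      then have "(\<integral>x. indicator S x * K (t *\<^sub>R x) \<partial>lborel) \<le> (\<integral>x. indicator S (t *\<^sub>R x) * K (t *\<^sub>R x) \<partial>lborel)"
        using i2 i3 by (simp add: left_diff_distrib)
      then have le: "t ^ N * (\<integral>x. indicator S x * K (t *\<^sub>R x) \<partial>lborel) \<le> (\<integral>x. indicator S x * K x \<partial>lborel)"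
        unfolding e using t by (intro mult_left_mono) auto
      have "(\<integral>x. indicator S x * ((K x - ?g x t) / (1 - t)) \<partial>lborel)
        = (\<integral>x. (indicator S x * K x - t ^ N * (indicator S x * K (t *\<^sub>R x))) / (1 - t) \<partial>lborel)"
        by (intro Bochner_Integration.integral_cong) (auto simp: indicator_def)
      also have "\<dots> = ((\<integral>x. indicator S x * K x \<partial>lborel) - t ^ N * (\<integral>x. indicator S x * K (t *\<^sub>R x) \<partial>lborel)) / (1 - t)"
        using i1 i2 by simp
      also have "0 \<le> \<dots>" using le t by simp
      finally show ?case by (simp add: t_def)
    qed
  qed
  ultimately show ?thesis
    unfolding N_def by (rule tendsto_lowerbound) simp
qed

section \<open>The radial vector field and the energy inequality\<close>

context radial_profile
begin

text \<open>Equals \<open>\<bar>\<phi>'\<bar>\<close> on \<open>(0, R)\<close>, and vanishes from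
  \<open>R\<close> on together with \<open>\<phi>\<close>.\<close>

definition "\<psi> \<rho> = (\<rho> * h \<rho>) powr (1 / (p - 1)) * \<phi> \<rho>"

text \<open>For \<open>u(x) = \<phi>(|x|)\<close>, the field \<open>k(|x|) x\<close> is
  \<open>- u |grad u|^(p-2) grad u\<close>.\<close>

definition "k \<rho> = \<phi> \<rho> powr p * h \<rho>"

lemma h_nonneg: "0 \<le> \<rho> \<Longrightarrow> \<rho> < R \<Longrightarrow> 0 \<le> h \<rho>"
proof -
  assume "0 \<le> \<rho>" "\<rho> < R"
  moreover obtain c where "0 < c" "\<And>\<rho>. \<rho> \<in> {0..<R} \<Longrightarrow> c \<le> h \<rho>" using h_pos by blast
  ultimately show "0 \<le> h \<rho>" by (meson atLeastLessThan_iff less_imp_le order_trans)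
qed

lemma \<psi>_nonneg: "0 \<le> \<rho> \<Longrightarrow> 0 \<le> \<psi> \<rho>"
  using \<phi>_pos[of \<rho>] \<phi>_eq_0[of \<rho>] by (cases "\<rho> < R") (auto simp: \<psi>_def)

lemma \<psi>_powr:
  assumes "0 \<le> \<rho>" "\<rho> < R"
  shows "\<psi> \<rho> powr p = (\<rho> * h \<rho>) powr (p / (p - 1)) * \<phi> \<rho> powr p"
  unfolding \<psi>_def by (simp add: powr_mult powr_powr)

text \<open>The divergence of \<open>k(|x|) x\<close> in radial form. Differentiating
  \<open>\<phi>^p\<close> gives \<open>- p\<close> times \<open>\<phi>^p w^q\<close>, the Riccati
  equation gives \<open>p - 1\<close> times it, and what remains is
  \<open>- \<psi>^p\<close>.\<close>

lemma k_deriv: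
  assumes "0 < \<rho>" "\<rho> < R"
  shows "(k has_real_derivative (\<Lambda> * \<phi> \<rho> powr p - \<psi> \<rho> powr p - real N * k \<rho>) / \<rho>) (at \<rho>)"
proof -
  define w where "w = \<rho> * h \<rho>"
  have w: "0 \<le> w" using h_nonneg assms by (simp add: w_def)
  have ph: "0 < \<phi> \<rho>" using \<phi>_pos assms by simp
  have 1: "\<phi> \<rho> powr (p - 1) * \<phi> \<rho> = \<phi> \<rho> powr p" using ph by (simp add: powr_mult_base mult.commute)
  have "w * w powr (1 / (p - 1)) = w powr (1 + 1 / (p - 1))" using w by (rule powr_mult_base)
  also have "1 + 1 / (p - 1) = p / (p - 1)" using p by (simp add: field_simps)
  finally have 2: "h \<rho> * w powr (1 / (p - 1)) = w powr (p / (p - 1)) / \<rho>"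
    using assms(1) by (simp add: w_def field_simps)
  have "(k has_real_derivative (p * \<phi> \<rho> powr (p - of_nat 1) * - (w powr (1 / (p - 1)) * \<phi> \<rho>)) * h \<rho>
      + (\<Lambda> + (p - 1) * w powr (p / (p - 1)) - real N * h \<rho>) / \<rho> * \<phi> \<rho> powr p) (at \<rho>)"
    unfolding k_def[abs_def] w_def
    by (intro DERIV_mult DERIV_fun_powr \<phi>_deriv h_deriv assms ph)
  also have "(p * \<phi> \<rho> powr (p - of_nat 1) * - (w powr (1 / (p - 1)) * \<phi> \<rho>)) * h \<rho>
    = - (p * (\<phi> \<rho> powr (p - 1) * \<phi> \<rho>) * (h \<rho> * w powr (1 / (p - 1))))" by (simp add: mult_ac)
  also have "\<dots> + (\<Lambda> + (p - 1) * w powr (p / (p - 1)) - real N * h \<rho>) / \<rho> * \<phi> \<rho> powr p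
    = (\<Lambda> * \<phi> \<rho> powr p - \<psi> \<rho> powr p - real N * k \<rho>) / \<rho>"
    unfolding 1 2 using \<psi>_powr assms by (simp add: k_def w_def[symmetric] field_simps)
  finally show ?thesis .
qed

text \<open>Regularity of \<open>h\<close> is known only on the open interval, so measurability is
  stated with a cutoff, here and for the functions built from \<open>h\<close>.\<close>

lemma h_borel [measurable]: "(\<lambda>\<rho>. indicator {0<..<R} \<rho> * h \<rho>) \<in> borel_measurable borel"
proof -
  have "continuous_on {0<..<R} h"
    using DERIV_isCont[OF h_deriv] by (intro continuous_at_imp_continuous_on) auto
  from borel_measurable_continuous_on_indicator[OF _ this] show ?thesis by simp
qed

lemma \<phi>_borel [measurable]: "(\<lambda>\<rho>. indicator {0..} \<rho> * \<phi> \<rho>) \<in> borel_measurable borel"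
  using borel_measurable_continuous_on_indicator[OF _ \<phi>_cont] by simp

lemma \<phi>_norm_borel [measurable]: "(\<lambda>x::'b::euclidean_space. \<phi> (norm x)) \<in> borel_measurable borel"
proof -
  have "(\<lambda>x::'b. indicator {0..} (norm x) * \<phi> (norm x)) \<in> borel_measurable borel" by measurable
  then show ?thesis by simp
qed

lemma h_norm_borel: "(\<lambda>x::'b::euclidean_space. indicator (ball 0 R - {0}) x * h (norm x)) \<in> borel_measurable borel"
proof -
  have "(\<lambda>x::'b. indicator {0<..<R} (norm x) * h (norm x)) \<in> borel_measurable borel" by measurable
  also have "(\<lambda>x::'b. indicator {0<..<R} (norm x) * h (norm x)) = (\<lambda>x. indicator (ball 0 R - {0}) x * h (norm x))"
    by (auto simp: indicator_def)
  finally show ?thesis .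
qed

lemma \<psi>_norm_borel: "(\<lambda>x::'b::euclidean_space. indicator (ball 0 R - {0}) x * \<psi> (norm x)) \<in> borel_measurable borel"
proof -
  note [measurable] = h_norm_borel
  have "(\<lambda>x::'b. (norm x * (indicator (ball 0 R - {0}) x * h (norm x))) powr (1 / (p - 1)) * \<phi> (norm x)) \<in> borel_measurable borel"
    by measurable
  also have "(\<lambda>x::'b. (norm x * (indicator (ball 0 R - {0}) x * h (norm x))) powr (1 / (p - 1)) * \<phi> (norm x))
    = (\<lambda>x. indicator (ball 0 R - {0}) x * \<psi> (norm x))"
    by (auto simp: indicator_def \<psi>_def)
  finally show ?thesis .
qed

lemma k_norm_borel: "(\<lambda>x::'b::euclidean_space. indicator (ball 0 R - {0}) x * k (norm x)) \<in> borel_measurable borel"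
proof -
  note [measurable] = h_norm_borel
  have "(\<lambda>x::'b. \<phi> (norm x) powr p * (indicator (ball 0 R - {0}) x * h (norm x))) \<in> borel_measurable borel"
    by measurable
  then show ?thesis by (simp add: k_def mult.left_commute)
qed

lemma \<psi>_bounded: "\<exists>C. \<forall>\<rho>\<ge>0. \<psi> \<rho> \<le> C"
proof -
  obtain C where C: "\<And>\<rho>. \<rho> \<in> {0..<R} \<Longrightarrow> \<psi> \<rho> \<le> C" using bounds unfolding \<psi>_def by blast
  have "\<psi> \<rho> \<le> max C 0" if "0 \<le> \<rho>" for \<rho>
    using C[of \<rho>] that \<phi>_eq_0[of \<rho>] by (cases "\<rho> < R") (auto simp: \<psi>_def)
  then show ?thesis by blast
qed

text \<open>The dilation lemma for the field \<open>k(|x|) x\<close> with \<open>k \<ge> 0\<close>.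
  To quantify strictness, \<open>k\<close> is lowered by a constant \<open>k0\<close> on a sector
  \<open>W\<close>. Since \<open>W\<close> consists of whole ray pieces, the radial derivative does
  not change; the multiplier stays nonnegative, and the divergence drops by \<open>N * k0\<close> on
  \<open>W\<close>.\<close>

lemma energy_le:
  fixes U :: "'a::euclidean_space set"
  assumes N: "N = DIM('a)" and U: "open U" "bounded U"
    and star: "\<And>x t. x \<in> U \<Longrightarrow> 0 < t \<Longrightarrow> t < 1 \<Longrightarrow> t *\<^sub>R x \<in> U"
  defines "S \<equiv> U \<inter> ball 0 R - {0}"
  shows "(\<integral>x. indicator S x * \<psi> (norm x) powr p \<partial>lborel) \<le> \<Lambda> * (\<integral>x. indicator S x * \<phi> (norm x) powr p \<partial>lborel)" (is "?E \<le> \<Lambda> * ?F")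
    and "\<exists>x\<in>U. x \<noteq> 0 \<and> (R / 2 / norm x) *\<^sub>R x \<notin> closure U \<Longrightarrow>
      (\<integral>x. indicator S x * \<psi> (norm x) powr p \<partial>lborel) < \<Lambda> * (\<integral>x. indicator S x * \<phi> (norm x) powr p \<partial>lborel)"
proof -
  let ?A = "ball 0 R - {0} :: 'a set"
  define r where "r x = (R / 2 / norm x) *\<^sub>R x" for x :: 'a
  \<comment> \<open>The rays whose point at distance \<open>R / 2\<close> lies outside
    \<open>U\<close>. As \<open>U\<close> is starshaped, their points in \<open>S\<close> are closer
    to the origin than \<open>R / 2\<close>, where \<open>k\<close> is bounded below by
    \<open>k0\<close>.\<close>
  define W where "W = {x\<in>S. r x \<notin> U}"
  have [measurable]: "U \<in> sets borel" using U(1) by simp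
  have Sb [measurable]: "S \<in> sets borel" unfolding S_def by simp
  have rb [measurable]: "r \<in> borel_measurable borel" unfolding r_def by measurable
  have Wb [measurable]: "W \<in> sets borel"
  proof -
    have "r -` (- U) \<in> sets borel" using measurable_sets[OF rb, of "- U"] U(1) by simp
    moreover have "W = S \<inter> r -` (- U)" by (auto simp: W_def)
    ultimately show ?thesis by simp
  qed
  have Sbd: "bounded S" and Wbd: "bounded W" using U(2) by (auto simp: S_def W_def intro: bounded_subset)
  have sub: "S \<subseteq> ?A" by (auto simp: S_def)
  have starS: "t *\<^sub>R x \<in> S" if "x \<in> S" "0 < t" "t < 1" for x t
  proof -
    have "t * norm x \<le> norm x" using that by (simp add: mult_left_le_one_le)
    also have "norm x < R" using that by (simp add: S_def)
    finally show ?thesis using that star[of x t] by (auto simp: S_def)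
  qed
  obtain c where c: "0 < c" "\<And>\<rho>. 0 \<le> \<rho> \<Longrightarrow> \<rho> < R \<Longrightarrow> c \<le> h \<rho>" using h_pos by auto
  define k0 where "k0 = \<phi> (R / 2) powr p * c"
  have k0: "0 < k0" unfolding k0_def using c \<phi>_pos[of "R / 2"] R by auto
  have rscale: "r (t *\<^sub>R x) = r x" if "0 < t" for x t
    using that by (simp add: r_def)
  have WS: "t *\<^sub>R x \<in> W \<longleftrightarrow> x \<in> W" if "x \<in> S" "t \<in> {1/2..1}" for x t
    using starS[OF that(1), of t] that rscale[of t x] by (cases "t = 1") (auto simp: W_def)
  have kW: "k0 \<le> k (norm x)" if "x \<in> W" for x
  proof -
    have "norm x < R / 2"
    proof (rule ccontr)
      assume a: "\<not> norm x < R / 2"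
      then have "R / 2 / norm x \<le> 1" "0 < R / 2 / norm x" using R by (auto simp: divide_simps)
      then have "r x \<in> U" using that star[of x "R / 2 / norm x"]
        by (cases "R / 2 / norm x = 1") (auto simp: W_def S_def r_def)
      then show False using that by (simp add: W_def)
    qed
    then show ?thesis unfolding k_def k0_def
      using c \<phi>_antimono[of "norm x" "R / 2"] \<phi>_pos[of "R / 2"] p R by (intro mult_mono powr_mono2) auto
  qed
  have kpos: "0 \<le> k (norm x)" if "norm x < R" for x :: 'a
    unfolding k_def using h_nonneg[of "norm x"] that by simp
  obtain C where C: "\<And>\<rho>. \<rho> \<in> {0..<R} \<Longrightarrow> \<psi> \<rho> \<le> C \<and> k \<rho> \<le> C" using bounds unfolding \<psi>_def k_def by blast
  have C0: "0 \<le> C" using C[of 0] \<psi>_nonneg[of 0] R by auto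
  define D0 where "D0 \<rho> = \<Lambda> * \<phi> \<rho> powr p - \<psi> \<rho> powr p - real N * k \<rho>" for \<rho>
  define K where "K x = indicator ?A x * k (norm x) - k0 * indicator W x" for x :: 'a
  define D where "D x = indicator ?A x * D0 (norm x)" for x :: 'a
  have indA: "indicator ?A x = (1::real)" if "x \<in> S" for x
    using that sub by (auto simp: indicator_def)
  have KS: "K x = k (norm x) - (if x \<in> W then k0 else 0)" if "x \<in> S" for x
    unfolding K_def indA[OF that] by simp
  have DS: "D x = D0 (norm x)" if "x \<in> S" for x
    unfolding D_def indA[OF that] by simp
  define B where "B = \<Lambda> + C powr p + real N * C + C + k0"
  have phi1: "\<phi> \<rho> powr p \<le> 1" "0 \<le> \<phi> \<rho> powr p" if "0 \<le> \<rho>" "\<rho> < R" for \<rho>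
    using that \<phi>_pos[of \<rho>] \<phi>_le_1[of \<rho>] p by (auto intro: powr_le1)
  have psi1: "\<psi> \<rho> powr p \<le> C powr p" if "0 \<le> \<rho>" "\<rho> < R" for \<rho>
    using that C[of \<rho>] \<psi>_nonneg[of \<rho>] p by (intro powr_mono2) auto
  note intS = integrable_indicator_mult_bounded[OF Sb Sbd]
  have psi_m: "(\<lambda>x::'a. indicator S x * \<psi> (norm x) powr p) \<in> borel_measurable borel"
  proof -
    note [measurable] = \<psi>_norm_borel
    have "(\<lambda>x::'a. indicator S x * (indicator ?A x * \<psi> (norm x)) powr p) \<in> borel_measurable borel" by measurable
    also have "(\<lambda>x::'a. indicator S x * (indicator ?A x * \<psi> (norm x)) powr p) = (\<lambda>x. indicator S x * \<psi> (norm x) powr p)"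
      by (auto simp: indicator_def S_def fun_eq_iff)
    finally show ?thesis .
  qed
  have i\<psi>: "integrable lborel (\<lambda>x. indicator S x * \<psi> (norm x) powr p)"
    by (rule intS[OF psi_m, of "C powr p"]) (use psi1 in \<open>auto simp: S_def\<close>)
  have i\<phi>: "integrable lborel (\<lambda>x. indicator S x * \<phi> (norm x) powr p)"
  proof (rule intS[where B = 1])
    show "(\<lambda>x. indicator S x * \<phi> (norm x) powr p) \<in> borel_measurable borel" by measurable
  qed (use phi1 in \<open>auto simp: S_def\<close>)
  have "0 \<le> (\<integral>x. indicator S x * (real DIM('a) * K x + D x) \<partial>lborel)"
  proof (rule dilation_divergence_nonneg[OF Sb Sbd starS, where C = B and \<tau> = 0])
    define G1 where "G1 x = indicator ?A x * \<psi> (norm x)" for x :: 'a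
    define G2 where "G2 x = indicator ?A x * k (norm x)" for x :: 'a
    have [measurable]: "?A \<in> sets borel" by (intro sets.Diff) auto
    have [measurable]: "G1 \<in> borel_measurable borel" "G2 \<in> borel_measurable borel"
      using \<psi>_norm_borel k_norm_borel unfolding G1_def[abs_def] G2_def[abs_def] by blast+
    have "(\<lambda>x. G2 x - k0 * indicator W x) \<in> borel_measurable borel" by measurable
    then show "K \<in> borel_measurable borel" unfolding K_def[abs_def] G2_def .
    have "(\<lambda>x::'a. indicator ?A x * (\<Lambda> * \<phi> (norm x) powr p - G1 x powr p - real N * G2 x)) \<in> borel_measurable borel"
      by measurable
    also have "(\<lambda>x::'a. indicator ?A x * (\<Lambda> * \<phi> (norm x) powr p - G1 x powr p - real N * G2 x)) = D"
      by (auto simp: D_def D0_def G1_def G2_def indicator_def fun_eq_iff)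
    finally show "D \<in> borel_measurable borel" .
    show "\<bar>K x\<bar> \<le> B" if "x \<in> S" for x
    proof -
      have n: "0 \<le> norm x" "norm x < R" using that by (auto simp: S_def)
      have "0 \<le> k (norm x)" "k (norm x) \<le> C" using kpos[OF n(2)] C[of "norm x"] n by auto
      moreover have "C + k0 \<le> B" using \<Lambda> C0 by (simp add: B_def)
      ultimately show ?thesis using k0 unfolding KS[OF that] by (cases "x \<in> W") (simp_all add: abs_le_iff)
    qed
    show "\<bar>D x\<bar> \<le> B" if x: "x \<in> S" for x
    proof -
      have n: "0 \<le> norm x" "norm x < R" using x by (auto simp: S_def)
      have "0 \<le> \<Lambda> * \<phi> (norm x) powr p" "\<Lambda> * \<phi> (norm x) powr p \<le> \<Lambda> * 1"
        using phi1[OF n] \<Lambda> by (auto intro: mult_left_mono)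
      moreover have "0 \<le> \<psi> (norm x) powr p" by simp
      moreover have "0 \<le> real N * k (norm x)" "real N * k (norm x) \<le> real N * C"
        using kpos[OF n(2)] C[of "norm x"] n by (auto intro!: mult_left_mono)
      ultimately show ?thesis using psi1[OF n] k0 C0 unfolding DS[OF x] D0_def B_def abs_le_iff by (intro conjI) linarith+
    qed
    show "0 \<le> K (t *\<^sub>R x)" if "t *\<^sub>R x \<in> S" for x t
    proof -
      have "norm (t *\<^sub>R x) < R" using that by (auto simp: S_def)
      then show ?thesis using kpos[of "t *\<^sub>R x"] kW[of "t *\<^sub>R x"] unfolding KS[OF that] by (simp split: if_splits)
    qed
    show "((\<lambda>s. K (s *\<^sub>R x)) has_real_derivative D (t *\<^sub>R x) / t) (at t within {1/2..1})"
      if x: "x \<in> S" and t: "t \<in> {1/2..1}" for x t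
    proof -
      have inS: "s *\<^sub>R x \<in> S" if "s \<in> {1/2..1}" for s
        using starS[OF x, of s] that x by (cases "s = 1") auto
      have tn: "0 < t * norm x" "t * norm x < R"
        using inS[OF t] t by (auto simp: S_def zero_less_mult_iff)
      have "((\<lambda>s. k (s * norm x) - k0 * indicator W x) has_real_derivative
          D0 (t * norm x) / (t * norm x) * norm x - 0) (at t within {1/2..1})"
      proof (intro DERIV_diff DERIV_const)
        have d1: "((\<lambda>s. s * norm x) has_real_derivative norm x) (at t within {1/2..1})"
          by (auto intro!: derivative_eq_intros)
        show "((\<lambda>s. k (s * norm x)) has_real_derivative D0 (t * norm x) / (t * norm x) * norm x) (at t within {1/2..1})"
          by (rule DERIV_chain2[where f = k and g = "\<lambda>s. s * norm x", OF _ d1]) (rule k_deriv[OF tn, folded D0_def])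
      qed
      also have "D0 (t * norm x) / (t * norm x) * norm x - 0 = D (t *\<^sub>R x) / t"
        using t tn x unfolding DS[OF inS[OF t]] by (simp add: S_def)
      finally show ?thesis
      proof (rule has_field_derivative_transform_within[OF _ zero_less_one t])
        fix s :: real assume s: "s \<in> {1/2..1}"
        then show "k (s * norm x) - k0 * indicator W x = K (s *\<^sub>R x)"
          unfolding KS[OF inS[OF s]] WS[OF x s] by (simp add: indicator_def)
      qed
    qed
  qed (auto simp: S_def)
  also have "(\<lambda>x. indicator S x * (real DIM('a) * K x + D x)) =
    (\<lambda>x. \<Lambda> * (indicator S x * \<phi> (norm x) powr p) - indicator S x * \<psi> (norm x) powr p - real N * k0 * indicator W x)"
  proof
    fix x
    show "indicator S x * (real DIM('a) * K x + D x) =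
      \<Lambda> * (indicator S x * \<phi> (norm x) powr p) - indicator S x * \<psi> (norm x) powr p - real N * k0 * indicator W x"
    proof (cases "x \<in> S")
      case True
      then show ?thesis unfolding KS[OF True] DS[OF True] D0_def N by (simp add: indicator_def algebra_simps)
    qed (simp add: W_def)
  qed
  also have "(\<integral>x. \<Lambda> * (indicator S x * \<phi> (norm x) powr p) - indicator S x * \<psi> (norm x) powr p - real N * k0 * indicator W x \<partial>lborel)
    = \<Lambda> * ?F - ?E - real N * k0 * measure lborel W"
    using i\<phi> i\<psi> emeasure_bounded_finite[OF Wbd] by simp
  finally have main: "?E + real N * k0 * measure lborel W
    \<le> \<Lambda> * ?F" by simp
  have "0 \<le> real N * k0 * measure lborel W" using k0 by simp
  with main show "?E \<le> \<Lambda> * ?F" by linarith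
  assume "\<exists>x\<in>U. x \<noteq> 0 \<and> (R / 2 / norm x) *\<^sub>R x \<notin> closure U"
  then obtain x where x: "x \<in> U" "x \<noteq> 0" "r x \<notin> closure U" unfolding r_def by blast
  have "0 < measure lborel W"
  proof -
    \<comment> \<open>An open part of \<open>W\<close>, obtained by asking that the point at
      distance \<open>R / 2\<close> avoid even the closure of \<open>U\<close>.\<close>
    define V where "V = (U - {0}) \<inter> r -` (- closure U)"
    have "continuous_on (U - {0}) r" unfolding r_def by (intro continuous_intros) auto
    then have Vo: "open V" unfolding V_def using U(1)
      by (intro continuous_open_preimage) auto
    have "x \<in> V" using x by (simp add: V_def)
    have "V \<subseteq> W"
    proof
      fix y assume y: "y \<in> V"
      then have y': "y \<in> U" "y \<noteq> 0" "r y \<notin> U" using closure_subset[of U] by (auto simp: V_def)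
      have "norm y < R"
      proof (rule ccontr)
        assume "\<not> norm y < R"
        then have "R / 2 / norm y < 1" "0 < R / 2 / norm y" using R by (auto simp: divide_simps)
        then show False using star[OF y'(1)] y'(3) by (simp add: r_def)
      qed
      then show "y \<in> W" using y' by (simp add: W_def S_def)
    qed
    moreover have "0 < measure lebesgue V"
      using Vo \<open>x \<in> V\<close> U(2) by (intro open_measure_pos) (auto simp: V_def intro: bounded_subset)
    moreover have "W \<in> lmeasurable" using Wbd by (intro bounded_set_imp_lmeasurable) auto
    moreover have "V \<in> lmeasurable" using Vo U(2) by (intro lmeasurable_open) (auto simp: V_def intro: bounded_subset)
    ultimately have "0 < measure lebesgue W"
      using measure_mono_fmeasurable[of V W lebesgue] by (auto simp: fmeasurableD)
    then show ?thesis by simp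
  qed
  moreover have "0 < real N" by (simp add: N)
  ultimately have "0 < real N * k0 * measure lborel W" using k0 by simp
  with main show "?E < \<Lambda> * ?F" by linarith
qed

end

section \<open>The Dirichlet eigenvalue of a ball\<close>

text \<open>At 0 the difference quotient has absolute value
  \<open>\<bar>h\<bar> powr (p - 1)\<close>, so the derivative exists also where a function changes
  sign.\<close>

lemma abs_powr_has_real_derivative:
  fixes y p :: real
  assumes "1 < p"
  shows "((\<lambda>y. \<bar>y\<bar> powr p) has_real_derivative p * \<bar>y\<bar> powr (p - 1) * sgn y) (at y)"
proof (cases y "0::real" rule: linorder_cases)
  case greater
  have "((\<lambda>y. \<bar>y\<bar> powr p) has_real_derivative p * y powr (p - 1)) (at y)"
    by (rule has_field_derivative_transform_within_open[OF has_real_derivative_powr[OF greater], where S = "{0<..}"])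
       (use greater in auto)
  then show ?thesis using greater by simp
next
  case less
  have "((\<lambda>y. (- y) powr p) has_real_derivative p * (- y) powr (p - 1) * - 1) (at y)"
    using DERIV_fun_powr[of "\<lambda>y. - y" "- 1" y p] less by (auto intro!: derivative_eq_intros)
  then have "((\<lambda>y. \<bar>y\<bar> powr p) has_real_derivative p * (- y) powr (p - 1) * - 1) (at y)"
    by (rule has_field_derivative_transform_within_open[where S = "{..<0}"]) (use less in auto)
  then show ?thesis using less by simp
next
  case equal
  have "((\<lambda>h::real. \<bar>h\<bar> powr (p - 1)) \<longlongrightarrow> 0) (at 0)"
    using assms by (intro tendsto_zero_powrI) (auto intro!: tendsto_eq_intros)
  moreover have "norm ((\<bar>h\<bar> powr p) / h) = \<bar>h\<bar> powr (p - 1)" if "h \<noteq> 0" for h :: real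
    using that by (simp add: powr_diff)
  ultimately have "((\<lambda>h::real. norm ((\<bar>h\<bar> powr p) / h)) \<longlongrightarrow> 0) (at 0)"
    by (rule_tac Lim_transform_eventually) (auto simp: eventually_at_filter)
  then have "((\<lambda>h::real. (\<bar>h\<bar> powr p) / h) \<longlongrightarrow> 0) (at 0)"
    by (rule tendsto_norm_zero_cancel)
  then show ?thesis unfolding equal using assms by (simp add: has_field_derivative_iff)
qed

text \<open>Convexity of the power with weights \<open>1 - s\<close> and \<open>s\<close>. For fixed
  \<open>s\<close> the last term vanishes as \<open>a\<close> approaches \<open>b\<close>, and the
  other factor tends to 1 as \<open>s\<close> tends to 0; limits are taken in this order.\<close>

lemma norm_powr_split:
  fixes a b :: "'b::real_normed_vector"
  assumes "1 \<le> p" "0 < s" "s < 1"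
  shows "norm a powr p \<le> (1 - s) powr (1 - p) * norm b powr p + s powr (1 - p) * norm (a - b) powr p"
proof -
  have conv: "((1 - s) * A + s * B) powr p \<le> (1 - s) * A powr p + s * B powr p" if "0 \<le> A" "0 \<le> B" for A B :: real
  proof (cases "A = 0 \<or> B = 0")
    case True
    have "(r * C) powr p \<le> r * C powr p" if "0 < r" "r < 1" for r C :: real
      using that assms powr_mono'[of 1 p r] by (simp add: powr_mult mult_right_mono)
    then show ?thesis using True assms by auto
  next
    case False
    then show ?thesis using convex_onD[OF powr_convex[OF assms(1)], of s A B] that assms by simp
  qed
  have "norm a \<le> norm b + norm (a - b)" using norm_triangle_ineq[of b "a - b"] by simp
  also have "\<dots> = (1 - s) * (norm b / (1 - s)) + s * (norm (a - b) / s)" using assms by simp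
  finally have "norm a powr p \<le> ((1 - s) * (norm b / (1 - s)) + s * (norm (a - b) / s)) powr p"
    using assms by (intro powr_mono2) auto
  also have "\<dots> \<le> (1 - s) * (norm b / (1 - s)) powr p + s * (norm (a - b) / s) powr p"
    using assms by (intro conv) auto
  also have "\<dots> = (1 - s) powr (1 - p) * norm b powr p + s powr (1 - p) * norm (a - b) powr p"
    using assms by (simp add: powr_divide powr_diff)
  finally show ?thesis .
qed

text \<open>The definitions integrate over \<open>lebesgue_on\<close>, whereas scaling and
  translation are carried out in \<open>lborel\<close>; for Borel integrands the two agree.\<close>

lemma lebesgue_on_integral_borel:
  fixes f :: "'a::euclidean_space \<Rightarrow> 'b::euclidean_space"
  assumes "S \<in> sets borel" "(\<lambda>x. indicator S x *\<^sub>R f x) \<in> borel_measurable borel"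
  shows "(\<integral>x. f x \<partial>lebesgue_on S) = (\<integral>x. indicator S x *\<^sub>R f x \<partial>lborel)"
    and "integrable (lebesgue_on S) f \<longleftrightarrow> integrable lborel (\<lambda>x. indicator S x *\<^sub>R f x)"
  using assms integral_restrict_space[of S lebesgue f] integrable_restrict_space[of S lebesgue f]
    integral_completion[of "\<lambda>x. indicator S x *\<^sub>R f x" lborel] integrable_completion[of "\<lambda>x. indicator S x *\<^sub>R f x" lborel]
  by auto

section \<open>Test functions and their gradients\<close>

lemma continuous_on_borel: "continuous_on UNIV f \<Longrightarrow> f \<in> borel_measurable borel"
  by (rule borel_measurable_continuous_onI)

lemma test_function_has_derivative:
  fixes \<phi> :: "'a::euclidean_space \<Rightarrow> real"
  assumes "\<phi> \<in> test_functions \<Omega>"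
  shows "(\<phi> has_derivative (\<lambda>y. grad \<phi> x \<bullet> y)) (at x)" "continuous_on UNIV (grad \<phi>)"
proof -
  have C1: "C_k (Suc 0) \<phi>" using assms unfolding test_functions_def by blast
  have "\<phi> differentiable (at x)" using C1 by simp
  then have d: "(\<phi> has_derivative frechet_derivative \<phi> (at x)) (at x)" by (simp add: frechet_derivative_works)
  then interpret bounded_linear "frechet_derivative \<phi> (at x)" by (rule has_derivative_bounded_linear)
  have "frechet_derivative \<phi> (at x) y = grad \<phi> x \<bullet> y" for y
  proof -
    have "frechet_derivative \<phi> (at x) y = frechet_derivative \<phi> (at x) (\<Sum>b\<in>Basis. (y \<bullet> b) *\<^sub>R b)"
      by (simp add: euclidean_representation)
    also have "\<dots> = (\<Sum>b\<in>Basis. (y \<bullet> b) * frechet_derivative \<phi> (at x) b)" by (simp add: sum scaleR)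
    also have "\<dots> = grad \<phi> x \<bullet> y" unfolding grad_def inner_sum_left
      by (intro sum.cong) (auto simp: inner_commute)
    finally show ?thesis .
  qed
  then have "frechet_derivative \<phi> (at x) = (\<lambda>y. grad \<phi> x \<bullet> y)" by blast
  with d show "(\<phi> has_derivative (\<lambda>y. grad \<phi> x \<bullet> y)) (at x)" by simp
  have "continuous_on UNIV (\<lambda>x. frechet_derivative \<phi> (at x) b)" if "b \<in> Basis" for b
    using C1 that by simp
  then show "continuous_on UNIV (grad \<phi>)" unfolding grad_def[abs_def]
    by (intro continuous_on_sum continuous_on_scaleR continuous_on_const) auto
qed

lemma test_function_continuous:
  "\<phi> \<in> test_functions \<Omega> \<Longrightarrow> continuous_on UNIV (\<phi> :: 'a::euclidean_space \<Rightarrow> real)"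
  by (intro continuous_at_imp_continuous_on ballI has_derivative_continuous[OF test_function_has_derivative(1)])

lemma test_function_support:
  fixes \<phi> :: "'a::euclidean_space \<Rightarrow> real"
  assumes "\<phi> \<in> test_functions \<Omega>"
  obtains K where "compact K" "K \<subseteq> \<Omega>" "\<And>x. x \<notin> K \<Longrightarrow> \<phi> x = 0" "\<And>x. x \<notin> K \<Longrightarrow> grad \<phi> x = 0"
proof -
  obtain K where K: "K = closure {x. \<phi> x \<noteq> 0}" by blast
  have c: "compact K" "K \<subseteq> \<Omega>" using assms by (auto simp: test_functions_def K)
  have z: "\<phi> x = 0" if "x \<notin> K" for x
    using that closure_subset[of "{x. \<phi> x \<noteq> 0}"] unfolding K by blast
  have "grad \<phi> x = 0" if x: "x \<notin> K" for x
  proof -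
    have "((\<lambda>_. 0::real) has_derivative (\<lambda>_. 0)) (at x)" by simp
    then have "(\<phi> has_derivative (\<lambda>_. 0)) (at x)"
      by (rule has_derivative_transform_within_open[where s = "- K"])
         (use x z compact_imp_closed[OF c(1)] in auto)
    then have "(\<lambda>y. grad \<phi> x \<bullet> y) = (\<lambda>_. 0)"
      using test_function_has_derivative(1)[OF assms] has_derivative_unique by blast
    then have "grad \<phi> x \<bullet> grad \<phi> x = 0" by metis
    then show ?thesis by simp
  qed
  with c z show ?thesis using that by blast
qed

lemma test_function_bounded:
  fixes \<phi> :: "'a::euclidean_space \<Rightarrow> real"
  assumes "\<phi> \<in> test_functions \<Omega>"
  obtains B where "0 \<le> B" "\<And>x. \<bar>\<phi> x\<bar> \<le> B" "\<And>x. norm (grad \<phi> x) \<le> B"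
proof -
  obtain K where K: "compact K" "\<And>x. x \<notin> K \<Longrightarrow> \<phi> x = 0" "\<And>x. x \<notin> K \<Longrightarrow> grad \<phi> x = 0"
    using test_function_support[OF assms] by metis
  have "compact (\<phi> ` K)" "compact (grad \<phi> ` K)"
    using K(1) test_function_continuous[OF assms] test_function_has_derivative(2)[OF assms]
    by (auto intro!: compact_continuous_image intro: continuous_on_subset)
  then have "bounded (\<phi> ` K)" "bounded (grad \<phi> ` K)" by (auto intro: compact_imp_bounded)
  then obtain B1 B2 where "\<forall>y\<in>\<phi> ` K. norm y \<le> B1" "\<forall>y\<in>grad \<phi> ` K. norm y \<le> B2"
    unfolding bounded_iff by blast
  then have B: "\<bar>\<phi> x\<bar> \<le> B1" "norm (grad \<phi> x) \<le> B2" if "x \<in> K" for x using that by auto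
  show ?thesis
  proof (rule that[of "max 0 (max B1 B2)"])
    show "\<bar>\<phi> x\<bar> \<le> max 0 (max B1 B2)" for x using B(1)[of x] K(2)[of x] by (cases "x \<in> K") auto
    show "norm (grad \<phi> x) \<le> max 0 (max B1 B2)" for x using B(2)[of x] K(3)[of x] by (cases "x \<in> K") auto
  qed auto
qed

section \<open>Lower bound for the Rayleigh quotient on a ball\<close>

context radial_profile
begin

text \<open>Picone's argument with the vector field \<open>F(x) = h(\<bar>x\<bar>) x\<close>, which satisfies
  \<open>div F = \<Lambda> + (p - 1) \<bar>F\<bar>\<^sup>q\<close> for \<open>q = p/(p-1)\<close>: integrate \<open>div (\<bar>u\<bar>\<^sup>p F)\<close> and apply Young's inequality.\<close>

lemma poincare_centered:
  fixes u :: "'a::euclidean_space \<Rightarrow> real"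
  assumes N: "N = DIM('a)"
    and du: "\<And>x. (u has_derivative (\<lambda>y. g x \<bullet> y)) (at x)" and g: "continuous_on UNIV g"
    and supp: "r < R" "0 < r" "\<And>x. r \<le> norm x \<Longrightarrow> u x = 0" "\<And>x. r \<le> norm x \<Longrightarrow> g x = 0"
    and bdd: "\<And>x. \<bar>u x\<bar> \<le> B" "\<And>x. norm (g x) \<le> B"
  shows "\<Lambda> * (\<integral>x. \<bar>u x\<bar> powr p \<partial>lborel) \<le> (\<integral>x. norm (g x) powr p \<partial>lborel)"
proof -
  define S where "S = ball 0 R - {0::'a}"
  have [measurable]: "S \<in> sets borel" unfolding S_def by (intro sets.Diff) auto
  have Sbd: "bounded S" unfolding S_def by (auto intro: bounded_subset[OF bounded_ball])
  have ucont: "continuous_on UNIV u"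
    by (intro continuous_at_imp_continuous_on ballI has_derivative_continuous[OF du])
  have [measurable]: "u \<in> borel_measurable borel" "g \<in> borel_measurable borel"
    using ucont g by (auto intro: continuous_on_borel)
  have B: "0 \<le> B" using bdd(1)[of 0] by linarith
  define w where "w \<rho> = \<rho> * h \<rho>" for \<rho>
  define D1 where "D1 \<rho> = \<Lambda> + (p - 1) * w \<rho> powr (p / (p - 1)) - real N * h \<rho>" for \<rho>
  define G where "G x = indicator S x * h (norm x)" for x :: 'a
  have [measurable]: "G \<in> borel_measurable borel" using h_norm_borel unfolding G_def[abs_def] S_def by blast
  \<comment> \<open>On \<open>S\<close>, \<open>K(x) x\<close> is the field \<open>|u|^p F\<close>,
    and \<open>D\<close> is the derivative of \<open>K\<close> under dilation, so that
    \<open>N K + D\<close> is the divergence of the field.\<close>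
  define K where "K x = \<bar>u x\<bar> powr p * G x" for x
  define D where "D x = p * \<bar>u x\<bar> powr (p - 1) * sgn (u x) * (g x \<bullet> x) * G x + \<bar>u x\<bar> powr p *
    (\<Lambda> + (p - 1) * (norm x * G x) powr (p / (p - 1)) - real N * G x)" for x
  have GS: "G x = h (norm x)" if "x \<in> S" for x using that by (simp add: G_def)
  have hb: "0 \<le> h (norm x)" "norm x \<le> r \<Longrightarrow> h (norm x) \<le> h r" if "x \<in> S" for x
    using that h_nonneg h_mono[of "norm x" r] supp by (auto simp: S_def)
  have hr: "0 \<le> h r" using h_nonneg[of r] supp by simp
  have starS: "t *\<^sub>R x \<in> S" if "x \<in> S" "0 < t" "t < 1" for x t
  proof -
    have "t * norm x \<le> norm x" using that by (simp add: mult_left_le_one_le)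
    also have "norm x < R" using that by (simp add: S_def)
    finally show ?thesis using that by (auto simp: S_def)
  qed
  define M where "M = B powr p * h r"
  define M2 where "M2 = p * B powr (p - 1) * (B * r) * h r + B powr p * (\<Lambda> + (p - 1) * (r * h r) powr (p / (p - 1)) + real N * h r)"
  have Kz: "K x = 0" "D x = 0" if "r \<le> norm x" for x using supp(3)[OF that] by (auto simp: K_def D_def)
  have Kb: "0 \<le> K x" "\<bar>K x\<bar> \<le> M" if x: "x \<in> S" for x
  proof -
    show "0 \<le> K x" using hb[OF x] by (simp add: K_def GS[OF x])
    moreover have "K x \<le> M"
    proof (cases "r \<le> norm x")
      case True
      then show ?thesis using Kz(1) hr by (simp add: M_def)
    next
      case False
      then show ?thesis unfolding K_def GS[OF x] M_def
        using hb[OF x] B p bdd(1)[of x] by (intro mult_mono powr_mono2) auto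
    qed
    ultimately show "\<bar>K x\<bar> \<le> M" by simp
  qed
  have Db: "\<bar>D x\<bar> \<le> M2" if x: "x \<in> S" for x
  proof (cases "r \<le> norm x")
    case True
    have "0 \<le> M2" unfolding M2_def using p B supp hr \<Lambda>
      by (intro add_nonneg_nonneg mult_nonneg_nonneg) auto
    then show ?thesis using Kz(2)[OF True] by simp
  next
    case False
    have nx: "norm x \<le> r" using False by simp
    note hb' = hb(1)[OF x] hb(2)[OF x nx]
    have gx: "\<bar>g x \<bullet> x\<bar> \<le> B * r"
      using Cauchy_Schwarz_ineq2[of "g x" x] mult_mono[OF bdd(2)[of x] nx] B by simp
    have sg: "\<bar>sgn (u x)\<bar> \<le> 1" by (simp add: sgn_if)
    have up: "\<bar>\<bar>u x\<bar> powr (p - 1)\<bar> \<le> B powr (p - 1)" "\<bar>\<bar>u x\<bar> powr p\<bar> \<le> B powr p"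
      using powr_mono2[OF _ _ bdd(1)[of x], of "p - 1"] powr_mono2[OF _ _ bdd(1)[of x], of p] p by auto
    have a: "\<bar>p * \<bar>u x\<bar> powr (p - 1) * sgn (u x) * (g x \<bullet> x) * h (norm x)\<bar> \<le> p * B powr (p - 1) * 1 * (B * r) * h r"
      unfolding abs_mult using p B supp hb' hr
      by (intro mult_mono up gx sg mult_nonneg_nonneg) auto
    have b: "(norm x * h (norm x)) powr (p / (p - 1)) \<le> (r * h r) powr (p / (p - 1))"
      using p nx hb' hr supp by (intro powr_mono2 mult_mono mult_nonneg_nonneg) auto
    have "\<bar>\<Lambda> + (p - 1) * (norm x * h (norm x)) powr (p / (p - 1)) - real N * h (norm x)\<bar>
      \<le> \<Lambda> + (p - 1) * (r * h r) powr (p / (p - 1)) + real N * h r"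
    proof -
      have "(p - 1) * (norm x * h (norm x)) powr (p / (p - 1)) \<le> (p - 1) * (r * h r) powr (p / (p - 1))"
        "real N * h (norm x) \<le> real N * h r" "0 \<le> real N * h (norm x)"
        "0 \<le> (p - 1) * (norm x * h (norm x)) powr (p / (p - 1))"
        using b hb' p by (auto intro!: mult_left_mono)
      then show ?thesis using \<Lambda> unfolding abs_le_iff by (intro conjI) linarith+
    qed
    then have c: "\<bar>\<bar>u x\<bar> powr p * (\<Lambda> + (p - 1) * (norm x * h (norm x)) powr (p / (p - 1)) - real N * h (norm x))\<bar>
      \<le> B powr p * (\<Lambda> + (p - 1) * (r * h r) powr (p / (p - 1)) + real N * h r)"
      unfolding abs_mult by (intro mult_mono up) auto
    show ?thesis unfolding D_def GS[OF x] M2_def using order_trans[OF abs_triangle_ineq add_mono[OF a c]] by simp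
  qed
  have deriv: "((\<lambda>s. K (s *\<^sub>R x)) has_real_derivative D (t *\<^sub>R x) / t) (at t within {1/2..1})"
    if x: "x \<in> S" and t: "t \<in> {1/2..1}" for x t
  proof -
    have inS: "s *\<^sub>R x \<in> S" if "s \<in> {1/2..1}" for s
      using starS[OF x, of s] that x by (cases "s = 1") auto
    have tn: "0 < t * norm x" "t * norm x < R"
      using inS[OF t] t by (auto simp: S_def zero_less_mult_iff)
    let ?I = "{1/2..1::real}"
    have "((\<lambda>s. u (s *\<^sub>R x)) has_derivative (\<lambda>y. g (t *\<^sub>R x) \<bullet> (y *\<^sub>R x))) (at t within ?I)"
      by (rule has_derivative_compose[OF _ du]) (auto intro!: derivative_eq_intros)
    moreover have "(\<lambda>y. g (t *\<^sub>R x) \<bullet> (y *\<^sub>R x)) = (*) (g (t *\<^sub>R x) \<bullet> x)"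
      by (auto simp: fun_eq_iff)
    ultimately have d1: "((\<lambda>s. u (s *\<^sub>R x)) has_real_derivative g (t *\<^sub>R x) \<bullet> x) (at t within ?I)"
      unfolding has_field_derivative_def by simp
    have d2: "((\<lambda>s. \<bar>u (s *\<^sub>R x)\<bar> powr p) has_real_derivative
        (p * \<bar>u (t *\<^sub>R x)\<bar> powr (p - 1) * sgn (u (t *\<^sub>R x))) * (g (t *\<^sub>R x) \<bullet> x)) (at t within ?I)"
      by (rule DERIV_chain2[where f = "\<lambda>y. \<bar>y\<bar> powr p" and g = "\<lambda>s. u (s *\<^sub>R x)", OF abs_powr_has_real_derivative[OF p] d1])
    have d0: "((\<lambda>s. s * norm x) has_real_derivative norm x) (at t within ?I)"
      by (auto intro!: derivative_eq_intros)
    have d3: "((\<lambda>s. h (s * norm x)) has_real_derivative D1 (t * norm x) / (t * norm x) * norm x) (at t within ?I)"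
      by (rule DERIV_chain2[where f = h and g = "\<lambda>s. s * norm x", OF _ d0])
         (rule h_deriv[OF tn, folded w_def, folded D1_def])
    have "((\<lambda>s. \<bar>u (s *\<^sub>R x)\<bar> powr p * h (s * norm x)) has_real_derivative
        ((p * \<bar>u (t *\<^sub>R x)\<bar> powr (p - 1) * sgn (u (t *\<^sub>R x))) * (g (t *\<^sub>R x) \<bullet> x)) * h (t * norm x)
        + D1 (t * norm x) / (t * norm x) * norm x * \<bar>u (t *\<^sub>R x)\<bar> powr p) (at t within ?I)"
      by (rule DERIV_mult[OF d2 d3])
    also have "((p * \<bar>u (t *\<^sub>R x)\<bar> powr (p - 1) * sgn (u (t *\<^sub>R x))) * (g (t *\<^sub>R x) \<bullet> x)) * h (t * norm x)
        + D1 (t * norm x) / (t * norm x) * norm x * \<bar>u (t *\<^sub>R x)\<bar> powr p = D (t *\<^sub>R x) / t"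
      using t tn x unfolding D_def D1_def w_def GS[OF inS[OF t]] by (simp add: S_def field_simps)
    finally show ?thesis
    proof (rule has_field_derivative_transform_within[OF _ zero_less_one t])
      fix s :: real assume s: "s \<in> ?I"
      then show "\<bar>u (s *\<^sub>R x)\<bar> powr p * h (s * norm x) = K (s *\<^sub>R x)"
        unfolding K_def GS[OF inS[OF s]] by simp
    qed
  qed
  have Km [measurable]: "K \<in> borel_measurable borel" unfolding K_def[abs_def] by measurable
  have Dm [measurable]: "D \<in> borel_measurable borel" unfolding D_def[abs_def] by measurable
  \<comment> \<open>A point outside the ball, dilated by a factor of at least \<open>r / R\<close>,
    still has norm at least \<open>r\<close>, where \<open>u\<close> vanishes. So there is no
    boundary term, and the dilation lemma may be applied to \<open>- K\<close>.\<close>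
  have out: "K (t *\<^sub>R x) = 0" if "r / R \<le> t" "t < 1" "t *\<^sub>R x \<in> S" "x \<notin> S" for t x
  proof -
    have t0: "0 < t" using that(1) supp divide_pos_pos[of r R] R by linarith
    have "R \<le> norm x" using that t0 by (auto simp: S_def)
    then have "r / R * R \<le> t * norm x" using that(1) t0 R by (intro mult_mono) auto
    then show ?thesis using t0 R by (intro Kz) simp
  qed
  have "0 \<le> (\<integral>x. indicator S x * (real DIM('a) * (- K x) + (- D x)) \<partial>lborel)"
  proof (rule dilation_divergence_nonneg[OF _ Sbd starS, where C = "max M M2" and \<tau> = "r / R"])
    show "((\<lambda>s. - K (s *\<^sub>R x)) has_real_derivative - D (t *\<^sub>R x) / t) (at t within {1/2..1})"
      if x: "x \<in> S" and t: "t \<in> {1/2..1}" for x t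
      using DERIV_minus[OF deriv[OF that]] by simp
  qed (use supp R Kb Db out in \<open>auto intro: max.coboundedI1 max.coboundedI2\<close>)
  also have "(\<lambda>x. indicator S x * (real DIM('a) * (- K x) + (- D x))) = (\<lambda>x. - (indicator S x * (real N * K x + D x)))"
    by (auto simp: fun_eq_iff N indicator_def)
  finally have le0: "(\<integral>x. indicator S x * (real N * K x + D x) \<partial>lborel) \<le> 0" by simp
  have int: "integrable lborel (\<lambda>x. indicator S x * (real N * K x + D x))"
  proof (rule integrable_indicator_mult_bounded[OF _ Sbd, where B = "real N * M + M2"])
    show "\<bar>real N * K x + D x\<bar> \<le> real N * M + M2" if "x \<in> S" for x
    proof (rule order_trans[OF abs_triangle_ineq add_mono])
      show "\<bar>real N * K x\<bar> \<le> real N * M" unfolding abs_mult using Kb(2)[OF that] by (intro mult_mono) auto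
    qed (rule Db[OF that])
  qed auto
  have ipow: "integrable lborel (\<lambda>x. norm (f x) powr p)"
    if [measurable]: "f \<in> borel_measurable borel" and z: "\<And>x. r \<le> norm x \<Longrightarrow> f x = 0" and b: "\<And>x. norm (f x) \<le> B"
    for f :: "'a \<Rightarrow> 'c::euclidean_space"
  proof -
    have "integrable lborel (\<lambda>x. indicator (ball 0 R) x * norm (f x) powr p)"
    proof (rule integrable_indicator_mult_bounded[where B = "B powr p"])
      show "\<bar>norm (f x) powr p\<bar> \<le> B powr p" for x using b[of x] p by (simp add: powr_mono2)
      have [measurable]: "ball 0 R \<in> sets (borel :: 'a measure)" by simp
      show "(\<lambda>x. indicator (ball 0 R) x * norm (f x) powr p) \<in> borel_measurable borel" by measurable
    qed auto
    also have "(\<lambda>x. indicator (ball 0 R) x * norm (f x) powr p) = (\<lambda>x. norm (f x) powr p)"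
      using z supp(1) by (auto simp: fun_eq_iff indicator_def)
    finally show ?thesis .
  qed
  have iu: "integrable lborel (\<lambda>x. \<bar>u x\<bar> powr p)" using ipow[of u] supp bdd by simp
  have ig: "integrable lborel (\<lambda>x. norm (g x) powr p)" using ipow[of g] supp bdd by simp
  \<comment> \<open>Young's inequality with exponents \<open>p\<close> and \<open>q\<close> for
    \<open>|g|\<close> and \<open>|u|^(p-1) |F|\<close>. The resulting term
    \<open>(p - 1) |u|^p |F|^q\<close> is exactly the one contained in the divergence.\<close>
  have pw: "\<Lambda> * \<bar>u x\<bar> powr p \<le> indicator S x * (real N * K x + D x) + norm (g x) powr p" if x: "x \<noteq> 0" for x
  proof (cases "norm x < R")
    case True
    then have xS: "x \<in> S" using x by (simp add: S_def)
    define a where "a = norm (g x)"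
    define b where "b = \<bar>u x\<bar> powr (p - 1) * w (norm x)"
    have w0: "0 \<le> w (norm x)" using hb(1)[OF xS] by (simp add: w_def)
    have "a * b \<le> a powr p / p + b powr (p / (p - 1)) / (p / (p - 1))"
      using p w0 by (intro Youngs_inequality) (auto simp: a_def b_def field_simps)
    then have "p * (a * b) \<le> p * (a powr p / p + b powr (p / (p - 1)) / (p / (p - 1)))"
      using p by (intro mult_left_mono) auto
    also have "\<dots> = a powr p + (p - 1) * b powr (p / (p - 1))" using p by (simp add: field_simps)
    also have "b powr (p / (p - 1)) = \<bar>u x\<bar> powr p * w (norm x) powr (p / (p - 1))"
      unfolding b_def powr_mult powr_powr using p by simp
    finally have young: "p * (a * b) \<le> a powr p + (p - 1) * (\<bar>u x\<bar> powr p * w (norm x) powr (p / (p - 1)))" .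
    have "\<bar>p * \<bar>u x\<bar> powr (p - 1) * sgn (u x) * (g x \<bullet> x) * h (norm x)\<bar> \<le> p * \<bar>u x\<bar> powr (p - 1) * 1 * (a * norm x) * h (norm x)"
      unfolding abs_mult a_def using p hb(1)[OF xS] Cauchy_Schwarz_ineq2[of "g x" x]
      by (intro mult_mono mult_nonneg_nonneg) (auto simp: sgn_if)
    also have "\<dots> = p * (a * b)" by (simp add: b_def w_def mult_ac)
    finally have "- (p * (a * b)) \<le> p * \<bar>u x\<bar> powr (p - 1) * sgn (u x) * (g x \<bullet> x) * h (norm x)" by linarith
    moreover have "real N * K x + D x = p * \<bar>u x\<bar> powr (p - 1) * sgn (u x) * (g x \<bullet> x) * h (norm x)
      + \<Lambda> * \<bar>u x\<bar> powr p + (p - 1) * (\<bar>u x\<bar> powr p * w (norm x) powr (p / (p - 1)))"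
      unfolding K_def D_def GS[OF xS] w_def by (simp add: algebra_simps)
    ultimately show ?thesis using young xS by (simp add: a_def)
  next
    case False
    then have "u x = 0" using supp by simp
    then show ?thesis using False by (simp add: S_def)
  qed
  have "(\<integral>x. \<Lambda> * \<bar>u x\<bar> powr p \<partial>lborel) \<le> (\<integral>x. indicator S x * (real N * K x + D x) + norm (g x) powr p \<partial>lborel)"
  proof (rule integral_mono_AE)
    show "integrable lborel (\<lambda>x. indicator S x * (real N * K x + D x) + norm (g x) powr p)"
      using int ig by (rule Bochner_Integration.integrable_add)
    have "AE x in lborel. x \<noteq> (0::'a)" by (rule AE_lborel_singleton)
    then show "AE x in lborel. \<Lambda> * \<bar>u x\<bar> powr p \<le> indicator S x * (real N * K x + D x) + norm (g x) powr p"
      by eventually_elim (rule pw)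
  qed (use iu in simp)
  also have "\<dots> = (\<integral>x. indicator S x * (real N * K x + D x) \<partial>lborel) + (\<integral>x. norm (g x) powr p \<partial>lborel)"
    by (rule Bochner_Integration.integral_add[OF int ig])
  finally show ?thesis using le0 by simp
qed

lemma poincare_test_function:
  fixes u :: "'a::euclidean_space \<Rightarrow> real"
  assumes N: "N = DIM('a)" and u: "u \<in> test_functions (ball c R)"
  shows "\<Lambda> * (\<integral>x. \<bar>u x\<bar> powr p \<partial>lebesgue_on (ball c R)) \<le> (\<integral>x. norm (grad u x) powr p \<partial>lebesgue_on (ball c R))"
proof -
  obtain K where K: "compact K" "K \<subseteq> ball c R" "\<And>x. x \<notin> K \<Longrightarrow> u x = 0" "\<And>x. x \<notin> K \<Longrightarrow> grad u x = 0"
    using test_function_support[OF u] by metis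
  obtain B where B: "\<And>x. \<bar>u x\<bar> \<le> B" "\<And>x. norm (grad u x) \<le> B"
    using test_function_bounded[OF u] by metis
  have [measurable]: "u \<in> borel_measurable borel" "grad u \<in> borel_measurable borel"
    using test_function_continuous[OF u] test_function_has_derivative(2)[OF u] by (auto intro: continuous_on_borel)
  \<comment> \<open>A compact subset of the open ball stays within a smaller radius, up to which
    \<open>h\<close> is bounded by monotonicity.\<close>
  have "\<exists>r>0. r < R \<and> K \<subseteq> ball c r"
  proof (cases "K = {}")
    case True
    then show ?thesis using R by (intro exI[of _ "R / 2"]) auto
  next
    case False
    have "continuous_on K (dist c)" by (intro continuous_intros)
    then obtain y where y: "y \<in> K" "\<And>x. x \<in> K \<Longrightarrow> dist c x \<le> dist c y"
      using continuous_attains_sup[OF K(1) False] by blast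
    have "dist c y < R" using y K(2) by auto
    then obtain r where "dist c y < r" "r < R" using dense by blast
    then show ?thesis using y(2) zero_le_dist[of c y] by (intro exI[of _ r]) (force simp del: zero_le_dist)
  qed
  then obtain r where r: "0 < r" "r < R" "K \<subseteq> ball c r" by blast
  have out: "c + x \<notin> K" if "r \<le> norm x" for x
    using that r(3) by (auto simp: dist_norm subset_iff)
  have main: "\<Lambda> * (\<integral>x. \<bar>u (c + x)\<bar> powr p \<partial>lborel) \<le> (\<integral>x. norm (grad u (c + x)) powr p \<partial>lborel)"
  proof (rule poincare_centered[OF N])
    show "((\<lambda>x. u (c + x)) has_derivative (\<lambda>y. grad u (c + x) \<bullet> y)) (at x)" for x
      by (rule has_derivative_compose[where f = "\<lambda>x. c + x" and g = u, OF _ test_function_has_derivative(1)[OF u]])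
         (auto intro!: derivative_eq_intros)
    show "continuous_on UNIV (\<lambda>x. grad u (c + x))"
      by (intro continuous_on_compose2[OF test_function_has_derivative(2)[OF u]] continuous_intros) auto
  qed (use r K out B in auto)
  have "(\<integral>x. norm (f x) powr p \<partial>lebesgue_on (ball c R)) = (\<integral>x. norm (f (c + x)) powr p \<partial>lborel)"
    if [measurable]: "f \<in> borel_measurable borel" and z: "\<And>x. x \<notin> K \<Longrightarrow> f x = 0" for f :: "'a \<Rightarrow> 'c::euclidean_space"
  proof -
    have "(\<integral>x. norm (f x) powr p \<partial>lebesgue_on (ball c R)) = (\<integral>x. indicator (ball c R) x *\<^sub>R norm (f x) powr p \<partial>lborel)"
    proof (rule lebesgue_on_integral_borel(1))
      show [measurable]: "ball c R \<in> sets borel" by simp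
      show "(\<lambda>x. indicator (ball c R) x *\<^sub>R norm (f x) powr p) \<in> borel_measurable borel" by measurable
    qed
    also have "(\<lambda>x. indicator (ball c R) x *\<^sub>R norm (f x) powr p) = (\<lambda>x. norm (f x) powr p)"
      using z K(2) by (fastforce simp: fun_eq_iff indicator_def)
    also have "(\<integral>x. norm (f x) powr p \<partial>lborel) = (\<integral>x. norm (f (c + x)) powr p \<partial>lborel)"
      using lborel_integral_affine[of "\<lambda>x. norm (f x) powr p" 1 c] by simp
    finally show ?thesis .
  qed
  from this[of u] this[of "grad u"] main K(3,4) show ?thesis by simp
qed

end

text \<open>Convexity of the power replaces Minkowski's inequality in the passage to the limit.\<close>

lemma poincare_W1_0:
  fixes v :: "'a::euclidean_space \<Rightarrow> real"
  assumes p: "1 < p" and \<Omega>: "\<Omega> \<in> sets borel" and \<Lambda>: "0 \<le> \<Lambda>"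
    and test: "\<And>\<phi>. \<phi> \<in> test_functions \<Omega> \<Longrightarrow>
      \<Lambda> * (\<integral>x. \<bar>\<phi> x\<bar> powr p \<partial>lebesgue_on \<Omega>) \<le> (\<integral>x. norm (grad \<phi> x) powr p \<partial>lebesgue_on \<Omega>)"
    and vg: "(v, g) \<in> W1_0 p \<Omega>"
  shows "\<Lambda> * (\<integral>x. \<bar>v x\<bar> powr p \<partial>lebesgue_on \<Omega>) \<le> (\<integral>x. norm (g x) powr p \<partial>lebesgue_on \<Omega>)"
proof -
  let ?M = "lebesgue_on \<Omega>"
  obtain \<phi> where \<phi>: "\<And>n::nat. \<phi> n \<in> test_functions \<Omega>"
    and lim: "(\<lambda>n. W1_norm p \<Omega> (\<lambda>x. \<phi> n x - v x) (\<lambda>x. grad (\<phi> n) x - g x)) \<longlonglongrightarrow> 0"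
    using vg unfolding W1_0_def by blast
  have v: "v \<in> L_space p \<Omega>" and g: "g \<in> L_space p \<Omega>"
    using vg unfolding W1_0_def W1_def by auto
  have [measurable]: "v \<in> borel_measurable ?M" "g \<in> borel_measurable ?M"
    using v g by (auto simp: L_space_def)
  have iv: "integrable ?M (\<lambda>x. \<bar>v x\<bar> powr p)" and ig: "integrable ?M (\<lambda>x. norm (g x) powr p)"
    using v g by (auto simp: L_space_def)
  have cm: "f \<in> borel_measurable ?M" if "continuous_on UNIV f" for f :: "'a \<Rightarrow> 'c::euclidean_space"
  proof -
    have "f \<in> borel_measurable lborel" using continuous_on_borel[OF that] by simp
    then have "f \<in> borel_measurable lebesgue" by (rule measurable_completion)
    then show ?thesis by (rule measurable_restrict_space1)
  qed
  have [measurable]: "\<phi> n \<in> borel_measurable ?M" "grad (\<phi> n) \<in> borel_measurable ?M" for n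
    using test_function_continuous[OF \<phi>] test_function_has_derivative(2)[OF \<phi>] by (auto intro: cm)
  have tint: "integrable ?M (\<lambda>x. norm (f x) powr p)"
    if f: "continuous_on UNIV f" and K: "compact K" "K \<subseteq> \<Omega>" "\<And>x. x \<notin> K \<Longrightarrow> f x = 0" and B: "\<And>x. norm (f x) \<le> B"
    for f :: "'a \<Rightarrow> 'c::euclidean_space" and K B
  proof -
    have [measurable]: "f \<in> borel_measurable borel" "K \<in> sets borel"
      using continuous_on_borel[OF f] K(1) by (auto intro: borel_compact)
    have "integrable lborel (\<lambda>x. indicator K x * norm (f x) powr p)"
    proof (rule integrable_indicator_mult_bounded[where B = "B powr p"])
      show "\<bar>norm (f x) powr p\<bar> \<le> B powr p" for x using B[of x] p by (simp add: powr_mono2)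
      show "(\<lambda>x. indicator K x * norm (f x) powr p) \<in> borel_measurable borel" by measurable
    qed (use K(1) compact_imp_bounded in auto)
    also have "(\<lambda>x. indicator K x * norm (f x) powr p) = (\<lambda>x. indicator \<Omega> x *\<^sub>R norm (f x) powr p)"
      using K(2,3) by (fastforce simp: fun_eq_iff indicator_def)
    finally show ?thesis using \<Omega> by (subst lebesgue_on_integral_borel(2)) auto
  qed
  have i\<phi>: "integrable ?M (\<lambda>x. \<bar>\<phi> n x\<bar> powr p)" "integrable ?M (\<lambda>x. norm (grad (\<phi> n) x) powr p)" for n
  proof -
    obtain K where K: "compact K" "K \<subseteq> \<Omega>" "\<And>x. x \<notin> K \<Longrightarrow> \<phi> n x = 0" "\<And>x. x \<notin> K \<Longrightarrow> grad (\<phi> n) x = 0"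
      using test_function_support[OF \<phi>] by metis
    obtain B where B: "\<And>x. \<bar>\<phi> n x\<bar> \<le> B" "\<And>x. norm (grad (\<phi> n) x) \<le> B"
      using test_function_bounded[OF \<phi>] by metis
    show "integrable ?M (\<lambda>x. \<bar>\<phi> n x\<bar> powr p)"
      using tint[OF test_function_continuous[OF \<phi>] K(1,2,3)] B(1) by auto
    show "integrable ?M (\<lambda>x. norm (grad (\<phi> n) x) powr p)"
      using tint[OF test_function_has_derivative(2)[OF \<phi>] K(1,2,4)] B(2) by auto
  qed
  have idiff: "integrable ?M (\<lambda>x. norm (f x - f' x) powr p)"
    if "f \<in> borel_measurable ?M" "f' \<in> borel_measurable ?M" "integrable ?M (\<lambda>x. norm (f x) powr p)" "integrable ?M (\<lambda>x. norm (f' x) powr p)"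
    for f f' :: "'a \<Rightarrow> 'c::euclidean_space"
  proof (rule Bochner_Integration.integrable_bound)
    show "integrable ?M (\<lambda>x. (1 - 1/2) powr (1 - p) * norm (f x) powr p + (1/2) powr (1 - p) * norm (f' x) powr p)"
      using that by (intro Bochner_Integration.integrable_add integrable_mult_right)
    show "(\<lambda>x. norm (f x - f' x) powr p) \<in> borel_measurable ?M" using that(1,2) by measurable
    show "AE x in ?M. norm (norm (f x - f' x) powr p) \<le> norm ((1 - 1/2) powr (1 - p) * norm (f x) powr p + (1/2) powr (1 - p) * norm (f' x) powr p)"
    proof (intro AE_I2)
      fix x
      show "norm (norm (f x - f' x) powr p) \<le> norm ((1 - 1/2) powr (1 - p) * norm (f x) powr p + (1/2) powr (1 - p) * norm (f' x) powr p)"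
        using norm_powr_split[of p "1/2" "f x - f' x" "f x"] p by simp
    qed
  qed
  define A where "A n = (\<integral>x. norm (\<phi> n x - v x) powr p \<partial>?M)" for n
  define G where "G n = (\<integral>x. norm (grad (\<phi> n) x - g x) powr p \<partial>?M)" for n
  have AG: "0 \<le> A n" "0 \<le> G n" for n unfolding A_def G_def by (auto intro: integral_nonneg_AE)
  have "(\<lambda>n. (A n + G n) powr (1 / p)) \<longlonglongrightarrow> 0"
    using lim by (simp add: W1_norm_def A_def G_def)
  then have "(\<lambda>n. ((A n + G n) powr (1 / p)) powr p) \<longlonglongrightarrow> 0"
    by (rule tendsto_zero_powrI[OF _ tendsto_const]) (use p in auto)
  moreover have "((A n + G n) powr (1 / p)) powr p = A n + G n" for n
    using AG[of n] p by (simp add: powr_powr)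
  ultimately have AGlim: "(\<lambda>n. A n + G n) \<longlonglongrightarrow> 0" by simp
  have A0: "A \<longlonglongrightarrow> 0"
    by (rule tendsto_sandwich[OF _ _ tendsto_const AGlim]) (use AG in \<open>auto intro!: always_eventually\<close>)
  have G0: "G \<longlonglongrightarrow> 0"
    by (rule tendsto_sandwich[OF _ _ tendsto_const AGlim]) (use AG in \<open>auto intro!: always_eventually\<close>)
  let ?v = "\<integral>x. \<bar>v x\<bar> powr p \<partial>?M" and ?g = "\<integral>x. norm (g x) powr p \<partial>?M"
  \<comment> \<open>The inequality for \<open>\<phi> n\<close> is placed between two splittings,
    \<open>v\<close> against \<open>\<phi> n\<close> and the gradient of \<open>\<phi> n\<close>
    against \<open>g\<close>. Each costs a factor \<open>(1 - s) powr (1 - p)\<close>, which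
    disappears as \<open>s\<close> tends to 0.\<close>
  have le_s: "\<Lambda> * ?v \<le> (1 - s) powr (1 - p) * ((1 - s) powr (1 - p) * ?g)" if s: "0 < s" "s < 1" for s
  proof -
    define c1 where "c1 = (1 - s) powr (1 - p)"
    define c2 where "c2 = s powr (1 - p)"
    have c: "0 \<le> c1" "0 \<le> c2" by (auto simp: c1_def c2_def)
    have "\<Lambda> * ?v \<le> c1 * (c1 * ?g + c2 * G n) + \<Lambda> * (c2 * A n)" for n
    proof -
      have "?v \<le> (\<integral>x. c1 * \<bar>\<phi> n x\<bar> powr p + c2 * norm (\<phi> n x - v x) powr p \<partial>?M)"
      proof (rule Bochner_Integration.integral_mono)
        show "\<bar>v x\<bar> powr p \<le> c1 * \<bar>\<phi> n x\<bar> powr p + c2 * norm (\<phi> n x - v x) powr p" for x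
          using norm_powr_split[of p s "v x" "\<phi> n x"] p s by (simp add: c1_def c2_def abs_minus_commute)
      qed (use i\<phi>[of n] iv idiff[of "\<phi> n" v] in auto)
      also have "\<dots> = c1 * (\<integral>x. \<bar>\<phi> n x\<bar> powr p \<partial>?M) + c2 * A n"
        unfolding A_def using i\<phi>[of n] iv idiff[of "\<phi> n" v] by simp
      finally have "\<Lambda> * ?v \<le> \<Lambda> * (c1 * (\<integral>x. \<bar>\<phi> n x\<bar> powr p \<partial>?M) + c2 * A n)" using \<Lambda> by (rule mult_left_mono)
      also have "\<dots> = c1 * (\<Lambda> * (\<integral>x. \<bar>\<phi> n x\<bar> powr p \<partial>?M)) + \<Lambda> * (c2 * A n)" by (simp add: algebra_simps)
      also have "\<dots> \<le> c1 * (\<integral>x. norm (grad (\<phi> n) x) powr p \<partial>?M) + \<Lambda> * (c2 * A n)"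
        using test[OF \<phi>[of n]] c by (intro add_right_mono mult_left_mono)
      also have "(\<integral>x. norm (grad (\<phi> n) x) powr p \<partial>?M) \<le> (\<integral>x. c1 * norm (g x) powr p + c2 * norm (grad (\<phi> n) x - g x) powr p \<partial>?M)"
      proof (rule Bochner_Integration.integral_mono)
        show "norm (grad (\<phi> n) x) powr p \<le> c1 * norm (g x) powr p + c2 * norm (grad (\<phi> n) x - g x) powr p" for x
          using norm_powr_split[of p s "grad (\<phi> n) x" "g x"] p s by (simp add: c1_def c2_def)
      qed (use i\<phi>[of n] ig idiff[of "grad (\<phi> n)" g] in auto)
      also have "\<dots> = c1 * ?g + c2 * G n"
        unfolding G_def using i\<phi>[of n] ig idiff[of "grad (\<phi> n)" g] by simp
      finally show ?thesis using c by (simp add: mult_left_mono)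
    qed
    moreover have "(\<lambda>n. c1 * (c1 * ?g + c2 * G n) + \<Lambda> * (c2 * A n)) \<longlonglongrightarrow> c1 * (c1 * ?g + c2 * 0) + \<Lambda> * (c2 * 0)"
      by (intro tendsto_intros A0 G0)
    ultimately have "\<Lambda> * ?v \<le> c1 * (c1 * ?g + c2 * 0) + \<Lambda> * (c2 * 0)"
      by (intro tendsto_lowerbound[OF _ always_eventually]) auto
    then show ?thesis by (simp add: c1_def)
  qed
  have "((\<lambda>s. (1 - s) powr (1 - p) * ((1 - s) powr (1 - p) * ?g)) \<longlongrightarrow> (1 - 0) powr (1 - p) * ((1 - 0) powr (1 - p) * ?g)) (at_right 0)"
    by (intro tendsto_intros) auto
  moreover have "\<forall>\<^sub>F s in at_right (0::real). \<Lambda> * ?v \<le> (1 - s) powr (1 - p) * ((1 - s) powr (1 - p) * ?g)"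
    unfolding eventually_at_right_field using le_s by (intro exI[of _ 1]) auto
  ultimately have "\<Lambda> * ?v \<le> (1 - 0) powr (1 - p) * ((1 - 0) powr (1 - p) * ?g)"
    by (rule tendsto_lowerbound) simp
  then show ?thesis by simp
qed

lemma lambda_ball_ge:
  fixes c :: "'a::euclidean_space"
  assumes "radial_profile DIM('a) p \<Lambda> R h \<phi>"
  shows "ereal \<Lambda> \<le> lambda p (ball c R)"
proof -
  interpret radial_profile "DIM('a)" p \<Lambda> R h \<phi> by fact
  let ?M = "lebesgue_on (ball c R)"
  have "\<Lambda> \<le> rayleigh p (ball c R) v g"
    if vg: "(v, g) \<in> W1_0 p (ball c R)" and nz: "\<not> (AE x in ?M. v x = 0)" for v g
  proof -
    have le: "\<Lambda> * (\<integral>x. \<bar>v x\<bar> powr p \<partial>?M) \<le> (\<integral>x. norm (g x) powr p \<partial>?M)"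
      by (rule poincare_W1_0[OF p _ _ poincare_test_function vg]) (use \<Lambda> in auto)
    have iv: "integrable ?M (\<lambda>x. \<bar>v x\<bar> powr p)"
      using vg by (auto simp: W1_0_def W1_def L_space_def)
    have "(\<integral>x. \<bar>v x\<bar> powr p \<partial>?M) \<noteq> 0"
      using nz by (subst integral_nonneg_eq_0_iff_AE[OF iv]) auto
    moreover have "0 \<le> (\<integral>x. \<bar>v x\<bar> powr p \<partial>?M)" by (rule integral_nonneg_AE) auto
    ultimately have "0 < (\<integral>x. \<bar>v x\<bar> powr p \<partial>?M)" by linarith
    then show ?thesis using le by (simp add: rayleigh_def pos_le_divide_eq)
  qed
  then show ?thesis unfolding lambda_def by (intro Inf_greatest) auto
qed

section \<open>The Neumann eigenvalue\<close>

text \<open>A class in which the classical gradient is a weak one. The gradient off a null set is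
  given as data: the radial competitors are differentiated away from the centre and the sphere of
  radius \<open>R\<close>.\<close>

definition lipschitz_with_gradient :: "('a::euclidean_space \<Rightarrow> real) \<Rightarrow> ('a \<Rightarrow> 'a) \<Rightarrow> bool" where
  "lipschitz_with_gradient u g \<longleftrightarrow> (\<exists>B. \<forall>x y. \<bar>u x - u y\<bar> \<le> B * dist x y) \<and>
    (\<exists>B. \<forall>x. \<bar>u x\<bar> \<le> B \<and> norm (g x) \<le> B) \<and> g \<in> borel_measurable borel \<and>
    (\<exists>E. negligible E \<and> (\<forall>x. x \<notin> E \<longrightarrow> (u has_derivative (\<lambda>y. g x \<bullet> y)) (at x)))"

lemma lipschitz_with_gradient_diff:
  assumes "lipschitz_with_gradient u1 g1" "lipschitz_with_gradient u2 g2"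
  shows "lipschitz_with_gradient (\<lambda>x. c1 * u1 x - c2 * u2 x) (\<lambda>x. c1 *\<^sub>R g1 x - c2 *\<^sub>R g2 x)"
proof -
  obtain L1 B1 E1 where 1: "\<And>x y. \<bar>u1 x - u1 y\<bar> \<le> L1 * dist x y" "\<And>x. \<bar>u1 x\<bar> \<le> B1" "\<And>x. norm (g1 x) \<le> B1"
    "g1 \<in> borel_measurable borel" "negligible E1" "\<And>x. x \<notin> E1 \<Longrightarrow> (u1 has_derivative (\<lambda>y. g1 x \<bullet> y)) (at x)"
    using assms(1) unfolding lipschitz_with_gradient_def by metis
  obtain L2 B2 E2 where 2: "\<And>x y. \<bar>u2 x - u2 y\<bar> \<le> L2 * dist x y" "\<And>x. \<bar>u2 x\<bar> \<le> B2" "\<And>x. norm (g2 x) \<le> B2"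
    "g2 \<in> borel_measurable borel" "negligible E2" "\<And>x. x \<notin> E2 \<Longrightarrow> (u2 has_derivative (\<lambda>y. g2 x \<bullet> y)) (at x)"
    using assms(2) unfolding lipschitz_with_gradient_def by metis
  note [measurable] = 1(4) 2(4)
  have le: "\<bar>c1 * s - c2 * t\<bar> \<le> \<bar>c1\<bar> * S + \<bar>c2\<bar> * T" if "\<bar>s\<bar> \<le> S" "\<bar>t\<bar> \<le> T" for s t S T :: real
  proof -
    have "\<bar>c1 * s\<bar> \<le> \<bar>c1\<bar> * S" "\<bar>c2 * t\<bar> \<le> \<bar>c2\<bar> * T"
      unfolding abs_mult using that by (auto intro: mult_left_mono)
    then show ?thesis by linarith
  qed
  show ?thesis unfolding lipschitz_with_gradient_def
  proof (intro conjI exI allI impI)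
    fix x y :: 'a
    show "\<bar>(c1 * u1 x - c2 * u2 x) - (c1 * u1 y - c2 * u2 y)\<bar> \<le> (\<bar>c1\<bar> * L1 + \<bar>c2\<bar> * L2) * dist x y"
      using le[OF 1(1)[of x y] 2(1)[of x y]] by (simp add: algebra_simps)
    show "\<bar>c1 * u1 x - c2 * u2 x\<bar> \<le> \<bar>c1\<bar> * B1 + \<bar>c2\<bar> * B2" by (rule le[OF 1(2) 2(2)])
    show "norm (c1 *\<^sub>R g1 x - c2 *\<^sub>R g2 x) \<le> \<bar>c1\<bar> * B1 + \<bar>c2\<bar> * B2"
      by (rule order_trans[OF norm_triangle_ineq4]) (auto intro!: add_mono mult_left_mono 1 2)
    show "negligible (E1 \<union> E2)" using 1 2 by (intro negligible_Un)
    assume "x \<notin> E1 \<union> E2"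
    then have "((\<lambda>x. c1 * u1 x - c2 * u2 x) has_derivative (\<lambda>y. c1 * (g1 x \<bullet> y) - c2 * (g2 x \<bullet> y))) (at x)"
      using 1(6) 2(6) by (intro has_derivative_diff has_derivative_mult_right) auto
    then show "((\<lambda>x. c1 * u1 x - c2 * u2 x) has_derivative (\<lambda>y. (c1 *\<^sub>R g1 x - c2 *\<^sub>R g2 x) \<bullet> y)) (at x)"
      by (simp add: inner_diff_left)
  next
    show "(\<lambda>x. c1 *\<^sub>R g1 x - c2 *\<^sub>R g2 x) \<in> borel_measurable borel" by measurable
  qed
qed

lemma integrable_bounded_support:
  fixes F :: "'a::euclidean_space \<Rightarrow> 'b::euclidean_space"
  assumes K: "K \<in> sets borel" "bounded K" "\<And>x. x \<notin> K \<Longrightarrow> F x = 0"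
    and F: "F \<in> borel_measurable borel" "\<And>x. norm (F x) \<le> B"
  shows "integrable lborel F"
proof (rule Bochner_Integration.integrable_bound)
  show "integrable lborel (\<lambda>x. indicator K x * B)"
    using emeasure_bounded_finite[OF K(2)] K(1) by (intro integrable_mult_left integrable_real_indicator) auto
  show "AE x in lborel. norm (F x) \<le> norm (indicator K x * B)"
  proof (intro AE_I2)
    fix x show "norm (F x) \<le> norm (indicator K x * B)"
      using F(2)[of x] K(3)[of x] by (cases "x \<in> K") auto
  qed
qed (use F in simp)

lemma lipschitz_imp_continuous_on:
  fixes f :: "'a::metric_space \<Rightarrow> real"
  assumes "\<And>x y. \<bar>f x - f y\<bar> \<le> B * dist x y"
  shows "continuous_on UNIV f"
proof (rule lipschitz_on_continuous_on)
  show "(max B 0)-lipschitz_on UNIV f"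
  proof (rule lipschitz_onI)
    fix x y :: 'a
    have "B * dist x y \<le> max B 0 * dist x y" by (intro mult_right_mono) auto
    then show "dist (f x) (f y) \<le> max B 0 * dist x y" using assms[of x y] by (simp add: dist_real_def)
  qed simp
qed

text \<open>Translations preserve the integral, so the difference quotients in direction
  \<open>b\<close> integrate to 0. The Lipschitz bound dominates them on a bounded set, and they
  converge off \<open>E\<close>.\<close>

lemma integral_gradient_eq_0:
  fixes f :: "'a::euclidean_space \<Rightarrow> real"
  assumes lip: "\<And>x y. \<bar>f x - f y\<bar> \<le> B * dist x y"
    and K: "compact K" "\<And>x. x \<notin> K \<Longrightarrow> f x = 0"
    and E: "negligible E" "\<And>x. x \<notin> E \<Longrightarrow> (f has_derivative (\<lambda>y. g x \<bullet> y)) (at x)"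
    and g: "g \<in> borel_measurable borel"
  shows "(\<integral>x. g x \<bullet> b \<partial>lborel) = 0"
proof -
  define T where "T n = 1 / real (Suc n)" for n
  have T: "0 < T n" "T n \<le> 1" for n by (auto simp: T_def)
  have Tlim: "filterlim T (at 0) sequentially"
  proof -
    have "T \<longlonglongrightarrow> 0" unfolding T_def[abs_def] by (rule LIMSEQ_Suc[OF lim_1_over_n])
    then show ?thesis unfolding filterlim_at using T by (auto intro!: always_eventually simp: less_imp_neq[symmetric])
  qed
  have fc: "continuous_on UNIV f" by (rule lipschitz_imp_continuous_on[OF lip])
  have [measurable]: "f \<in> borel_measurable borel" by (rule continuous_on_borel[OF fc])
  note [measurable] = g
  obtain C where C: "\<And>x. x \<in> K \<Longrightarrow> norm x \<le> C" using compact_imp_bounded[OF K(1)] bounded_iff by blast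
  \<comment> \<open>Contains every \<open>x\<close> for which \<open>K\<close> meets the segment
    from \<open>x\<close> to \<open>x + b\<close>.\<close>
  define S where "S = cball (0::'a) (\<bar>C\<bar> + norm b)"
  have [measurable]: "S \<in> sets borel" by (simp add: S_def)
  have fS: "f (x + t *\<^sub>R b) = 0" if "x \<notin> S" "0 \<le> t" "t \<le> 1" for x t
  proof -
    have "norm (t *\<^sub>R b) \<le> norm b" using that by (simp add: mult_left_le_one_le)
    then have "\<bar>C\<bar> < norm (x + t *\<^sub>R b)" using that norm_diff_ineq[of x "t *\<^sub>R b"] by (simp add: S_def)
    then show ?thesis using C[of "x + t *\<^sub>R b"] by (intro K) auto
  qed
  have "\<exists>M. \<forall>x. \<bar>f x\<bar> \<le> M"
  proof -
    have "compact (f ` K)" using fc K(1) by (intro compact_continuous_image) (auto intro: continuous_on_subset)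
    then obtain M where "\<forall>y\<in>f ` K. norm y \<le> M" using compact_imp_bounded bounded_iff by metis
    then have "\<bar>f x\<bar> \<le> max M 0" for x using K(2)[of x] by (cases "x \<in> K") auto
    then show ?thesis by blast
  qed
  then obtain M where M: "\<And>x. \<bar>f x\<bar> \<le> M" by blast
  have fint: "integrable lborel (\<lambda>x. f (x + t *\<^sub>R b))" if "0 \<le> t" "t \<le> 1" for t
    by (rule integrable_bounded_support[of S _ M]) (use fS that M in \<open>auto simp: S_def\<close>)
  have zero: "(\<integral>x. (f (x + T n *\<^sub>R b) - f x) / T n \<partial>lborel) = 0" for n
  proof -
    have "(\<integral>x. f x \<partial>lborel) = (\<integral>x. f (x + T n *\<^sub>R b) \<partial>lborel)"
      using lborel_integral_affine[of f 1 "T n *\<^sub>R b"] by (simp add: add.commute)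
    then show ?thesis using fint[of "T n"] fint[of 0] T[of n] by simp
  qed
  have "(\<lambda>n. \<integral>x. (f (x + T n *\<^sub>R b) - f x) / T n \<partial>lborel) \<longlonglongrightarrow> (\<integral>x. g x \<bullet> b \<partial>lborel)"
  proof (rule integral_dominated_convergence)
    show "integrable lborel (\<lambda>x. indicator S x * (\<bar>B\<bar> * norm b))"
      using emeasure_bounded_finite[of S] by (intro integrable_mult_left integrable_real_indicator) (auto simp: S_def)
    show "AE x in lborel. (\<lambda>n. (f (x + T n *\<^sub>R b) - f x) / T n) \<longlonglongrightarrow> g x \<bullet> b"
    proof -
      have "AE x in lebesgue. x \<notin> E" using E(1) by (intro AE_not_in) (simp add: negligible_iff_null_sets)
      then have "AE x in lborel. x \<notin> E" by (simp add: AE_completion_iff)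
      then show ?thesis
      proof eventually_elim
        case (elim x)
        have "((\<lambda>t. f (x + t *\<^sub>R b)) has_derivative (\<lambda>t. g x \<bullet> (t *\<^sub>R b))) (at 0)"
          by (rule has_derivative_compose[where f = "\<lambda>t. x + t *\<^sub>R b" and g = f])
             (use E(2)[OF elim] in \<open>auto intro!: derivative_eq_intros\<close>)
        then have "((\<lambda>t. f (x + t *\<^sub>R b)) has_real_derivative g x \<bullet> b) (at 0)"
          unfolding has_field_derivative_def by (rule has_derivative_eq_rhs) auto
        then have "((\<lambda>t. (f (x + t *\<^sub>R b) - f x) / t) \<longlongrightarrow> g x \<bullet> b) (at 0)"
          by (simp add: has_field_derivative_iff)
        from filterlim_compose[OF this Tlim] show ?case .
      qed
    qed
    show "AE x in lborel. norm ((f (x + T n *\<^sub>R b) - f x) / T n) \<le> indicator S x * (\<bar>B\<bar> * norm b)" for n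
    proof (intro AE_I2)
      fix x :: 'a
      show "norm ((f (x + T n *\<^sub>R b) - f x) / T n) \<le> indicator S x * (\<bar>B\<bar> * norm b)"
      proof (cases "x \<in> S")
        case True
        have "\<bar>f (x + T n *\<^sub>R b) - f x\<bar> \<le> B * (T n * norm b)"
          using lip[of "x + T n *\<^sub>R b" x] T[of n] by (simp add: dist_norm)
        also have "\<dots> \<le> \<bar>B\<bar> * (T n * norm b)" using T[of n] by (intro mult_right_mono) auto
        finally show ?thesis using True T(1)[of n] by (simp add: abs_divide pos_divide_le_eq mult_ac)
      next
        case False
        then show ?thesis using fS[OF False, of 0] fS[OF False, of "T n"] T[of n] by simp
      qed
    qed
  qed measurable
  then show ?thesis unfolding zero using LIMSEQ_unique tendsto_const by blast
qed

lemma lipschitz_with_gradient_integrable: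
  fixes u :: "'a::euclidean_space \<Rightarrow> real"
  assumes lg: "lipschitz_with_gradient u g" and \<Omega>: "open \<Omega>" "bounded \<Omega>" and e: "0 < e"
  shows "integrable (lebesgue_on \<Omega>) (\<lambda>x. \<bar>u x\<bar> powr e)"
    and "integrable (lebesgue_on \<Omega>) (\<lambda>x. norm (g x) powr e)"
proof -
  obtain L B where B: "\<And>x y. \<bar>u x - u y\<bar> \<le> L * dist x y" "\<And>x. \<bar>u x\<bar> \<le> B" "\<And>x. norm (g x) \<le> B"
    and gm: "g \<in> borel_measurable borel"
    using lg unfolding lipschitz_with_gradient_def by metis
  have um: "u \<in> borel_measurable borel"
    by (rule continuous_on_borel[OF lipschitz_imp_continuous_on[OF B(1)]])
  have \<Omega>b [measurable]: "\<Omega> \<in> sets borel" using \<Omega>(1) by simp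
  have int: "integrable (lebesgue_on \<Omega>) (\<lambda>x. norm (f x) powr e)"
    if [measurable]: "f \<in> borel_measurable borel" and b: "\<And>x. norm (f x) \<le> B"
    for f :: "'a \<Rightarrow> 'c::euclidean_space"
  proof -
    have "integrable lborel (\<lambda>x. indicator \<Omega> x *\<^sub>R norm (f x) powr e)"
    proof (rule integrable_bounded_support[OF \<Omega>b \<Omega>(2)])
      show "norm (indicator \<Omega> x *\<^sub>R norm (f x) powr e) \<le> B powr e" for x
        using b[of x] e by (auto simp: indicator_def intro: powr_mono2)
    qed auto
    then show ?thesis by (subst lebesgue_on_integral_borel(2)[OF \<Omega>b]) auto
  qed
  show "integrable (lebesgue_on \<Omega>) (\<lambda>x. \<bar>u x\<bar> powr e)" using int[OF um] B(2) by simp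
  show "integrable (lebesgue_on \<Omega>) (\<lambda>x. norm (g x) powr e)" using int[OF gm] B(3) by simp
qed

text \<open>For a test function \<open>\<phi>\<close>, the product \<open>v \<phi>\<close> is
  Lipschitz with compact support and has gradient \<open>v grad \<phi> + \<phi> g\<close> almost
  everywhere; that this integrates to 0 is the weak formulation.\<close>

lemma lipschitz_with_gradient_in_W1:
  fixes v :: "'a::euclidean_space \<Rightarrow> real"
  assumes vg: "lipschitz_with_gradient v g" and \<Omega>: "open \<Omega>" "bounded \<Omega>" and p: "1 \<le> p"
  shows "(v, g) \<in> W1 p \<Omega>"
proof -
  obtain L B E where v: "\<And>x y. \<bar>v x - v y\<bar> \<le> L * dist x y" "\<And>x. \<bar>v x\<bar> \<le> B" "\<And>x. norm (g x) \<le> B"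
    and [measurable]: "g \<in> borel_measurable borel"
    and E: "negligible E" "\<And>x. x \<notin> E \<Longrightarrow> (v has_derivative (\<lambda>y. g x \<bullet> y)) (at x)"
    using vg unfolding lipschitz_with_gradient_def by metis
  have B: "0 \<le> B" using v(2)[of 0] by linarith
  have "continuous_on UNIV v" by (rule lipschitz_imp_continuous_on[OF v(1)])
  then have [measurable]: "v \<in> borel_measurable borel" by (rule continuous_on_borel)
  have \<Omega>b [measurable]: "\<Omega> \<in> sets borel" using \<Omega>(1) by simp
  have meas: "f \<in> borel_measurable (lebesgue_on \<Omega>)" if "f \<in> borel_measurable borel" for f :: "'a \<Rightarrow> 'c::euclidean_space"
    using that by (intro measurable_restrict_space1 measurable_completion) simp
  have "(\<integral>x. v x *\<^sub>R grad \<phi> x \<partial>lebesgue_on \<Omega>) = - (\<integral>x. \<phi> x *\<^sub>R g x \<partial>lebesgue_on \<Omega>)"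
    if \<phi>: "\<phi> \<in> test_functions \<Omega>" for \<phi>
  proof -
    obtain K where K: "compact K" "K \<subseteq> \<Omega>" "\<And>x. x \<notin> K \<Longrightarrow> \<phi> x = 0" "\<And>x. x \<notin> K \<Longrightarrow> grad \<phi> x = 0"
      using test_function_support[OF \<phi>] by metis
    obtain C where C: "0 \<le> C" "\<And>x. \<bar>\<phi> x\<bar> \<le> C" "\<And>x. norm (grad \<phi> x) \<le> C"
      using test_function_bounded[OF \<phi>] by metis
    have [measurable]: "\<phi> \<in> borel_measurable borel" "grad \<phi> \<in> borel_measurable borel"
      using test_function_continuous[OF \<phi>] test_function_has_derivative(2)[OF \<phi>] by (auto intro: continuous_on_borel)
    have Kb: "K \<in> sets borel" "bounded K" using K(1) by (auto intro: borel_compact compact_imp_bounded)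
    have \<phi>lip: "\<bar>\<phi> x - \<phi> y\<bar> \<le> C * dist x y" for x y
    proof -
      have "norm (\<phi> x - \<phi> y) \<le> C * norm (x - y)"
      proof (rule differentiable_bound[of UNIV])
        show "(\<phi> has_derivative (\<lambda>y. grad \<phi> x \<bullet> y)) (at x within UNIV)" for x
          using test_function_has_derivative(1)[OF \<phi>] by simp
        show "onorm (\<lambda>y. grad \<phi> x \<bullet> y) \<le> C" for x
        proof (rule onorm_le)
          show "norm (grad \<phi> x \<bullet> y) \<le> C * norm y" for y
            using Cauchy_Schwarz_ineq2[of "grad \<phi> x" y] mult_right_mono[OF C(3)[of x], of "norm y"] by simp
        qed
      qed auto
      then show ?thesis by (simp add: dist_norm)
    qed
    let ?F1 = "\<lambda>x. v x *\<^sub>R grad \<phi> x" and ?F2 = "\<lambda>x. \<phi> x *\<^sub>R g x"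
    have i1: "integrable lborel ?F1"
      by (rule integrable_bounded_support[OF Kb, where B = "B * C"])
         (use K C v B in \<open>auto intro!: mult_mono\<close>)
    have i2: "integrable lborel ?F2"
      by (rule integrable_bounded_support[OF Kb, where B = "C * B"])
         (use K C v B in \<open>auto intro!: mult_mono\<close>)
    have "(\<integral>x. ?F1 x + ?F2 x \<partial>lborel) = 0"
    proof (rule euclidean_eqI)
      fix b :: 'a
      have "(\<integral>x. (?F1 x + ?F2 x) \<bullet> b \<partial>lborel) = 0"
      proof (rule integral_gradient_eq_0[OF _ K(1) _ E(1)])
        show "\<bar>v x * \<phi> x - v y * \<phi> y\<bar> \<le> (B * C + C * max L 0) * dist x y" for x y
        proof -
          have "v x * \<phi> x - v y * \<phi> y = v x * (\<phi> x - \<phi> y) + \<phi> y * (v x - v y)" by (simp add: algebra_simps)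
          also have "\<bar>\<dots>\<bar> \<le> \<bar>v x * (\<phi> x - \<phi> y)\<bar> + \<bar>\<phi> y * (v x - v y)\<bar>" by (rule abs_triangle_ineq)
          also have "\<bar>v x * (\<phi> x - \<phi> y)\<bar> \<le> B * (C * dist x y)"
            unfolding abs_mult using v(2) \<phi>lip B by (intro mult_mono) auto
          also have "\<bar>\<phi> y * (v x - v y)\<bar> \<le> C * (max L 0 * dist x y)"
            unfolding abs_mult using C(1,2) v(1)[of x y] mult_right_mono[of L "max L 0" "dist x y"]
            by (intro mult_mono) auto
          finally show ?thesis by (simp add: algebra_simps)
        qed
        show "((\<lambda>x. v x * \<phi> x) has_derivative (\<lambda>y. (?F1 x + ?F2 x) \<bullet> y)) (at x)" if "x \<notin> E" for x
        proof -
          have "((\<lambda>x. v x * \<phi> x) has_derivative (\<lambda>y. v x * (grad \<phi> x \<bullet> y) + (g x \<bullet> y) * \<phi> x)) (at x)"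
            by (rule has_derivative_mult[OF E(2)[OF that] test_function_has_derivative(1)[OF \<phi>]])
          then show ?thesis by (rule has_derivative_eq_rhs) (auto simp: inner_add_left)
        qed
      qed (use K in auto)
      then show "(\<integral>x. ?F1 x + ?F2 x \<partial>lborel) \<bullet> b = 0 \<bullet> b"
        using i1 i2 by (subst (asm) integral_inner_left) auto
    qed
    then have sum0: "(\<integral>x. ?F1 x \<partial>lborel) = - (\<integral>x. ?F2 x \<partial>lborel)"
      using i1 i2 by (simp add: eq_neg_iff_add_eq_0)
    have ind: "(\<lambda>x. indicator \<Omega> x *\<^sub>R ?F1 x) = ?F1" "(\<lambda>x. indicator \<Omega> x *\<^sub>R ?F2 x) = ?F2"
      using K(2,3,4) by (fastforce simp: fun_eq_iff indicator_def)+
    have "(\<integral>x. ?F1 x \<partial>lebesgue_on \<Omega>) = (\<integral>x. ?F1 x \<partial>lborel)"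
      by (subst lebesgue_on_integral_borel(1)[OF \<Omega>b]) (unfold ind, measurable)
    moreover have "(\<integral>x. ?F2 x \<partial>lebesgue_on \<Omega>) = (\<integral>x. ?F2 x \<partial>lborel)"
      by (subst lebesgue_on_integral_borel(1)[OF \<Omega>b]) (unfold ind, measurable)
    ultimately show ?thesis using sum0 by simp
  qed
  moreover have "v \<in> L_space p \<Omega>" "g \<in> L_space p \<Omega>"
    using lipschitz_with_gradient_integrable[OF vg \<Omega>, of p] p by (auto simp: L_space_def intro: meas)
  ultimately show ?thesis unfolding W1_def by simp
qed

lemma integral_powr_pos:
  fixes u :: "'a::euclidean_space \<Rightarrow> real"
  assumes "open \<Omega>" and U: "U \<noteq> {}" "open U" "U \<subseteq> \<Omega>" "\<And>x. x \<in> U \<Longrightarrow> 0 < u x"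
    and i: "integrable (lebesgue_on \<Omega>) (\<lambda>x. u x powr e)"
  shows "0 < (\<integral>x. u x powr e \<partial>lebesgue_on \<Omega>)"
proof -
  have "\<not> (AE x in lebesgue_on \<Omega>. u x powr e = 0)"
  proof
    assume "AE x in lebesgue_on \<Omega>. u x powr e = 0"
    then have "AE x in lebesgue. x \<in> \<Omega> \<longrightarrow> u x powr e = 0"
      using assms(1) by (subst (asm) AE_restrict_space_iff) auto
    then have "AE x in lebesgue. x \<notin> U" by eventually_elim (use U in force)
    then have "U \<in> null_sets lebesgue"
      using U(2) by (subst (asm) AE_iff_null_sets[symmetric]) auto
    then have "negligible U" by (simp add: negligible_iff_null_sets)
    then show False using open_not_negligible U by blast
  qed
  then have "(\<integral>x. u x powr e \<partial>lebesgue_on \<Omega>) \<noteq> 0" by (subst integral_nonneg_eq_0_iff_AE[OF i]) auto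
  moreover have "0 \<le> (\<integral>x. u x powr e \<partial>lebesgue_on \<Omega>)" by (rule integral_nonneg_AE) auto
  ultimately show ?thesis by linarith
qed

lemma Int_ball_nonempty: "c \<in> closure S \<Longrightarrow> 0 < R \<Longrightarrow> S \<inter> ball c R \<noteq> {}"
  unfolding closure_approachable by (metis IntI dist_commute empty_iff mem_ball)

text \<open>The coefficients normalise the integrals of \<open>(c1 u1)^(p-1)\<close> and
  \<open>(c2 u2)^(p-1)\<close> to 1, so that with opposite signs they cancel in the constraint. On
  disjoint supports both numerator and denominator of the quotient add up with the same weights
  \<open>c1^p\<close> and \<open>c2^p\<close>, so the two strict inequalities combine.\<close>

lemma mu_less_of_disjoint_supports:
  fixes u1 u2 :: "'a::euclidean_space \<Rightarrow> real"
  assumes p: "1 < p" and \<Omega>: "open \<Omega>" "bounded \<Omega>"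
    and lg: "lipschitz_with_gradient u1 g1" "lipschitz_with_gradient u2 g2"
    and nonneg: "\<And>x. 0 \<le> u1 x" "\<And>x. 0 \<le> u2 x"
    and disj: "\<And>x. u1 x = 0 \<and> g1 x = 0 \<or> u2 x = 0 \<and> g2 x = 0"
    and nz: "Va \<noteq> {}" "open Va" "Va \<subseteq> \<Omega>" "\<And>x. x \<in> Va \<Longrightarrow> 0 < u1 x"
            "Vb \<noteq> {}" "open Vb" "Vb \<subseteq> \<Omega>" "\<And>x. x \<in> Vb \<Longrightarrow> 0 < u2 x"
    and less: "(\<integral>x. norm (g1 x) powr p \<partial>lebesgue_on \<Omega>) < \<Lambda> * (\<integral>x. u1 x powr p \<partial>lebesgue_on \<Omega>)"
              "(\<integral>x. norm (g2 x) powr p \<partial>lebesgue_on \<Omega>) < \<Lambda> * (\<integral>x. u2 x powr p \<partial>lebesgue_on \<Omega>)"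
  shows "mu p \<Omega> < ereal \<Lambda>"
proof -
  let ?M = "lebesgue_on \<Omega>"
  have ig: "integrable ?M (\<lambda>x. norm (g1 x) powr p)" "integrable ?M (\<lambda>x. norm (g2 x) powr p)"
    using lipschitz_with_gradient_integrable(2)[OF _ \<Omega>, of _ _ p] lg p by auto
  have iu: "integrable ?M (\<lambda>x. u1 x powr e)" "integrable ?M (\<lambda>x. u2 x powr e)" if "0 < e" for e
    using lipschitz_with_gradient_integrable(1)[OF lg(1) \<Omega> that]
      lipschitz_with_gradient_integrable(1)[OF lg(2) \<Omega> that] nonneg by auto
  note pos = integral_powr_pos[OF \<Omega>(1)]
  define I1 I2 where "I1 = (\<integral>x. u1 x powr (p - 1) \<partial>?M)" and "I2 = (\<integral>x. u2 x powr (p - 1) \<partial>?M)"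
  have I: "0 < I1" "0 < I2" unfolding I1_def I2_def using p nz iu[of "p - 1"] by (auto intro: pos)
  define c1 c2 where "c1 = I1 powr (- 1 / (p - 1))" and "c2 = I2 powr (- 1 / (p - 1))"
  have c: "0 < c1" "0 < c2" using I by (auto simp: c1_def c2_def)
  have cI: "c1 powr (p - 1) * I1 = 1" "c2 powr (p - 1) * I2 = 1"
  proof -
    have "(J powr (- 1 / (p - 1))) powr (p - 1) * J = 1" if "0 < J" for J :: real
    proof -
      have "- 1 / (p - 1) * (p - 1) = - 1" using p by simp
      then show ?thesis unfolding powr_powr using that by (simp add: powr_neg_one)
    qed
    then show "c1 powr (p - 1) * I1 = 1" "c2 powr (p - 1) * I2 = 1" using I by (auto simp only: c1_def c2_def)
  qed
  define v where "v x = c1 * u1 x - c2 * u2 x" for x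
  define g where "g x = c1 *\<^sub>R g1 x - c2 *\<^sub>R g2 x" for x
  have W: "(v, g) \<in> W1 p \<Omega>"
    unfolding v_def g_def using lipschitz_with_gradient_in_W1[OF lipschitz_with_gradient_diff[OF lg] \<Omega>] p by simp
  have vp: "\<bar>v x\<bar> powr p = c1 powr p * u1 x powr p + c2 powr p * u2 x powr p" for x
    using disj[of x] c nonneg[of x] by (auto simp: v_def powr_mult)
  have gp: "norm (g x) powr p = c1 powr p * norm (g1 x) powr p + c2 powr p * norm (g2 x) powr p" for x
    using disj[of x] c by (auto simp: g_def powr_mult)
  have vm: "\<bar>v x\<bar> powr (p - 2) * v x = c1 powr (p - 1) * u1 x powr (p - 1) - c2 powr (p - 1) * u2 x powr (p - 1)" for x
  proof -
    have e: "\<bar>y\<bar> powr (p - 2) * y = y powr (p - 1)" if "0 \<le> y" for y :: real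
      using powr_mult_base[OF that, of "p - 2"] that by (simp add: mult.commute)
    have "v x = c1 * u1 x \<and> u2 x = 0 \<or> v x = - (c2 * u2 x) \<and> u1 x = 0" using disj[of x] by (auto simp: v_def)
    then show ?thesis
    proof
      assume a: "v x = c1 * u1 x \<and> u2 x = 0"
      then show ?thesis using e[of "c1 * u1 x"] c nonneg(1)[of x] by (simp add: powr_mult)
    next
      assume a: "v x = - (c2 * u2 x) \<and> u1 x = 0"
      then show ?thesis using e[of "c2 * u2 x"] c nonneg(2)[of x] by (simp add: powr_mult)
    qed
  qed
  have mean: "(\<integral>x. \<bar>v x\<bar> powr (p - 2) * v x \<partial>?M) = 0"
    unfolding vm using iu[of "p - 1"] p cI by (simp add: I1_def I2_def)
  define A1 A2 D1 D2 where "A1 = (\<integral>x. norm (g1 x) powr p \<partial>?M)" and "A2 = (\<integral>x. norm (g2 x) powr p \<partial>?M)"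
    and "D1 = (\<integral>x. u1 x powr p \<partial>?M)" and "D2 = (\<integral>x. u2 x powr p \<partial>?M)"
  have vi: "(\<integral>x. \<bar>v x\<bar> powr p \<partial>?M) = c1 powr p * D1 + c2 powr p * D2"
    unfolding vp D1_def D2_def using iu[of p] p by simp
  have gi: "(\<integral>x. norm (g x) powr p \<partial>?M) = c1 powr p * A1 + c2 powr p * A2"
    unfolding gp A1_def A2_def using ig by simp
  have D: "0 < D1" "0 < D2" unfolding D1_def D2_def using p nz iu[of p] by (auto intro: pos)
  have cp: "0 < c1 powr p" "0 < c2 powr p" using c by auto
  have Dp: "0 < c1 powr p * D1 + c2 powr p * D2" using D cp by (intro add_pos_pos mult_pos_pos)
  have nv: "\<not> (AE x in ?M. v x = 0)"
  proof
    assume "AE x in ?M. v x = 0"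
    then have "AE x in ?M. \<bar>v x\<bar> powr p = 0" by eventually_elim simp
    then have "(\<integral>x. \<bar>v x\<bar> powr p \<partial>?M) = 0" by (rule integral_eq_zero_AE)
    then show False using Dp vi by simp
  qed
  have "c1 powr p * A1 + c2 powr p * A2 < c1 powr p * (\<Lambda> * D1) + c2 powr p * (\<Lambda> * D2)"
    using less cp unfolding A1_def A2_def D1_def D2_def by (intro add_strict_mono mult_strict_left_mono)
  also have "\<dots> = \<Lambda> * (c1 powr p * D1 + c2 powr p * D2)" by (simp add: algebra_simps)
  finally have "rayleigh p \<Omega> v g < \<Lambda>"
    unfolding rayleigh_def vi gi using Dp by (simp add: pos_divide_less_eq)
  moreover have "mu p \<Omega> \<le> ereal (rayleigh p \<Omega> v g)"
    unfolding mu_def using W nv mean by (intro Inf_lower) blast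
  ultimately show ?thesis by (meson ereal_less_eq(3) le_less_trans less_ereal.simps(1))
qed

section \<open>Radial competitors centred at the ends of a diameter\<close>

context radial_profile
begin

definition bump :: "'a::euclidean_space \<Rightarrow> 'a \<Rightarrow> real"
  where "bump a x = \<phi> (norm (x - a))"

text \<open>A vector of length \<open>\<psi>\<close> pointing towards \<open>a\<close>. The
  indicator fixes the value 0 at the centre and from radius \<open>R\<close> on, which makes it
  Borel measurable and lets it vanish wherever \<open>bump\<close> does.\<close>

definition bump_grad :: "'a::euclidean_space \<Rightarrow> 'a \<Rightarrow> 'a"
  where "bump_grad a x = - (indicator (ball 0 R - {0}) (x - a) * \<psi> (norm (x - a)) / norm (x - a)) *\<^sub>R (x - a)"

lemma \<phi>_lipschitz:
  assumes C: "\<And>\<rho>. 0 \<le> \<rho> \<Longrightarrow> \<psi> \<rho> \<le> C" and "0 \<le> \<rho>" "\<rho> \<le> \<sigma>"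
  shows "\<phi> \<rho> - \<phi> \<sigma> \<le> C * (\<sigma> - \<rho>)"
proof -
  have C0: "0 \<le> C" using C[of 0] \<psi>_nonneg[of 0] by simp
  have in_R: "\<phi> \<rho> - \<phi> \<sigma> \<le> C * (\<sigma> - \<rho>)" if "0 \<le> \<rho>" "\<rho> \<le> \<sigma>" "\<sigma> \<le> R" for \<rho> \<sigma>
  proof -
    have "\<phi> \<rho> + C * \<rho> \<le> \<phi> \<sigma> + C * \<sigma>"
    proof (rule DERIV_nonneg_imp_increasing_open[OF that(2)])
      fix x assume x: "\<rho> < x" "x < \<sigma>"
      have "((\<lambda>x. \<phi> x + C * x) has_real_derivative - \<psi> x + C * 1) (at x)"
        unfolding \<psi>_def using that x by (intro DERIV_add \<phi>_deriv DERIV_cmult DERIV_ident) auto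
      moreover have "0 \<le> - \<psi> x + C * 1" using C[of x] x that by simp
      ultimately show "\<exists>y. ((\<lambda>x. \<phi> x + C * x) has_real_derivative y) (at x) \<and> 0 \<le> y" by blast
    next
      show "continuous_on {\<rho>..\<sigma>} (\<lambda>x. \<phi> x + C * x)"
        using that by (intro continuous_intros continuous_on_subset[OF \<phi>_cont]) auto
    qed
    then show ?thesis by (simp add: algebra_simps)
  qed
  consider "\<sigma> \<le> R" | "R \<le> \<rho>" | "\<rho> < R" "R < \<sigma>" by linarith
  then show ?thesis
  proof cases
    case 1
    then show ?thesis using in_R assms by blast
  next
    case 2
    then show ?thesis using assms C0 \<phi>_eq_0 by simp
  next
    case 3
    then have "\<phi> \<rho> - \<phi> \<sigma> \<le> C * (R - \<rho>)" using in_R[of \<rho> R] assms \<phi>_eq_0[of \<sigma>] \<phi>_eq_0[of R] by simp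
    also have "\<dots> \<le> C * (\<sigma> - \<rho>)" using 3 C0 by (intro mult_left_mono) auto
    finally show ?thesis .
  qed
qed

lemma norm_bump_grad: "norm (bump_grad a x) = indicator (ball 0 R - {0}) (x - a) * \<psi> (norm (x - a))"
  using \<psi>_nonneg[of "norm (x - a)"] by (auto simp: bump_grad_def indicator_def)

lemma bump_nonneg: "0 \<le> bump a x"
  using \<phi>_pos[of "norm (x - a)"] \<phi>_eq_0[of "norm (x - a)"] by (cases "norm (x - a) < R") (auto simp: bump_def)

lemma bump_has_derivative:
  assumes "x \<noteq> a" "x \<notin> sphere a R"
  shows "(bump a has_derivative (\<lambda>y. bump_grad a x \<bullet> y)) (at x)"
proof (cases "norm (x - a) < R")
  case True
  have dn: "((\<lambda>x. norm (x - a)) has_derivative (\<lambda>y. y \<bullet> sgn (x - a))) (at x)"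
  proof (rule has_derivative_compose[where f = "\<lambda>x. x - a" and g = norm])
    show "((\<lambda>x. x - a) has_derivative (\<lambda>y. y)) (at x)" by (auto intro!: derivative_eq_intros)
    show "(norm has_derivative (\<lambda>y. y \<bullet> sgn (x - a))) (at (x - a))"
      using GDERIV_norm[of "x - a"] assms(1) by (simp add: gderiv_def)
  qed
  have "(\<phi> has_derivative (*) (- \<psi> (norm (x - a)))) (at (norm (x - a)))"
    using \<phi>_deriv[of "norm (x - a)"] assms(1) True unfolding has_field_derivative_def \<psi>_def by simp
  from has_derivative_compose[OF dn this]
  show ?thesis unfolding bump_def[abs_def]
    by (rule has_derivative_eq_rhs) (use True assms(1) in \<open>auto simp: bump_grad_def sgn_div_norm inner_commute divide_inverse\<close>)
next
  case False
  then have x: "x \<in> - cball a R" using assms(2) by (auto simp: dist_norm norm_minus_commute)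
  have "((\<lambda>_. 0::real) has_derivative (\<lambda>_. 0)) (at x)" by simp
  then have "(bump a has_derivative (\<lambda>_. 0)) (at x)"
    by (rule has_derivative_transform_within_open[where s = "- cball a R"])
       (use x \<phi>_eq_0 in \<open>auto simp: bump_def dist_norm norm_minus_commute\<close>)
  moreover have "bump_grad a x = 0" using False by (simp add: bump_grad_def)
  ultimately show ?thesis by simp
qed

lemma bump_lipschitz_with_gradient:
  fixes a :: "'a::euclidean_space"
  shows "lipschitz_with_gradient (bump a) (bump_grad a)"
  unfolding lipschitz_with_gradient_def
proof (intro conjI)
  obtain C where C: "\<And>\<rho>. 0 \<le> \<rho> \<Longrightarrow> \<psi> \<rho> \<le> C" using \<psi>_bounded by blast
  have C0: "0 \<le> C" using C[of 0] \<psi>_nonneg[of 0] by simp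
  have "\<bar>bump a x - bump a y\<bar> \<le> C * dist x y" for x y
  proof -
    have "\<bar>\<phi> \<rho> - \<phi> \<sigma>\<bar> \<le> C * \<bar>\<rho> - \<sigma>\<bar>" if "0 \<le> \<rho>" "0 \<le> \<sigma>" for \<rho> \<sigma>
      using \<phi>_lipschitz[of C \<rho> \<sigma>] \<phi>_lipschitz[of C \<sigma> \<rho>] \<phi>_antimono[of \<rho> \<sigma>] \<phi>_antimono[of \<sigma> \<rho>] C that
      by (cases "\<rho> \<le> \<sigma>") auto
    then have "\<bar>bump a x - bump a y\<bar> \<le> C * \<bar>norm (x - a) - norm (y - a)\<bar>" by (simp add: bump_def)
    also have "\<dots> \<le> C * dist x y"
      using norm_triangle_ineq3[of "x - a" "y - a"] C0 by (intro mult_left_mono) (auto simp: dist_norm)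
    finally show ?thesis .
  qed
  then show "\<exists>B. \<forall>x y. \<bar>bump a x - bump a y\<bar> \<le> B * dist x y" by blast
  have "\<bar>bump a x\<bar> \<le> max 1 C \<and> norm (bump_grad a x) \<le> max 1 C" for x
    using bump_nonneg[of a x] \<phi>_le_1[of "norm (x - a)"] C[of "norm (x - a)"] C0 unfolding norm_bump_grad
    by (auto simp: bump_def indicator_def)
  then show "\<exists>B. \<forall>x. \<bar>bump a x\<bar> \<le> B \<and> norm (bump_grad a x) \<le> B" by blast
  define G where "G x = indicator (ball 0 R - {0}) x * \<psi> (norm x)" for x :: 'a
  have [measurable]: "G \<in> borel_measurable borel" using \<psi>_norm_borel unfolding G_def[abs_def] .
  have "(\<lambda>x. - (G (x - a) / norm (x - a)) *\<^sub>R (x - a)) \<in> borel_measurable borel" by measurable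
  then show "bump_grad a \<in> borel_measurable borel" by (simp add: bump_grad_def[abs_def] G_def)
  have "negligible (insert a (sphere a R))" by (simp add: negligible_insert negligible_sphere)
  then show "\<exists>E. negligible E \<and> (\<forall>x. x \<notin> E \<longrightarrow> (bump a has_derivative (\<lambda>y. bump_grad a x \<bullet> y)) (at x))"
    using bump_has_derivative by blast
qed

lemma bump_energy_le:
  fixes a :: "'a::euclidean_space"
  assumes N: "N = DIM('a)" and \<Omega>: "open \<Omega>" "bounded \<Omega>" "convex \<Omega>" and a: "a \<in> closure \<Omega>"
  shows "(\<integral>x. norm (bump_grad a x) powr p \<partial>lebesgue_on \<Omega>) \<le> \<Lambda> * (\<integral>x. bump a x powr p \<partial>lebesgue_on \<Omega>)" (is "?E \<le> \<Lambda> * ?F")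
    and "\<exists>x\<in>(+) (- a) ` \<Omega>. x \<noteq> 0 \<and> (R / 2 / norm x) *\<^sub>R x \<notin> closure ((+) (- a) ` \<Omega>) \<Longrightarrow>
      (\<integral>x. norm (bump_grad a x) powr p \<partial>lebesgue_on \<Omega>) < \<Lambda> * (\<integral>x. bump a x powr p \<partial>lebesgue_on \<Omega>)"
proof -
  define U where "U = (+) (- a) ` \<Omega>"
  define S where "S = U \<inter> ball 0 R - {0}"
  have Uiff: "y \<in> U \<longleftrightarrow> a + y \<in> \<Omega>" for y unfolding U_def by (force simp: image_iff)
  have U: "open U" "bounded U" unfolding U_def by (rule open_translation[OF \<Omega>(1)], rule bounded_translation[OF \<Omega>(2)])
  have star: "t *\<^sub>R y \<in> U" if "y \<in> U" "0 < t" "t < 1" for y t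
  proof -
    \<comment> \<open>The segment from a point of the closure to an interior point is interior
      except possibly at its first end. So \<open>\<Omega>\<close> is starshaped about
      \<open>a\<close> even if \<open>a\<close> lies on the boundary.\<close>
    have "a - t *\<^sub>R (a - (a + y)) \<in> interior \<Omega>"
      using that \<Omega> a Uiff by (intro mem_interior_closure_convex_shrink) (auto simp: interior_open)
    then show ?thesis using interior_subset by (auto simp: Uiff)
  qed
  have \<Omega>b [measurable]: "\<Omega> \<in> sets borel" using \<Omega>(1) by simp
  have bm [measurable]: "bump a \<in> borel_measurable borel" "bump_grad a \<in> borel_measurable borel"
  proof -
    obtain L where "\<And>x y. \<bar>bump a x - bump a y\<bar> \<le> L * dist x y" and g: "bump_grad a \<in> borel_measurable borel"
      using bump_lipschitz_with_gradient[of a] unfolding lipschitz_with_gradient_def by metis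
    then show "bump a \<in> borel_measurable borel" by (intro continuous_on_borel lipschitz_imp_continuous_on)
    show "bump_grad a \<in> borel_measurable borel" by (rule g)
  qed
  have shift: "(\<integral>x. f x \<partial>lebesgue_on \<Omega>) = (\<integral>y. indicator U y * f (a + y) \<partial>lborel)"
    if [measurable]: "f \<in> borel_measurable borel" for f :: "'a \<Rightarrow> real"
  proof -
    have "(\<integral>x. f x \<partial>lebesgue_on \<Omega>) = (\<integral>x. indicator \<Omega> x *\<^sub>R f x \<partial>lborel)"
      by (rule lebesgue_on_integral_borel(1)[OF \<Omega>b]) measurable
    also have "\<dots> = (\<integral>y. indicator \<Omega> (a + y) * f (a + y) \<partial>lborel)"
      using lborel_integral_affine[of "\<lambda>x. indicator \<Omega> x * f x" 1 a] by simp
    finally show ?thesis by (simp add: indicator_def Uiff)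
  qed
  have 1: "?E = (\<integral>x. indicator S x * \<psi> (norm x) powr p \<partial>lborel)"
  proof -
    have "?E = (\<integral>y. indicator U y * norm (bump_grad a (a + y)) powr p \<partial>lborel)"
      by (rule shift) measurable
    also have "(\<lambda>y. indicator U y * norm (bump_grad a (a + y)) powr p) = (\<lambda>x. indicator S x * \<psi> (norm x) powr p)"
      unfolding norm_bump_grad by (auto simp: fun_eq_iff S_def indicator_def)
    finally show ?thesis .
  qed
  have 2: "?F = (\<integral>x. indicator S x * \<phi> (norm x) powr p \<partial>lborel)"
  proof -
    have "?F = (\<integral>y. indicator U y * bump a (a + y) powr p \<partial>lborel)"
      by (rule shift) measurable
    also have "\<dots> = (\<integral>x. indicator S x * \<phi> (norm x) powr p \<partial>lborel)"
    proof (rule integral_cong_AE)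
      have "AE y in lborel. y \<noteq> (0::'a)" by (rule AE_lborel_singleton)
      then show "AE y in lborel. indicator U y * bump a (a + y) powr p = indicator S y * \<phi> (norm y) powr p"
      proof eventually_elim
        case (elim y)
        then show ?case using \<phi>_eq_0[of "norm y"] by (cases "norm y < R") (auto simp: S_def bump_def indicator_def)
      qed
      have [measurable]: "U \<in> sets borel" "S \<in> sets borel" unfolding S_def using U(1) by (auto intro!: sets.Diff sets.Int)
      show "(\<lambda>y. indicator U y * bump a (a + y) powr p) \<in> borel_measurable lborel" by measurable
      show "(\<lambda>x. indicator S x * \<phi> (norm x) powr p) \<in> borel_measurable lborel" by measurable
    qed
    finally show ?thesis .
  qed
  note E = energy_le[OF N U, folded S_def]
  show "?E \<le> \<Lambda> * ?F"
    unfolding 1 2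
  proof (rule E(1))
    show "t *\<^sub>R y \<in> U" if "y \<in> U" "0 < t" "t < 1" for y t using that by (rule star)
  qed
  show "?E < \<Lambda> * ?F"
    if "\<exists>x\<in>(+) (- a) ` \<Omega>. x \<noteq> 0 \<and> (R / 2 / norm x) *\<^sub>R x \<notin> closure ((+) (- a) ` \<Omega>)"
    unfolding 1 2
  proof (rule E(2)[OF _ that[folded U_def]])
    show "t *\<^sub>R y \<in> U" if "y \<in> U" "0 < t" "t < 1" for y t using that by (rule star)
  qed
qed

text \<open>The balls of radius \<open>R\<close> about \<open>a\<close> and \<open>b\<close> are
  disjoint. The level \<open>t\<close> may exceed the eigenvalue of the profile, so that strictness
  can come either from the volume ratio or from the energy inequality.\<close>

lemma mu_less:
  fixes a b :: "'a::euclidean_space"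
  assumes N: "N = DIM('a)" and \<Omega>: "open \<Omega>" "bounded \<Omega>" "convex \<Omega>"
    and ab: "a \<in> closure \<Omega>" "b \<in> closure \<Omega>" "dist a b = 2 * R"
    and less: "\<And>c. c \<in> {a, b} \<Longrightarrow>
      (\<integral>x. norm (bump_grad c x) powr p \<partial>lebesgue_on \<Omega>) < t * (\<integral>x. bump c x powr p \<partial>lebesgue_on \<Omega>)"
  shows "mu p \<Omega> < ereal t"
proof (rule mu_less_of_disjoint_supports[where Va = "\<Omega> \<inter> ball a R" and Vb = "\<Omega> \<inter> ball b R",
      OF p \<Omega>(1,2) bump_lipschitz_with_gradient bump_lipschitz_with_gradient])
  have ne: "\<Omega> \<inter> ball c R \<noteq> {}" if "c \<in> closure \<Omega>" for c
    by (rule Int_ball_nonempty[OF that R])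
  show "\<Omega> \<inter> ball a R \<noteq> {}" "\<Omega> \<inter> ball b R \<noteq> {}" using ne ab by auto
  have z: "bump c x = 0 \<and> bump_grad c x = 0" if "R \<le> norm (x - c)" for c x :: 'a
    using that \<phi>_eq_0 by (simp add: bump_def bump_grad_def)
  show "bump a x = 0 \<and> bump_grad a x = 0 \<or> bump b x = 0 \<and> bump_grad b x = 0" for x
  proof -
    have "R \<le> norm (x - a) \<or> R \<le> norm (x - b)"
      using ab(3) dist_triangle[of a b x] by (auto simp: dist_norm norm_minus_commute)
    then show ?thesis using z by blast
  qed
  show "0 < bump a x" if "x \<in> \<Omega> \<inter> ball a R" for x
    using that \<phi>_pos[of "norm (x - a)"] by (simp add: bump_def dist_norm norm_minus_commute)
  show "0 < bump b x" if "x \<in> \<Omega> \<inter> ball b R" for x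
    using that \<phi>_pos[of "norm (x - b)"] by (simp add: bump_def dist_norm norm_minus_commute)
qed (use \<Omega>(1) less bump_nonneg in auto)

lemma bump_integral_pos:
  fixes a :: "'a::euclidean_space"
  assumes \<Omega>: "open \<Omega>" "bounded \<Omega>" and a: "a \<in> closure \<Omega>"
  shows "0 < (\<integral>x. bump a x powr p \<partial>lebesgue_on \<Omega>)"
proof (rule integral_powr_pos[OF \<Omega>(1)])
  show "\<Omega> \<inter> ball a R \<noteq> {}" by (rule Int_ball_nonempty[OF a R])
  show "0 < bump a x" if "x \<in> \<Omega> \<inter> ball a R" for x
    using that \<phi>_pos[of "norm (x - a)"] by (simp add: bump_def dist_norm norm_minus_commute)
  show "integrable (lebesgue_on \<Omega>) (\<lambda>x. bump a x powr p)"
    using lipschitz_with_gradient_integrable(1)[OF bump_lipschitz_with_gradient \<Omega>, of p a] p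
    unfolding abs_of_nonneg[OF bump_nonneg] by simp
qed (use \<Omega> in auto)

end

theorem corollary3p2:
  fixes \<Omega> :: "'a::euclidean_space set" and c :: 'a and r p :: real
  assumes "DIM('a) \<ge> 2"
    and "open \<Omega>" and "bounded \<Omega>" and "convex \<Omega>" and "\<Omega> \<noteq> {}"
    and "1 < p" and "0 < r"
  shows "mu p \<Omega> < lambda p (ball c r) *
    ereal ((measure lebesgue (ball c r) / measure lebesgue \<Omega>) powr (p / real DIM('a)))"
proof -
  let ?V = "measure lebesgue :: 'a set \<Rightarrow> real" and ?N = "DIM('a)"
  note \<Omega> = assms(2,3,4)
  have cpt: "compact (closure \<Omega>)" using assms(3) by simp
  obtain a b where ab: "a \<in> closure \<Omega>" "b \<in> closure \<Omega>" "dist a b = diameter (closure \<Omega>)"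
    using diameter_compact_attained[OF cpt] assms(5) by auto
  define R where "R = dist a b / 2"
  have diam: "dist x y \<le> 2 * R" if "x \<in> closure \<Omega>" "y \<in> closure \<Omega>" for x y
    using diameter_bounded_bound[OF compact_imp_bounded[OF cpt] that] ab(3) by (simp add: R_def)
  have R: "0 < R"
  proof (rule ccontr)
    assume "\<not> 0 < R"
    have "dist x y \<le> 0" if "x \<in> \<Omega>" "y \<in> \<Omega>" for x y
    proof -
      have "dist x y \<le> 2 * R" using that closure_subset[of \<Omega>] by (intro diam) auto
      then show ?thesis using \<open>\<not> 0 < R\<close> by linarith
    qed
    moreover obtain x where x: "x \<in> \<Omega>" using assms(5) by blast
    ultimately have "\<Omega> = {x}" by fastforce
    then show False using assms(2) not_open_singleton[of x] by simp
  qed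
  have Vp: "0 < ?V \<Omega>" using assms by (intro open_measure_pos)
  obtain R1 where R1: "0 < R1" "\<And>R. 0 < R \<Longrightarrow> \<exists>h \<phi>. radial_profile ?N p ((R1 / R) powr p) R h \<phi>"
    using radial_profile_exists[of ?N p] assms(1,6) by auto
  \<comment> \<open>The right-hand side of the claim with the eigenvalue of the ball replaced by the
    lower bound \<open>(R1 / r) powr p\<close>.\<close>
  define t where "t = (R1 / r) powr p * (?V (ball c r) / ?V \<Omega>) powr (p / real ?N)"
  have lam: "ereal ((R1 / r) powr p) \<le> lambda p (ball c r)"
    using R1(2)[OF assms(7)] lambda_ball_ge by blast
  \<comment> \<open>The radius \<open>r\<close> cancels, because the volume scales with
    \<open>r ^ DIM('a)\<close> and the eigenvalue with \<open>r powr (- p)\<close>. In this form the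
    isodiametric inequality says that \<open>t\<close> is at least the eigenvalue at radius
    \<open>R\<close>.\<close>
  have t_eq: "t = (R1 / R) powr p * (?V (ball (0::'a) R) / ?V \<Omega>) powr (p / real ?N)"
  proof -
    have "?V (ball c r) = (r / R) ^ ?N * ?V (ball (0::'a) R)"
      using R assms(7) by (simp add: content_ball power_divide)
    then have "?V (ball c r) / ?V \<Omega> = (r / R) ^ ?N * (?V (ball (0::'a) R) / ?V \<Omega>)" by simp
    moreover have "((r / R) ^ ?N) powr (p / real ?N) = (r / R) powr p"
      using R assms(7) by (simp add: powr_powr flip: powr_realpow)
    ultimately have "(?V (ball c r) / ?V \<Omega>) powr (p / real ?N)
      = (r / R) powr p * (?V (ball (0::'a) R) / ?V \<Omega>) powr (p / real ?N)"
      by (simp only: powr_mult)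
    then have "t = (R1 / r * (r / R)) powr p * (?V (ball (0::'a) R) / ?V \<Omega>) powr (p / real ?N)"
      unfolding t_def by (simp only: powr_mult mult.assoc)
    then show ?thesis using assms(7) by simp
  qed
  obtain h \<phi> where prof: "radial_profile ?N p ((R1 / R) powr p) R h \<phi>" using R1(2)[OF R] by blast
  interpret radial_profile ?N p "(R1 / R) powr p" R h \<phi> by (rule prof)
  have iso: "?V \<Omega> \<le> ?V (ball (0::'a) R)"
    and width: "?V \<Omega> = ?V (ball (0::'a) R) \<Longrightarrow> norm z \<le> 2 * R \<Longrightarrow> \<exists>a\<in>closure \<Omega>. \<exists>b\<in>closure \<Omega>. a - b = z" for z
  proof -
    have d: "dist x y \<le> 2 * R" if "x \<in> \<Omega>" "y \<in> \<Omega>" for x y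
      using that closure_subset[of \<Omega>] by (intro diam) auto
    show "?V \<Omega> \<le> ?V (ball (0::'a) R)" by (rule isodiametric(1)[OF assms(2,3,5) R d])
    show "\<exists>a\<in>closure \<Omega>. \<exists>b\<in>closure \<Omega>. a - b = z" if "?V \<Omega> = ?V (ball (0::'a) R)" "norm z \<le> 2 * R"
      by (rule isodiametric(2)[OF assms(2,3,5) R d that])
  qed
  have "mu p \<Omega> < ereal t"
  proof (rule mu_less[OF refl \<Omega> ab(1,2)])
    show "dist a b = 2 * R" by (simp add: R_def)
    fix x assume "x \<in> {a, b}"
    then obtain y where x: "x \<in> closure \<Omega>" and y: "y \<in> closure \<Omega>" "dist x y = 2 * R"
      using ab by (auto simp: R_def dist_commute)
    note E = bump_energy_le[OF refl \<Omega> x]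
    show "(\<integral>z. norm (bump_grad x z) powr p \<partial>lebesgue_on \<Omega>) < t * (\<integral>z. bump x z powr p \<partial>lebesgue_on \<Omega>)"
    proof (cases "?V \<Omega> = ?V (ball (0::'a) R)")
      case True
      have cl: "closure ((+) (- x) ` \<Omega>) = (+) (- x) ` closure \<Omega>" by (rule closure_translation)
      \<comment> \<open>The end \<open>x\<close> of the diameter is moved to the origin and the
        other end plays the role of the far point; the rays are tested at distance
        \<open>R / 2\<close>, as the strict energy inequality requires.\<close>
      have "\<exists>z\<in>(+) (- x) ` \<Omega>. z \<noteq> 0 \<and> (R / 2 / norm z) *\<^sub>R z \<notin> closure ((+) (- x) ` \<Omega>)"
      proof (rule exists_short_ray[OF assms(1)])
        show "0 \<in> closure ((+) (- x) ` \<Omega>)" using x unfolding cl by (auto simp: image_iff intro!: bexI[of _ x])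
        show "- x + y \<in> closure ((+) (- x) ` \<Omega>)" using y unfolding cl by blast
        show "norm (- x + y) = 2 * R" using y(2) by (simp add: dist_norm norm_minus_commute)
        show "dist u v \<le> 2 * R" if uv: "u \<in> closure ((+) (- x) ` \<Omega>)" "v \<in> closure ((+) (- x) ` \<Omega>)" for u v
        proof -
          obtain u' v' where "u' \<in> closure \<Omega>" "v' \<in> closure \<Omega>" "u = - x + u'" "v = - x + v'"
            using uv unfolding cl by blast
          then show ?thesis using diam[of u' v'] by (simp add: dist_norm)
        qed
        show "\<exists>a\<in>closure ((+) (- x) ` \<Omega>). \<exists>b\<in>closure ((+) (- x) ` \<Omega>). a - b = n" if n: "norm n = 2 * R" for n
        proof -
          obtain u v where "u \<in> closure \<Omega>" "v \<in> closure \<Omega>" "u - v = n" using width[OF True, of n] n by auto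
          then show ?thesis unfolding cl by (intro bexI[of _ "- x + u"] bexI[of _ "- x + v"]) auto
        qed
        show "open ((+) (- x) ` \<Omega>)" by (rule open_translation[OF \<Omega>(1)])
        show "bounded ((+) (- x) ` \<Omega>)" by (rule bounded_translation[OF \<Omega>(2)])
      qed (use assms(5) R in auto)
      then have "(\<integral>z. norm (bump_grad x z) powr p \<partial>lebesgue_on \<Omega>) < (R1 / R) powr p * (\<integral>z. bump x z powr p \<partial>lebesgue_on \<Omega>)"
        by (rule E(2))
      also have "(R1 / R) powr p = t" unfolding t_eq True[symmetric] using Vp by simp
      finally show ?thesis .
    next
      case False
      then have "1 < ?V (ball (0::'a) R) / ?V \<Omega>" using iso Vp by simp
      then have "1 < (?V (ball (0::'a) R) / ?V \<Omega>) powr (p / real ?N)" using p by (intro gr_one_powr) auto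
      then have "(R1 / R) powr p < t" unfolding t_eq using \<Lambda> mult_strict_left_mono[of 1 _ "(R1 / R) powr p"] by simp
      then have "(R1 / R) powr p * (\<integral>z. bump x z powr p \<partial>lebesgue_on \<Omega>) < t * (\<integral>z. bump x z powr p \<partial>lebesgue_on \<Omega>)"
        using bump_integral_pos[OF \<Omega>(1,2) x] by (rule mult_strict_right_mono)
      with E(1) show ?thesis by (rule le_less_trans)
    qed
  qed
  also have "ereal t = ereal ((R1 / r) powr p) * ereal ((?V (ball c r) / ?V \<Omega>) powr (p / real ?N))"
    by (simp add: t_def)
  also have "\<dots> \<le> lambda p (ball c r) * ereal ((?V (ball c r) / ?V \<Omega>) powr (p / real ?N))"
    by (intro ereal_mult_right_mono lam) simp
  finally show ?thesis .
qed

end
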